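(* Let $A=\mathbb{k}Q/I$ be a toupie algebra, and let $p:\mathbb{B}'_*\to\mathbb{T}_*$, $i:\mathbb{T}_*\to\mathbb{B}'_*$ and $h:\mathbb{B}'_*\to\mathbb{B}'_{*+1}$ be the maps given by sums of weights of zigzag paths for the Morse matching $\mathcal{M}$ described in the context. Then for every attached bar term $\gamma=[w_0|\cdots|w_r]$, with associated terms $\gamma^1,\dots,\gamma^n$ and $\gamma=\Gamma^0,\Gamma^1,\dots,\Gamma^n$, $$h(\gamma)=\sum_{j=1}^n\gamma^j,\qquad p(\gamma)=\Gamma^n,$$ and for every chain $w=[w_0|\cdots|w_r]$, $$i(w)=\begin{cases}w,& r\neq1,\\ \displaystyle\sum_{p_1p_2\in\mathrm{Supp}(\mathrm{Tip}^{-1}(w_0w_1)),\ p_1\in Q_1}c(p_1p_2)\,[p_1|p_2],& r=1.\end{cases}$$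
   Context: $\mathbb{k}$ is a field of characteristic zero. Paths are written from left to right, $Q$ also denotes the set of paths, $Q_n$ the paths of length $n$, $l(p)$ is the length of $p$, $E=\mathbb{k}Q_0$. $\mathrm{Supp}(a)$ is the set of paths occurring in $a\in\mathbb{k}Q$ with nonzero coefficient. **Toupie algebras.** A finite quiver $Q$ is toupie if it has a unique source $0$ and a unique sink $\omega$ and every other vertex is the source of exactly one arrow and the target of exactly one arrow. A toupie algebra is $A=\mathbb{k}Q/I$ with $Q$ toupie and $I$ admissible. Branches are the paths from $0$ to $\omega$; they are ordered as $B_1$ (arrows, $\alpha^{(1)},\dots,\alpha^{(a)}$), $B_2$ (length $>1$, involved in no relation, next $l$ ones), $B_3$ (containing monomial relations, next $m$ ones), $B_4=\{\alpha^{(a+l+m+1)},\dots,\alpha^{(a+l+m+n)}\}$ (involved in non monomial relations, listed with non-increasing lengths). The non monomial relations are taken in reduced row echelon form: $\rho_i=\alpha^{(a+l+m+k_i)}+\sum_{j>k_i}a_{ij}\alpha^{(a+l+m+j)}$, $1\le i\le r$ (coefficient matrix reduced of rank $r$). $\mathrm{Tip}(\rho_i)=\alpha^{(a+l+m+k_i)}$, $\mathrm{Tip}^{-1}(\alpha^{(a+l+m+k_i)})=\rho_i$, and $c(\cdot)$ denotes the coefficient of a branch in $\rho_i$. $\mathcal{G}=\mathcal{G}_{mon}\sqcup\mathcal{G}_{nomon}$ is a minimal generating set of $I$ with $\mathcal{G}_{nomon}=\{\rho_i\}$ and $\mathcal{G}_{mon}$ consisting of paths; for $u\in\mathcal{G}_{mon}$,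 $\mathrm{Tip}(u)=\mathrm{Tip}^{-1}(u)=u$ and $c(u)=1$. $W=\mathrm{Tip}\,\mathcal{G}=\mathcal{G}_{mon}\cup\{\mathrm{Tip}(\rho_i)\}$, and $\mathrm{NonTip}(I)$ is the set of paths having no subpath in $W$; it gives a basis of $A$. **Chains.** The Uf-graph $Q_W$ has vertex set $Q_0\cup Q_1\cup\{\text{proper right factors of elements of }W\}$ and arrows $e\to x$ for $e\in Q_0$, $x=ex\in Q_1$, and $u\to v$ whenever the path $uv$ lies in $\langle W\rangle$ but every proper left factor of $uv$ (i.e. $w$ with $uv=wp$, $l(p)\ge1$) does not. $W^{(i)}$, the set of $i$-chains ($i\ge0$), consists of the sequences $[w_1|\cdots|w_{i+1}]$ with $w_k\in\mathrm{NonTip}(I)\setminus Q_0$ such that $e\to w_1\to\cdots\to w_{i+1}$ is a path in $Q_W$ ($e\in Q_0$); $W^{(-1)}=Q_0$. $V_{q,i}^{(n)}$ is the set of $[w_1|\cdots|w_n]$ with $w_1\cdots w_n=q$, $[w_1|\cdots|w_{i+1}]\in W^{(i)}$ and $[w_1|\cdots|w_{i+2}]\notin W^{(i+1)}$. **Complexes and maps.** $\mathbb{B}'_*=E\otimes_A\mathbb{B}_*\otimes_AE$, where $\mathbb{B}_*$ is the reduced bar resolution of $A$; $\mathbb{B}'_n$ ($n\ge1$) has as basis the bar terms $[a_1|\cdots|a_n]$ with $a_j\in\mathrm{NonTip}(I)\setminus Q_0$ and $a_1\cdots a_n$ a path, with $d([a_1|\cdots|a_n])=\sum_{j=1}^{n-1}(-1)^j[a_1|\cdots|a_ja_{j+1}|\cdots|a_n]$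 (products in $A$, expanded in the basis). Let $G$ be the quiver with vertices the bar terms and an arrow $x\to y$ weighted by the nonzero coefficient of $y$ in $d(x)$. $\mathcal{M}$ is the set of arrows $[w_1|\cdots|w_{i+1}|w'_{i+2}|w''_{i+2}|w_{i+3}|\cdots|w_n]\to[w_1|\cdots|w_{i+2}|\cdots|w_n]$ with $w_{i+2}=w'_{i+2}w''_{i+2}$ (weight $(-1)^{i+2}$), source in $V_{q,i+1}^{(n+1)}$ and target in $V_{q,i}^{(n)}$, $q=w_1\cdots w_n$. This is a Morse matching whose critical vertices in degree $n$ are $W^{(n-1)}$. Reverse each arrow of $\mathcal{M}$ (making it dotted) and replace its weight by the negative inverse; a zigzag path is one in which dotted and undotted arrows alternate (trivial paths are allowed, with weight $1$), and its weight is the product of the weights of its arrows. $\mathbb{T}_n=\mathbb{k}W^{(n-1)}=\mathrm{Tor}_n^A(E,E)$ (zero differential). For a bar term $x$ of degree $n$: $p(x)$ is the sum over critical $y$ of degree $n$, and $h(x)$ the sum over all $y$ of degree $n+1$, of $y$ times the total weight of zigzag paths from $x$ to $y$; for critical $x$, $i(x)$ is the same sum over all $y$ of degree $n$. **Attached terms.** A bar term $[w_0|\cdots|w_r]$ is attached if each path $w_{j-1}w_j$, $1\le j\le r$, has a subpath in $W$ (so $w_{j-1}w_j=0$ in $A$ if $r>1$). Let $\gamma=[w_0|\cdots|w_r]$ be attached and put $\Gamma^0=\gamma$. If $\gamma$ is a chain, then $n=0$. Otherwise there is a largest $i_1$ such that $w_{i_1}=w'_{i_1}w''_{i_1}$ (proper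 factorization) with $\eta^1=[w_0|\cdots|w_{i_1-1}|w'_{i_1}]$ a chain (if $i_1=0$, $w'_0$ is the first arrow of $w_0$); set $\gamma^1=(-1)^{i_1}[\eta^1|w''_{i_1}|w_{i_1+1}|\cdots|w_r]$ and $\Gamma^1=[\eta^1|w''_{i_1}w_{i_1+1}|w_{i_1+2}|\cdots|w_r]$, where $\Gamma^1:=0$ if $i_1=r$ or the product is zero in $A$. If $\Gamma^1$ is a chain or zero, stop ($n=1$). Otherwise repeat with $\Gamma^1$: take the largest $i_2>i_1$ such that splitting the entry at (0-based) position $i_2$ of $\Gamma^1$ as $w'_{i_2}w''_{i_2}$ gives a chain $\eta^2$ ending in $w'_{i_2}$, and set $\gamma^2=(-1)^{i_2}[\eta^2|w''_{i_2}|w_{i_2+1}|\cdots|w_r]$, $\Gamma^2=[\eta^2|w''_{i_2}w_{i_2+1}|\cdots|w_r]$ (zero if $i_2=r$), and so on, until $\Gamma^n$ is zero or a chain. *)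

theory Defs
  imports
    "Graph_Theory.Arc_Walk"
    "HOL-Algebra.QuotRing"
    "HOL-Library.Poly_Mapping"
begin

section \<open>Path algebras\<close>

text \<open>A path is its starting vertex together with its list of arrows, read from left to right.
  The trivial path at \<open>v\<close> is \<open>(v, [])\<close>; \<open>tgt\<close> and \<open>pcomp\<close> are
  only meaningful on paths, respectively on composable paths.\<close>

type_synonym ('v, 'e) path = "'v \<times> 'e list"

definition paths :: "('v, 'e) pre_digraph \<Rightarrow> ('v, 'e) path set" where
  "paths Q = {(u, p). \<exists>v. pre_digraph.awalk Q u p v}"

definition tgt :: "('v, 'e) pre_digraph \<Rightarrow> ('v, 'e) path \<Rightarrow> 'v" where
  "tgt Q p = pre_digraph.awlast Q (fst p) (snd p)"

abbreviation len :: "('v, 'e) path \<Rightarrow> nat" where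
  "len p \<equiv> length (snd p)"

definition composable :: "('v, 'e) pre_digraph \<Rightarrow> ('v, 'e) path \<Rightarrow> ('v, 'e) path \<Rightarrow> bool" where
  "composable Q p q \<longleftrightarrow> tgt Q p = fst q"

definition pcomp :: "('v, 'e) path \<Rightarrow> ('v, 'e) path \<Rightarrow> ('v, 'e) path" where
  "pcomp p q = (fst p, snd p @ snd q)"

definition subpath :: "('v, 'e) pre_digraph \<Rightarrow> ('v, 'e) path \<Rightarrow> ('v, 'e) path \<Rightarrow> bool" where
  "subpath Q w p \<longleftrightarrow> w \<in> paths Q \<and>
     (\<exists>x\<in>paths Q. \<exists>y\<in>paths Q. composable Q x w \<and> composable Q w y \<and> p = pcomp (pcomp x w) y)"

definition path_algebra ::
    "('v, 'e) pre_digraph \<Rightarrow> (('v, 'e) path \<Rightarrow>\<^sub>0 'k::field) ring" where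
  "path_algebra Q =
     \<lparr>carrier = {x. Poly_Mapping.keys x \<subseteq> paths Q},
      mult = (\<lambda>x y. \<Sum>p\<in>Poly_Mapping.keys x. \<Sum>q\<in>Poly_Mapping.keys y.
                if composable Q p q
                then Poly_Mapping.single (pcomp p q) (Poly_Mapping.lookup x p * Poly_Mapping.lookup y q)
                else 0),
      one = (\<Sum>v\<in>verts Q. Poly_Mapping.single (v, []) 1),
      zero = 0,
      add = (+)\<rparr>"

text \<open>The \<open>m\<close>-th power of the arrow ideal is spanned by the paths of length at least \<open>m\<close>.\<close>

definition arrow_ideal_pow ::
    "('v, 'e) pre_digraph \<Rightarrow> nat \<Rightarrow> (('v, 'e) path \<Rightarrow>\<^sub>0 'k::field) set" where
  "arrow_ideal_pow Q m =
     {x \<in> carrier (path_algebra Q). \<forall>p\<in>Poly_Mapping.keys x. m \<le> len p}"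

definition admissible ::
    "('v, 'e) pre_digraph \<Rightarrow> (('v, 'e) path \<Rightarrow>\<^sub>0 'k::field) set \<Rightarrow> bool" where
  "admissible Q I \<longleftrightarrow> ideal I (path_algebra Q) \<and> I \<subseteq> arrow_ideal_pow Q 2 \<and>
     (\<exists>N\<ge>2. arrow_ideal_pow Q N \<subseteq> I)"


section \<open>Toupie algebras\<close>

definition toupie :: "('v, 'e) pre_digraph \<Rightarrow> 'v \<Rightarrow> 'v \<Rightarrow> bool" where
  "toupie Q s t \<longleftrightarrow> fin_digraph Q \<and>
     {v \<in> verts Q. in_arcs Q v = {}} = {s} \<and>
     {v \<in> verts Q. out_arcs Q v = {}} = {t} \<and>
     (\<forall>v \<in> verts Q - {s, t}. out_degree Q v = 1 \<and> in_degree Q v = 1)"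

definition branches :: "('v, 'e) pre_digraph \<Rightarrow> 'v \<Rightarrow> 'v \<Rightarrow> ('v, 'e) path set" where
  "branches Q s t = {p \<in> paths Q. fst p = s \<and> tgt Q p = t \<and> 1 \<le> len p}"

text \<open>A toupie algebra together with the choices made to present it: the ideal \<open>I\<close>
  (\<open>rel_ideal\<close>), the cardinalities \<open>a, l, m, n\<close> of the four groups of branches
  (\<open>num1\<close>, \dots, \<open>num4\<close>), the enumeration \<open>\<alpha>\<close> of the branches (\<open>branch\<close>,
  indexed from 1), the number \<open>r\<close> of non monomial relations, the pivots \<open>k\<^sub>i\<close>,
  the coefficients \<open>a\<^sub>i\<^sub>j\<close> (used only for \<open>j > k\<^sub>i\<close>)
  and the set of monomial relations.\<close>

record (overloaded) ('v, 'e, 'k) toupie_data =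
  quiver :: "('v, 'e) pre_digraph"
  source :: 'v
  sink :: 'v
  rel_ideal :: "(('v, 'e) path \<Rightarrow>\<^sub>0 'k::field_char_0) set"
  num1 :: nat
  num2 :: nat
  num3 :: nat
  num4 :: nat
  branch :: "nat \<Rightarrow> ('v, 'e) path"
  num_rels :: nat
  pivot :: "nat \<Rightarrow> nat"
  coef :: "nat \<Rightarrow> nat \<Rightarrow> 'k"
  mon_rels :: "('v, 'e) path set"

context
  fixes T :: "('v, 'e, 'k::field_char_0) toupie_data"
begin

definition branch4 :: "nat \<Rightarrow> ('v, 'e) path" where
  "branch4 j = branch T (num1 T + num2 T + num3 T + j)"

definition rho :: "nat \<Rightarrow> (('v, 'e) path \<Rightarrow>\<^sub>0 'k)" where
  "rho i = Poly_Mapping.single (branch4 (pivot T i)) 1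
     + (\<Sum>j\<in>{pivot T i<..num4 T}. Poly_Mapping.single (branch4 j) (coef T i j))"

definition gens :: "(('v, 'e) path \<Rightarrow>\<^sub>0 'k) set" where
  "gens = (\<lambda>u. Poly_Mapping.single u 1) ` mon_rels T \<union> rho ` {1..num_rels T}"

definition toupie_algebra :: bool where
  "toupie_algebra \<longleftrightarrow>
     toupie (quiver T) (source T) (sink T) \<and>
     admissible (quiver T) (rel_ideal T) \<and>
     \<comment> \<open>the four groups of branches\<close>
     (let B = branches (quiver T) (source T) (sink T);
          a = num1 T; l = num2 T; m = num3 T; n = num4 T
      in bij_betw (branch T) {1..a + l + m + n} B \<and>
         branch T ` {1..a} = {p \<in> B. len p = 1} \<and>
         branch T ` {a + 1..a + l} =
           {p \<in> B. 1 < len p \<and>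
              (\<forall>g\<in>gens. \<forall>u\<in>Poly_Mapping.keys g. \<not> subpath (quiver T) u p)} \<and>
         branch T ` {a + l + 1..a + l + m} =
           {p \<in> B. \<exists>u\<in>mon_rels T. subpath (quiver T) u p} \<and>
         branch T ` {a + l + m + 1..a + l + m + n} =
           {p \<in> B. \<exists>i\<in>{1..num_rels T}. p \<in> Poly_Mapping.keys (rho i)} \<and>
         (\<forall>j\<in>{1..<n}. len (branch4 (j + 1)) \<le> len (branch4 j))) \<and>
     \<comment> \<open>the non monomial relations, in reduced row echelon form\<close>
     strict_mono_on {1..num_rels T} (pivot T) \<and>
     pivot T ` {1..num_rels T} \<subseteq> {1..num4 T} \<and>
     (\<forall>i\<in>{1..num_rels T}. \<forall>i'\<in>{1..num_rels T}. i < i' \<longrightarrow> coef T i (pivot T i') = 0) \<and>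
     (\<forall>i\<in>{1..num_rels T}. 2 \<le> card (Poly_Mapping.keys (rho i))) \<and>
     \<comment> \<open>minimal generating set\<close>
     mon_rels T \<subseteq> paths (quiver T) \<and>
     Idl\<^bsub>path_algebra (quiver T)\<^esub> gens = rel_ideal T \<and>
     (\<forall>S. S \<subset> gens \<longrightarrow> Idl\<^bsub>path_algebra (quiver T)\<^esub> S \<noteq> rel_ideal T)"

definition tips :: "('v, 'e) path set" where
  "tips = mon_rels T \<union> (\<lambda>i. branch4 (pivot T i)) ` {1..num_rels T}"

text \<open>\<open>Tip\<^sup>-\<^sup>1\<close> on the elements of \<open>tips\<close>.\<close>

definition tip_inv :: "('v, 'e) path \<Rightarrow> (('v, 'e) path \<Rightarrow>\<^sub>0 'k)" where
  "tip_inv w =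
     (if w \<in> mon_rels T then Poly_Mapping.single w 1
      else rho (THE i. i \<in> {1..num_rels T} \<and> branch4 (pivot T i) = w))"

definition nontip :: "('v, 'e) path set" where
  "nontip = {p \<in> paths (quiver T). \<forall>w\<in>tips. \<not> subpath (quiver T) w p}"

abbreviation toupie_quot :: "(('v, 'e) path \<Rightarrow>\<^sub>0 'k) set ring" where
  "toupie_quot \<equiv> path_algebra (quiver T) Quot rel_ideal T"

definition path_class :: "('v, 'e) path \<Rightarrow> (('v, 'e) path \<Rightarrow>\<^sub>0 'k) set" where
  "path_class p = rel_ideal T +>\<^bsub>path_algebra (quiver T)\<^esub> Poly_Mapping.single p 1"

text \<open>Expansion of an element of \<open>A = kQ/I\<close> in the basis given by \<open>nontip\<close>.\<close>

definition expand :: "(('v, 'e) path \<Rightarrow>\<^sub>0 'k) set \<Rightarrow> (('v, 'e) path \<Rightarrow>\<^sub>0 'k)" where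
  "expand C = (THE y. y \<in> C \<and> Poly_Mapping.keys y \<subseteq> nontip)"


section \<open>Chains\<close>

definition in_tip_ideal :: "('v, 'e) path \<Rightarrow> bool" where
  "in_tip_ideal p \<longleftrightarrow> Poly_Mapping.single p (1::'k) \<in>
     Idl\<^bsub>path_algebra (quiver T)\<^esub> ((\<lambda>w. Poly_Mapping.single w 1) ` tips)"

definition uf_verts :: "('v, 'e) path set" where
  "uf_verts = {p \<in> paths (quiver T). len p = 0 \<or> len p = 1 \<or>
     (\<exists>u\<in>paths (quiver T). 1 \<le> len u \<and> composable (quiver T) u p \<and> pcomp u p \<in> tips)}"

definition uf_arrow :: "('v, 'e) path \<Rightarrow> ('v, 'e) path \<Rightarrow> bool" where
  "uf_arrow u v \<longleftrightarrow> u \<in> uf_verts \<and> v \<in> uf_verts \<and> composable (quiver T) u v \<and>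
     (len u = 0 \<and> len v = 1 \<or>
      in_tip_ideal (pcomp u v) \<and>
      (\<forall>w\<in>paths (quiver T). \<forall>p\<in>paths (quiver T).
         composable (quiver T) w p \<and> pcomp u v = pcomp w p \<and> 1 \<le> len p \<longrightarrow> \<not> in_tip_ideal w))"

text \<open>A bar term \<open>[w\<^sub>1|\<dots>|w\<^sub>n]\<close> is represented by \<open>(e, [w\<^sub>1, \<dots>, w\<^sub>n])\<close> where \<open>e\<close>
  is the vertex at which \<open>w\<^sub>1\<close> starts, so that the terms \<open>(e, [])\<close> of degree 0 are the
  vertices of the quiver, as required by \<open>E = kQ\<^sub>0\<close>. The set \<open>chain_terms n\<close> is \<open>W\<close> with
  upper index \<open>n - 1\<close>: degrees count entries.\<close>

definition bar_terms :: "nat \<Rightarrow> ('v \<times> ('v, 'e) path list) set" where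
  "bar_terms n = {(e, ws). e \<in> verts (quiver T) \<and> length ws = n \<and>
     set ws \<subseteq> {w \<in> nontip. 1 \<le> len w} \<and>
     successively (composable (quiver T)) ((e, []) # ws)}"

definition chain_terms :: "nat \<Rightarrow> ('v \<times> ('v, 'e) path list) set" where
  "chain_terms n = {(e, ws). e \<in> verts (quiver T) \<and> length ws = n \<and>
     set ws \<subseteq> {w \<in> nontip. 1 \<le> len w} \<and>
     successively uf_arrow ((e, []) # ws)}"

abbreviation is_chain :: "'v \<times> ('v, 'e) path list \<Rightarrow> bool" where
  "is_chain x \<equiv> x \<in> chain_terms (length (snd x))"

text \<open>\<open>Vset q k n\<close> is the set with lower indices \<open>q, k - 1\<close> and upper index \<open>n\<close>:
  exactly the first \<open>k\<close> entries form a chain.\<close>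

definition Vset :: "('v, 'e) path \<Rightarrow> nat \<Rightarrow> nat \<Rightarrow> ('v \<times> ('v, 'e) path list) set" where
  "Vset q k n = {(e, ws) \<in> bar_terms n. (e, concat (map snd ws)) = q \<and> k \<le> n \<and>
     is_chain (e, take k ws) \<and> (k < n \<longrightarrow> \<not> is_chain (e, take (k + 1) ws))}"


section \<open>The reduced bar complex, the Morse matching and the maps h, p and i\<close>

definition bar_diff ::
    "'v \<times> ('v, 'e) path list \<Rightarrow> ('v \<times> ('v, 'e) path list) \<Rightarrow>\<^sub>0 'k" where
  "bar_diff x = (case x of (e, ws) \<Rightarrow>
     \<Sum>j\<in>{1..<length ws}.
       let y = expand (path_class (ws ! (j - 1)) \<otimes>\<^bsub>toupie_quot\<^esub> path_class (ws ! j))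
       in \<Sum>b\<in>Poly_Mapping.keys y.
            Poly_Mapping.single (e, take (j - 1) ws @ b # drop (j + 1) ws)
              ((-1) ^ j * Poly_Mapping.lookup y b))"

definition bar_weight ::
    "'v \<times> ('v, 'e) path list \<Rightarrow> 'v \<times> ('v, 'e) path list \<Rightarrow> 'k" where
  "bar_weight x y = Poly_Mapping.lookup (bar_diff x) y"

definition bar_arrow ::
    "'v \<times> ('v, 'e) path list \<Rightarrow> 'v \<times> ('v, 'e) path list \<Rightarrow> bool" where
  "bar_arrow x y \<longleftrightarrow> (\<exists>n. x \<in> bar_terms n) \<and> (\<exists>n. y \<in> bar_terms n) \<and> bar_weight x y \<noteq> 0"

text \<open>In \<open>matched x y\<close> the index \<open>k\<close> is \<open>i + 1\<close>, that is, the 0-based position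
  of the entry of \<open>y\<close> which is factored in \<open>x\<close>.\<close>

definition matched ::
    "'v \<times> ('v, 'e) path list \<Rightarrow> 'v \<times> ('v, 'e) path list \<Rightarrow> bool" where
  "matched x y \<longleftrightarrow> bar_arrow x y \<and>
     (\<exists>e ws k w' w'' q. y = (e, ws) \<and> k < length ws \<and>
        w' \<in> paths (quiver T) \<and> w'' \<in> paths (quiver T) \<and> composable (quiver T) w' w'' \<and>
        ws ! k = pcomp w' w'' \<and>
        x = (e, take k ws @ [w', w''] @ drop (k + 1) ws) \<and>
        x \<in> Vset q (k + 1) (length ws + 1) \<and> y \<in> Vset q k (length ws))"

definition dotted ::
    "'v \<times> ('v, 'e) path list \<Rightarrow> 'v \<times> ('v, 'e) path list \<Rightarrow> bool" where
  "dotted x y \<longleftrightarrow> matched y x"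

definition undotted ::
    "'v \<times> ('v, 'e) path list \<Rightarrow> 'v \<times> ('v, 'e) path list \<Rightarrow> bool" where
  "undotted x y \<longleftrightarrow> bar_arrow x y \<and> \<not> matched x y"

definition arrow_weight ::
    "'v \<times> ('v, 'e) path list \<Rightarrow> 'v \<times> ('v, 'e) path list \<Rightarrow> 'k" where
  "arrow_weight x y = (if dotted x y then - inverse (bar_weight y x) else bar_weight x y)"

text \<open>A zigzag path is given by the list of its vertices; there is at most one arrow between two
  bar terms, as dotted arrows raise and undotted arrows lower the degree.\<close>

definition zigzag :: "('v \<times> ('v, 'e) path list) list \<Rightarrow> bool" where
  "zigzag xs \<longleftrightarrow> xs \<noteq> [] \<and> (\<forall>x\<in>set xs. \<exists>n. x \<in> bar_terms n) \<and>
     successively (\<lambda>x y. dotted x y \<or> undotted x y) xs \<and>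
     (\<forall>i. i + 2 < length xs \<longrightarrow>
        (dotted (xs ! i) (xs ! (i + 1)) \<longleftrightarrow> undotted (xs ! (i + 1)) (xs ! (i + 2))))"

definition zigzag_weight :: "('v \<times> ('v, 'e) path list) list \<Rightarrow> 'k" where
  "zigzag_weight xs = (\<Prod>i<length xs - 1. arrow_weight (xs ! i) (xs ! (i + 1)))"

definition total_weight ::
    "'v \<times> ('v, 'e) path list \<Rightarrow> 'v \<times> ('v, 'e) path list \<Rightarrow> 'k" where
  "total_weight x y = (\<Sum>xs\<in>{xs. zigzag xs \<and> hd xs = x \<and> last xs = y}. zigzag_weight xs)"

definition lin_ext ::
    "('b \<Rightarrow> 'c \<Rightarrow>\<^sub>0 'k) \<Rightarrow> ('b \<Rightarrow>\<^sub>0 'k) \<Rightarrow> 'c \<Rightarrow>\<^sub>0 'k" where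
  "lin_ext f z =
     (\<Sum>x\<in>Poly_Mapping.keys z. Poly_Mapping.map ((*) (Poly_Mapping.lookup z x)) (f x))"

text \<open>The maps h and p are meant for combinations of bar terms, the map i for combinations of
  chains.\<close>

definition h_map ::
    "(('v \<times> ('v, 'e) path list) \<Rightarrow>\<^sub>0 'k) \<Rightarrow> ('v \<times> ('v, 'e) path list) \<Rightarrow>\<^sub>0 'k" where
  "h_map = lin_ext (\<lambda>x. \<Sum>y\<in>bar_terms (length (snd x) + 1).
                          Poly_Mapping.single y (total_weight x y))"

definition p_map ::
    "(('v \<times> ('v, 'e) path list) \<Rightarrow>\<^sub>0 'k) \<Rightarrow> ('v \<times> ('v, 'e) path list) \<Rightarrow>\<^sub>0 'k" where
  "p_map = lin_ext (\<lambda>x. \<Sum>y\<in>chain_terms (length (snd x)).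
                          Poly_Mapping.single y (total_weight x y))"

definition i_map ::
    "(('v \<times> ('v, 'e) path list) \<Rightarrow>\<^sub>0 'k) \<Rightarrow> ('v \<times> ('v, 'e) path list) \<Rightarrow>\<^sub>0 'k" where
  "i_map = lin_ext (\<lambda>x. \<Sum>y\<in>bar_terms (length (snd x)).
                          Poly_Mapping.single y (total_weight x y))"


section \<open>Attached terms\<close>

definition attached :: "'v \<times> ('v, 'e) path list \<Rightarrow> bool" where
  "attached x \<longleftrightarrow> (case x of (e, ws) \<Rightarrow>
     ws \<noteq> [] \<and> x \<in> bar_terms (length ws) \<and>
     (\<forall>j. j + 1 < length ws \<longrightarrow>
        (\<exists>w\<in>tips. subpath (quiver T) w (pcomp (ws ! j) (ws ! (j + 1))))))"

text \<open>Position \<open>i\<close> (0-based) of \<open>(e, ws)\<close> factors properly as \<open>w'w''\<close> in such a way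
  that the entries before \<open>i\<close> followed by \<open>w'\<close> form a chain. For \<open>i = 0\<close> this forces
  \<open>w'\<close> to be the first arrow.\<close>

definition splits ::
    "'v \<Rightarrow> ('v, 'e) path list \<Rightarrow> nat \<Rightarrow> ('v, 'e) path \<Rightarrow> ('v, 'e) path \<Rightarrow> bool" where
  "splits e ws i w' w'' \<longleftrightarrow> i < length ws \<and>
     w' \<in> paths (quiver T) \<and> w'' \<in> paths (quiver T) \<and> composable (quiver T) w' w'' \<and>
     1 \<le> len w' \<and> 1 \<le> len w'' \<and> ws ! i = pcomp w' w'' \<and>
     is_chain (e, take i ws @ [w'])"

text \<open>\<open>attached_terms x n g G\<close>: the procedure started at \<open>G 0 = x\<close> stops after \<open>n\<close>
  steps, with \<open>g j\<close> and \<open>G j\<close> the terms \<open>\<gamma>\<^sup>j\<close> and \<open>\<Gamma>\<^sup>j\<close> of step \<open>j\<close>;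
  \<open>I j\<close> is the position split in step \<open>j\<close>.\<close>

definition attached_terms ::
    "'v \<times> ('v, 'e) path list \<Rightarrow> nat
     \<Rightarrow> (nat \<Rightarrow> ('v \<times> ('v, 'e) path list) \<Rightarrow>\<^sub>0 'k)
     \<Rightarrow> (nat \<Rightarrow> ('v \<times> ('v, 'e) path list) \<Rightarrow>\<^sub>0 'k) \<Rightarrow> bool" where
  "attached_terms x n g G \<longleftrightarrow>
     G 0 = Poly_Mapping.single x 1 \<and>
     (\<exists>I. \<forall>j\<in>{1..n}. \<exists>e ws w' w''.
        G (j - 1) = Poly_Mapping.single (e, ws) 1 \<and> \<not> is_chain (e, ws) \<and>
        splits e ws (I j) w' w'' \<and>
        (1 < j \<longrightarrow> I (j - 1) < I j) \<and>
        (\<forall>i' u u'. splits e ws i' u u' \<longrightarrow> i' \<le> I j) \<and>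
        g j = Poly_Mapping.single
                (e, take (I j) ws @ [w', w''] @ drop (I j + 1) ws) ((-1) ^ I j) \<and>
        G j =
          (if I j + 1 = length ws \<or>
              path_class w'' \<otimes>\<^bsub>toupie_quot\<^esub> path_class (ws ! (I j + 1)) = \<zero>\<^bsub>toupie_quot\<^esub>
           then 0
           else Poly_Mapping.single
                  (e, take (I j) ws @ [w', pcomp w'' (ws ! (I j + 1))] @ drop (I j + 2) ws) 1)) \<and>
     (G n = 0 \<or> (\<exists>y. is_chain y \<and> G n = Poly_Mapping.single y 1))"

end

end

theory Submission
  imports Defs "HOL-Library.Sublist"
begin

text \<open>A product of two non-tips can only fail to be a path or zero in \<open>A\<close> when it is a whole branch
  from source to sink; such a product cannot have neighbours in a bar term. Hence, for an attached
  term \<open>\<gamma>\<close> which is not a chain, \<open>\<gamma>\<close> is matched with \<open>\<gamma>\<^sup>1\<close> and the differential of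
  \<open>\<gamma>\<^sup>1\<close> consists of \<open>\<gamma>\<close> and \<open>\<Gamma>\<^sup>1\<close> only, so that all zigzag paths from
  \<open>\<gamma>\<close> that start with a dotted arrow run along \<open>\<Gamma>\<^sup>0, \<gamma>\<^sup>1, \<Gamma>\<^sup>1, \<gamma>\<^sup>2, \<dots>\<close>. Counting
  degrees, a zigzag path that contributes to \<open>h\<close> or \<open>p\<close> is trivial or starts with a dotted arrow,
  since no dotted arrow ends in a chain. A chain of degree different from 2 has zero differential; in
  degree 2 a chain is a factorization of a tip, and its differential runs through the other branches
  of the corresponding relation.\<close>

section \<open>Paths\<close>

text \<open>Products in A enter through \<open>expand\<close>, a definite description, so the
  differential is accessible only once the non-tips are known to be linearly independent modulo I.
  The toupie shape makes this elementary: every term of a non monomial relation is a whole branch,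
  nothing nontrivial can be multiplied onto a branch, and so, away from paths containing a monomial
  relation, I is just the linear span of the \<open>rho i\<close>. Reduced echelon form then
  isolates each coefficient at its pivot.

  The attached procedure splits at the largest possible position, the matching at the end of the
  longest chain prefix. These positions agree, and \<open>first_split\<close> captures both. After a
  step the chain prefix has grown, so the position increases strictly and the procedure stops.

  \<open>total_weight\<close> is a \<open>sum\<close> over a set of zigzag paths and would be 0 for
  an infinite set, so finiteness of these sets is proved together with the values. As for signs, the
  matching arrow at position k has weight \<open>(-1) ^ Suc k\<close>, its reversal
  \<open>(-1) ^ k\<close>, and the following undotted arrow again \<open>(-1) ^ k\<close>; a full
  up-down move has weight 1, which is why each \<Gamma> carries coefficient 1.\<close>

context wf_digraph
begin

lemma paths_iff: "(u, p) \<in> paths G \<longleftrightarrow> awalk u p (awlast u p)"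
  unfolding paths_def by auto

lemma paths_append_iff: "(u, p @ q) \<in> paths G \<longleftrightarrow> (u, p) \<in> paths G \<and> (awlast u p, q) \<in> paths G"
  by (auto simp: paths_def) 

lemma composable_iff: "composable G p q \<longleftrightarrow> awlast (fst p) (snd p) = fst q"
  by (simp add: composable_def tgt_def)

lemma pcomp_in_paths_iff:
  "composable G p q \<Longrightarrow> pcomp p q \<in> paths G \<longleftrightarrow> p \<in> paths G \<and> q \<in> paths G"
  by (cases p; cases q) (simp add: composable_iff pcomp_def paths_append_iff)

lemma tgt_pcomp: "pcomp p q \<in> paths G \<Longrightarrow> composable G p q \<Longrightarrow> tgt G (pcomp p q) = tgt G q"
  by (cases p; cases q) (auto simp add: tgt_def composable_iff pcomp_def paths_iff awlast_append)

lemma fst_path: "p \<in> paths G \<Longrightarrow> snd p \<noteq> [] \<Longrightarrow> fst p = tail G (hd (snd p))"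
  by (cases p; cases "snd p") (simp_all add: paths_iff awalk_Cons_iff)

lemma tgt_path: "snd p \<noteq> [] \<Longrightarrow> tgt G p = head G (last (snd p))"
  by (cases p) (simp add: tgt_def awalk_verts_conv)

text \<open>The start of a nontrivial path is the tail of its first arrow, so comparing arrow lists
  is enough; trivial paths are the only exception.\<close>

lemma path_eqI: "p \<in> paths G \<Longrightarrow> q \<in> paths G \<Longrightarrow> snd p = snd q \<Longrightarrow> snd p \<noteq> [] \<Longrightarrow> p = q"
  by (metis fst_path prod_eqI)

lemma arcs_path: "p \<in> paths G \<Longrightarrow> set (snd p) \<subseteq> arcs G"
  by (cases p) (auto simp: paths_iff awalk_def)

lemma fst_path_verts: "p \<in> paths G \<Longrightarrow> fst p \<in> verts G"
  by (cases p) (auto simp: paths_iff awalk_def)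

text \<open>Reduces questions about tips inside paths to \<open>sublist\<close> on arrow lists.
  Cutting \<open>p\<close> around the sublist yields a path with the same arrows as
  \<open>w\<close>, and it is \<open>w\<close> itself because \<open>w\<close> is
  nontrivial.\<close>

lemma subpath_iff:
  assumes "w \<in> paths G" "p \<in> paths G" "snd w \<noteq> []"
  shows "subpath G w p \<longleftrightarrow> sublist (snd w) (snd p)"
proof
  assume "sublist (snd w) (snd p)"
  then obtain a b where ab: "snd p = a @ snd w @ b" by (auto simp: sublist_def)
  let ?u = "awlast (fst p) a"
  from assms(2) have *: "(fst p, a) \<in> paths G" "(?u, snd w) \<in> paths G"
      "(awlast ?u (snd w), b) \<in> paths G"
    by (metis ab paths_append_iff prod.collapse)+
  with assms have w: "w = (?u, snd w)" by (intro path_eqI) auto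
  have "composable G (fst p, a) w" "composable G w (awlast ?u (snd w), b)"
    using w by (metis composable_iff fst_conv snd_conv)+
  moreover have "p = pcomp (pcomp (fst p, a) w) (awlast ?u (snd w), b)"
    by (simp add: pcomp_def ab[symmetric])
  ultimately show "subpath G w p" using * assms(1) unfolding subpath_def by blast
next
  assume "subpath G w p"
  then show "sublist (snd w) (snd p)"
    by (auto simp: subpath_def pcomp_def)
qed

end

section \<open>Relations and basis of a toupie algebra\<close>

text \<open>Paths and bar terms are pairs; quantifiers over them should stay whole instead of being
  split into components by the simplifier.\<close>

declare split_paired_All [simp del] split_paired_Ex [simp del]

lemma lookup_path_algebra_mult:
  "Poly_Mapping.lookup (x \<otimes>\<^bsub>path_algebra Q\<^esub> y) p =
     (\<Sum>q\<in>Poly_Mapping.keys x. \<Sum>q'\<in>Poly_Mapping.keys y. if composable Q q q' \<and> pcomp q q' = p then Poly_Mapping.lookup x q * Poly_Mapping.lookup y q' else 0)"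
  unfolding path_algebra_def
  by (simp add: lookup_sum lookup_single when_def if_distrib[of "\<lambda>x. Poly_Mapping.lookup x p"] cong: if_cong)
     (intro sum.cong refl, auto)

lemma path_algebra_single_mult:
  "Poly_Mapping.single p a \<otimes>\<^bsub>path_algebra Q\<^esub> Poly_Mapping.single q b =
     (if composable Q p q then Poly_Mapping.single (pcomp p q) (a * b) else 0)"
  by (auto simp: path_algebra_def)

lemma path_algebra_carrier: "x \<in> carrier (path_algebra Q) \<longleftrightarrow> Poly_Mapping.keys x \<subseteq> paths Q"
  and path_algebra_add: "x \<oplus>\<^bsub>path_algebra Q\<^esub> y = x + y"
  and path_algebra_zero: "\<zero>\<^bsub>path_algebra Q\<^esub> = 0"
  by (simp_all add: path_algebra_def)

lemma path_algebra_uminus: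
  fixes x :: "('v, 'e) path \<Rightarrow>\<^sub>0 'k::field"
  assumes "ring (path_algebra Q :: (('v, 'e) path \<Rightarrow>\<^sub>0 'k) ring)" "x \<in> carrier (path_algebra Q)"
  shows "\<ominus>\<^bsub>path_algebra Q\<^esub> x = - x"
proof -
  interpret ring "path_algebra Q :: (('v, 'e) path \<Rightarrow>\<^sub>0 'k) ring" by fact
  show ?thesis using assms(2) by (intro minus_equality) (simp_all add: path_algebra_def)
qed

lemma path_algebra_subgroupI:
  fixes J :: "(('v, 'e) path \<Rightarrow>\<^sub>0 'k::field) set"
  assumes R: "ring (path_algebra Q :: (('v, 'e) path \<Rightarrow>\<^sub>0 'k) ring)"
    and J: "J \<subseteq> carrier (path_algebra Q)" "0 \<in> J"
      "\<And>x y. x \<in> J \<Longrightarrow> y \<in> J \<Longrightarrow> x + y \<in> J" "\<And>x. x \<in> J \<Longrightarrow> - x \<in> J"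
  shows "subgroup J (add_monoid (path_algebra Q))"
proof (rule subgroup.intro)
  fix x assume "x \<in> J"
  moreover from this have "\<ominus>\<^bsub>path_algebra Q\<^esub> x = - x"
    using J(1) by (intro path_algebra_uminus R) blast
  ultimately show "inv\<^bsub>add_monoid (path_algebra Q)\<^esub> x \<in> J"
    using J(4) by (simp add: a_inv_def)
qed (use J in \<open>simp_all add: path_algebra_def\<close>)

lemma (in wf_digraph) ideal_single_subpath:
  assumes J: "ideal J (path_algebra G)" and w: "Poly_Mapping.single w 1 \<in> J" "subpath G w p"
  shows "Poly_Mapping.single p a \<in> J"
proof -
  interpret ideal J "path_algebra G" by fact
  obtain x y where xy: "x \<in> paths G" "y \<in> paths G" "composable G x w" "composable G w y"
      "p = pcomp (pcomp x w) y" "w \<in> paths G"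
    using w(2) by (auto simp: subpath_def)
  have "composable G (pcomp x w) y"
    using xy by (simp add: composable_def tgt_pcomp pcomp_in_paths_iff)
  \<comment> \<open>The scalar is absorbed into the left factor, since ideals here are closed under
    ring multiplication only.\<close>
  then have "Poly_Mapping.single p a = (Poly_Mapping.single x a \<otimes>\<^bsub>path_algebra G\<^esub> Poly_Mapping.single w 1) \<otimes>\<^bsub>path_algebra G\<^esub> Poly_Mapping.single y 1"
    using xy by (simp add: path_algebra_single_mult)
  also have "\<dots> \<in> J"
    using xy by (intro I_r_closed I_l_closed w) (auto simp: path_algebra_carrier)
  finally show ?thesis .
qed

locale toupie_presentation =
  fixes T :: "('v, 'e, 'k::field_char_0) toupie_data"
  assumes toupie_algebra: "toupie_algebra T"
begin

abbreviation "Q \<equiv> quiver T"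
abbreviation "R \<equiv> path_algebra (quiver T) :: (('v, 'e) path \<Rightarrow>\<^sub>0 'k) ring"
abbreviation "Pths \<equiv> paths (quiver T)"

lemma toupie_quiver: "toupie Q (source T) (sink T)"
  and admissible: "admissible Q (rel_ideal T)"
  using toupie_algebra by (simp_all add: toupie_algebra_def)

sublocale fin_digraph "quiver T"
  using toupie_quiver by (simp add: toupie_def)

sublocale rel: ideal "rel_ideal T" R
  using admissible by (simp add: admissible_def)

lemma branch_bij: "bij_betw (branch T) {1..num1 T + num2 T + num3 T + num4 T} (branches Q (source T) (sink T))"
  and branch3: "branch T ` {num1 T + num2 T + 1..num1 T + num2 T + num3 T} =
      {p \<in> branches Q (source T) (sink T). \<exists>u\<in>mon_rels T. subpath Q u p}"
  and pivot_mono: "strict_mono_on {1..num_rels T} (pivot T)"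
  and pivot_range: "pivot T ` {1..num_rels T} \<subseteq> {1..num4 T}"
  and reduced: "\<forall>i\<in>{1..num_rels T}. \<forall>i'\<in>{1..num_rels T}. i < i' \<longrightarrow> coef T i (pivot T i') = 0"
  and mon_rels_paths: "mon_rels T \<subseteq> Pths"
  and Idl_gens: "Idl\<^bsub>R\<^esub> gens T = rel_ideal T"
  using toupie_algebra unfolding toupie_algebra_def Let_def by - (elim conjE, assumption)+

lemma head_neq_source: "x \<in> arcs Q \<Longrightarrow> head Q x \<noteq> source T"
  and tail_neq_sink: "x \<in> arcs Q \<Longrightarrow> tail Q x \<noteq> sink T"
  using toupie_quiver by (auto simp: toupie_def in_arcs_def out_arcs_def)

lemma tgt_neq_source: "p \<in> Pths \<Longrightarrow> snd p \<noteq> [] \<Longrightarrow> tgt Q p \<noteq> source T"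
  using head_neq_source[OF subsetD[OF arcs_path last_in_set]] by (simp add: tgt_path)

lemma fst_neq_sink: "p \<in> Pths \<Longrightarrow> snd p \<noteq> [] \<Longrightarrow> fst p \<noteq> sink T"
  using tail_neq_sink[OF subsetD[OF arcs_path hd_in_set]] by (simp add: fst_path)

abbreviation "Brs \<equiv> branches (quiver T) (source T) (sink T)"

text \<open>No arrow enters the source and none leaves the sink, so a branch cannot be prolonged at
  either end.\<close>

lemma branch_factor:
  assumes "composable Q p q" "p \<in> Pths" "q \<in> Pths"
  shows "q \<in> Brs \<Longrightarrow> snd p = []" "p \<in> Brs \<Longrightarrow> snd q = []"
  using assms tgt_neq_source[of p] fst_neq_sink[of q] by (auto simp: branches_def composable_def)

lemma subpath_of_branch:
  assumes "b \<in> Brs" "subpath Q b p"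
  shows "p = b"
proof -
  obtain x y where xy: "x \<in> Pths" "y \<in> Pths" "composable Q x b" "composable Q b y"
      "p = pcomp (pcomp x b) y" "b \<in> Pths"
    using assms(2) by (auto simp: subpath_def)
  then have "snd x = []" "snd y = []" using branch_factor(1)[of x b] branch_factor(2)[of b y] assms(1) by simp_all
  with xy show ?thesis by (simp add: pcomp_def composable_iff prod_eq_iff)
qed

text \<open>No arrow can be composed with a branch, so modulo \<open>S\<close> multiplication by any element acts on
  combinations of branches as a scalar.\<close>

lemma ideal_of_paths_and_branches:
  fixes f :: "nat \<Rightarrow> ('v, 'e) path \<Rightarrow>\<^sub>0 'k"
  assumes S: "\<And>p q. composable Q p q \<Longrightarrow> p \<in> Pths \<Longrightarrow> q \<in> Pths \<Longrightarrow> p \<in> S \<or> q \<in> S \<Longrightarrow> pcomp p q \<in> S"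
    and f: "\<And>i. i \<in> N \<Longrightarrow> Poly_Mapping.keys (f i) \<subseteq> Brs"
  shows "ideal {x \<in> carrier R. \<exists>c. \<forall>p. p \<notin> S \<longrightarrow> Poly_Mapping.lookup x p = (\<Sum>i\<in>N. c i * Poly_Mapping.lookup (f i) p)} R"
proof -
  define rep where "rep c x \<longleftrightarrow> (\<forall>p. p \<notin> S \<longrightarrow> Poly_Mapping.lookup x p = (\<Sum>i\<in>N. c i * Poly_Mapping.lookup (f i) p))"
    for c and x :: "('v, 'e) path \<Rightarrow>\<^sub>0 'k"
  let ?J = "{x \<in> carrier R. \<exists>c. rep c x}"
  have "ideal ?J R"
  proof (rule idealI)
    show "ring R" by (rule rel.ring_axioms)
    have minus: "- x \<in> ?J" if "x \<in> ?J" for x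
    proof -
      from that obtain c where "rep c x" by blast
      then have "rep (\<lambda>i. - c i) (- x)"
        by (simp add: rep_def sum_negf)
      moreover have "- x \<in> carrier R" using that by (simp add: path_algebra_carrier)
      ultimately show ?thesis by (intro CollectI conjI exI)
    qed
    have plus: "x + y \<in> ?J" if xy: "x \<in> ?J" "y \<in> ?J" for x y
    proof -
      from xy obtain c d where "rep c x" "rep d y" by blast
      then have "rep (\<lambda>i. c i + d i) (x + y)"
        by (simp add: rep_def lookup_add distrib_right sum.distrib)
      moreover have "x + y \<in> carrier R"
        using xy Poly_Mapping.keys_add[of x y] unfolding path_algebra_carrier by blast
      ultimately show ?thesis by (intro CollectI conjI exI)
    qed
    show "subgroup ?J (add_monoid R)"
    proof (rule path_algebra_subgroupI[OF rel.ring_axioms])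
      have "rep (\<lambda>_. 0) 0" by (simp add: rep_def)
      moreover have "0 \<in> carrier R" by (simp add: path_algebra_carrier)
      ultimately show "0 \<in> ?J" by (intro CollectI conjI exI)
    qed (rule Collect_restrict plus minus; assumption?)+
    fix x a
    assume xJ: "x \<in> ?J" and a: "a \<in> carrier R"
    then have x: "Poly_Mapping.keys x \<subseteq> Pths" by (simp add: path_algebra_carrier)
    from xJ obtain c where "rep c x" by blast
    then have c: "Poly_Mapping.lookup x p = (\<Sum>i\<in>N. c i * Poly_Mapping.lookup (f i) p)" if "p \<notin> S" for p
      using that unfolding rep_def by blast
    \<comment> \<open>Off \<open>S\<close> the element \<open>x\<close> is a combination of the
      \<open>f i\<close>, and these are supported on branches.\<close>
    have brs: "p \<in> Brs" if "p \<in> Poly_Mapping.keys x" "p \<notin> S" for p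
    proof (rule ccontr)
      assume "p \<notin> Brs"
      then have "Poly_Mapping.lookup (f i) p = 0" if "i \<in> N" for i
        using f[OF that] by (auto simp: in_keys_iff)
      with c[OF that(2)] that(1) show False by (simp add: in_keys_iff)
    qed
    have keysa: "Poly_Mapping.keys a \<subseteq> Pths" using a by (simp add: path_algebra_carrier)
    \<comment> \<open>If a product avoids \<open>S\<close> then so does its factor
      \<open>q'\<close>, which is therefore a branch and admits only the trivial path at the source
      on its left.\<close>
    have *: "(composable Q q q' \<and> pcomp q q' = p) \<longleftrightarrow> q = (source T, []) \<and> q' = p"
      if "p \<notin> S" "q \<in> Poly_Mapping.keys a" "q' \<in> Poly_Mapping.keys x" for p q q'
    proof (intro iffI conjI; elim conjE)
      assume h: "composable Q q q'" "pcomp q q' = p"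
      with that S keysa x have "q' \<notin> S" by blast
      then have "q' \<in> Brs" using brs that by blast
      then have "snd q = []" "fst q' = source T"
        using branch_factor(1)[OF h(1)] that keysa x by (auto simp: branches_def)
      then show "q = (source T, [])" "q' = p"
        using h by (auto simp: composable_iff pcomp_def prod_eq_iff)
    next
      assume h: "q = (source T, [])" "q' = p"
      then have "q' \<in> Brs" using brs that by blast
      then show "composable Q q q'" "pcomp q q' = p"
        using h by (auto simp: composable_iff pcomp_def branches_def prod_eq_iff)
    qed
    \<comment> \<open>The scalar by which \<open>a\<close> acts from the left is its coefficient at
      the trivial path at the source.\<close>
    have "Poly_Mapping.lookup (a \<otimes>\<^bsub>R\<^esub> x) p = (\<Sum>i\<in>N. (Poly_Mapping.lookup a (source T, []) * c i) * Poly_Mapping.lookup (f i) p)"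
      if "p \<notin> S" for p
    proof -
      have "Poly_Mapping.lookup (a \<otimes>\<^bsub>R\<^esub> x) p = (\<Sum>q\<in>Poly_Mapping.keys a. \<Sum>q'\<in>Poly_Mapping.keys x.
          if q = (source T, []) \<and> q' = p then Poly_Mapping.lookup a q * Poly_Mapping.lookup x q' else 0)"
        unfolding lookup_path_algebra_mult using *[OF that] by (intro sum.cong refl) simp
      also have "\<dots> = (\<Sum>q\<in>Poly_Mapping.keys a. if q = (source T, []) then \<Sum>q'\<in>Poly_Mapping.keys x.
          if q' = p then Poly_Mapping.lookup a q * Poly_Mapping.lookup x q' else 0 else 0)"
        by (intro sum.cong refl) auto
      also have "\<dots> = Poly_Mapping.lookup a (source T, []) * Poly_Mapping.lookup x p"
        by (simp add: sum.delta in_keys_iff)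
      finally show ?thesis using c[OF that] by (simp add: sum_distrib_left mult.assoc)
    qed
    then have "rep (\<lambda>i. Poly_Mapping.lookup a (source T, []) * c i) (a \<otimes>\<^bsub>R\<^esub> x)"
      by (simp add: rep_def)
    moreover have "a \<otimes>\<^bsub>R\<^esub> x \<in> carrier R" using a xJ by (intro rel.m_closed) auto
    ultimately show "a \<otimes>\<^bsub>R\<^esub> x \<in> ?J" by (intro CollectI conjI exI)
    \<comment> \<open>Mirror image: from the right only the trivial path at the sink can
      act.\<close>
    have *: "(composable Q q' q \<and> pcomp q' q = p) \<longleftrightarrow> q = (sink T, []) \<and> q' = p"
      if "p \<notin> S" "q \<in> Poly_Mapping.keys a" "q' \<in> Poly_Mapping.keys x" for p q q'
    proof (intro iffI conjI; elim conjE)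
      assume h: "composable Q q' q" "pcomp q' q = p"
      with that S keysa x have "q' \<notin> S" by blast
      then have "q' \<in> Brs" using brs that by blast
      then have "snd q = []" "tgt Q q' = sink T"
        using branch_factor(2)[OF h(1)] that keysa x by (auto simp: branches_def)
      then show "q = (sink T, [])" "q' = p"
        using h by (auto simp: composable_def pcomp_def prod_eq_iff)
    next
      assume h: "q = (sink T, [])" "q' = p"
      then have "q' \<in> Brs" using brs that by blast
      then show "composable Q q' q" "pcomp q' q = p"
        using h by (auto simp: composable_def tgt_def pcomp_def branches_def prod_eq_iff)
    qed
    have "Poly_Mapping.lookup (x \<otimes>\<^bsub>R\<^esub> a) p = (\<Sum>i\<in>N. (Poly_Mapping.lookup a (sink T, []) * c i) * Poly_Mapping.lookup (f i) p)"
      if "p \<notin> S" for p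
    proof -
      have "Poly_Mapping.lookup (x \<otimes>\<^bsub>R\<^esub> a) p = (\<Sum>q'\<in>Poly_Mapping.keys x. \<Sum>q\<in>Poly_Mapping.keys a.
          if q = (sink T, []) \<and> q' = p then Poly_Mapping.lookup x q' * Poly_Mapping.lookup a q else 0)"
        unfolding lookup_path_algebra_mult using *[OF that] by (intro sum.cong refl) simp
      also have "\<dots> = (\<Sum>q'\<in>Poly_Mapping.keys x. if q' = p then \<Sum>q\<in>Poly_Mapping.keys a.
          if q = (sink T, []) then Poly_Mapping.lookup x q' * Poly_Mapping.lookup a q else 0 else 0)"
        by (intro sum.cong refl) auto
      also have "\<dots> = Poly_Mapping.lookup x p * Poly_Mapping.lookup a (sink T, [])"
        by (simp add: sum.delta in_keys_iff)
      finally show ?thesis using c[OF that] by (simp add: sum_distrib_left mult_ac)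
    qed
    then have "rep (\<lambda>i. Poly_Mapping.lookup a (sink T, []) * c i) (x \<otimes>\<^bsub>R\<^esub> a)"
      by (simp add: rep_def)
    moreover have "x \<otimes>\<^bsub>R\<^esub> a \<in> carrier R" using a xJ by (intro rel.m_closed) auto
    ultimately show "x \<otimes>\<^bsub>R\<^esub> a \<in> ?J" by (intro CollectI conjI exI)
  qed
  then show ?thesis by (simp only: rep_def)
qed

section \<open>Coefficients of the relations, tips, and membership in the tip ideal\<close>

lemma branch4_inj: "inj_on (branch4 T) {1..num4 T}"
proof (rule inj_onI)
  fix i j assume ij: "i \<in> {1..num4 T}" "j \<in> {1..num4 T}" "branch4 T i = branch4 T j"
  have "inj_on (branch T) {1..num1 T + num2 T + num3 T + num4 T}"
    using branch_bij by (simp add: bij_betw_def)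
  from inj_onD[OF this ij(3)[unfolded branch4_def]] ij(1,2) show "i = j" by simp
qed

lemma branch4_in_branches: "j \<in> {1..num4 T} \<Longrightarrow> branch4 T j \<in> Brs"
  using bij_betwE[OF branch_bij] by (simp add: branch4_def)

text \<open>Branches containing a monomial relation are exactly those of the third group, and the
  injective enumeration \<open>branch\<close> gives the third and fourth groups disjoint index
  ranges.\<close>

lemma branch4_no_mon:
  assumes "j \<in> {1..num4 T}" "u \<in> mon_rels T"
  shows "\<not> subpath Q u (branch4 T j)"
proof
  assume "subpath Q u (branch4 T j)"
  with assms have "branch4 T j \<in> branch T ` {num1 T + num2 T + 1..num1 T + num2 T + num3 T}"
    using branch4_in_branches branch3 by blast
  then obtain m where m: "m \<in> {num1 T + num2 T + 1..num1 T + num2 T + num3 T}"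
      "branch T (num1 T + num2 T + num3 T + j) = branch T m"
    by (auto simp: branch4_def)
  have "inj_on (branch T) {1..num1 T + num2 T + num3 T + num4 T}"
    using branch_bij by (simp add: bij_betw_def)
  from inj_onD[OF this m(2)] m(1) assms(1) show False by simp
qed

lemma pivot_in: "i \<in> {1..num_rels T} \<Longrightarrow> pivot T i \<in> {1..num4 T}"
  using pivot_range by blast

lemma lookup_rho:
  assumes "i \<in> {1..num_rels T}" "j \<in> {1..num4 T}"
  shows "Poly_Mapping.lookup (rho T i) (branch4 T j) =
    (if j = pivot T i then 1 else if pivot T i < j then coef T i j else 0)"
proof -
  have eq: "branch4 T j' = branch4 T j \<longleftrightarrow> j' = j" if "j' \<in> {1..num4 T}" for j'
    using inj_on_eq_iff[OF branch4_inj] that assms(2) by blast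
  have "(\<Sum>j'\<in>{pivot T i<..num4 T}. Poly_Mapping.lookup (Poly_Mapping.single (branch4 T j') (coef T i j')) (branch4 T j))
      = (\<Sum>j'\<in>{pivot T i<..num4 T}. if j' = j then coef T i j' else 0)"
    using pivot_in[OF assms(1)] by (intro sum.cong refl) (simp add: lookup_single when_def eq)
  then show ?thesis
    using assms pivot_in[OF assms(1)] unfolding rho_def
    by (simp add: lookup_add lookup_sum) (auto simp: lookup_single when_def eq)
qed

lemma keys_rho: "i \<in> {1..num_rels T} \<Longrightarrow> Poly_Mapping.keys (rho T i) \<subseteq> branch4 T ` {1..num4 T}"
proof
  fix p assume i: "i \<in> {1..num_rels T}" and "p \<in> Poly_Mapping.keys (rho T i)"
  then have "Poly_Mapping.lookup (rho T i) p \<noteq> 0" by (simp add: in_keys_iff)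
  show "p \<in> branch4 T ` {1..num4 T}"
  proof (rule ccontr)
    assume p: "p \<notin> branch4 T ` {1..num4 T}"
    then have "branch4 T j \<noteq> p" if "j \<in> {1..num4 T}" for j using that by blast
    then have "Poly_Mapping.lookup (rho T i) p = 0"
      using pivot_in[OF i] unfolding rho_def
      by (simp add: lookup_add lookup_sum lookup_single when_def)
    with \<open>Poly_Mapping.lookup (rho T i) p \<noteq> 0\<close> show False by simp
  qed
qed

text \<open>The pivot columns form an identity matrix: entries left of a pivot vanish by the echelon
  shape, those at later pivots because the matrix is reduced.\<close>

lemma lookup_rho_pivot:
  assumes "i \<in> {1..num_rels T}" "i' \<in> {1..num_rels T}"
  shows "Poly_Mapping.lookup (rho T i) (branch4 T (pivot T i')) = (if i = i' then 1 else 0)"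
  using lookup_rho[OF assms(1) pivot_in[OF assms(2)]] reduced assms
    strict_mono_onD[OF pivot_mono, of i i'] strict_mono_onD[OF pivot_mono, of i' i]
  by (cases i i' rule: linorder_cases) auto

lemma gens_rel_ideal: "gens T \<subseteq> rel_ideal T"
proof -
  have "rho T i \<in> carrier R" if "i \<in> {1..num_rels T}" for i
    using keys_rho[OF that] branch4_in_branches by (auto simp: path_algebra_carrier branches_def)
  then have "gens T \<subseteq> carrier R"
    using mon_rels_paths by (auto simp: gens_def path_algebra_carrier)
  from rel.genideal_self[OF this] show ?thesis by (simp add: Idl_gens)
qed

lemma rel_ideal_len: "x \<in> rel_ideal T \<Longrightarrow> p \<in> Poly_Mapping.keys x \<Longrightarrow> 2 \<le> len p"
  using admissible by (auto simp: admissible_def arrow_ideal_pow_def)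

definition pivots :: "('v, 'e) path set" where
  "pivots = (\<lambda>i. branch4 T (pivot T i)) ` {1..num_rels T}"

lemma tips_eq: "tips T = mon_rels T \<union> pivots"
  by (simp add: tips_def pivots_def)

lemma pivots_branches: "pivots \<subseteq> Brs"
  using branch4_in_branches[OF pivot_in] by (auto simp: pivots_def)

lemma tips_paths: "tips T \<subseteq> Pths"
  using mon_rels_paths pivots_branches by (auto simp: tips_eq branches_def)

lemma rho_in_ideal: "i \<in> {1..num_rels T} \<Longrightarrow> rho T i \<in> rel_ideal T"
  using gens_rel_ideal by (auto simp: gens_def)

text \<open>A tip occurs in a generator with nonzero coefficient, and admissibility puts the
  generators into the square of the arrow ideal.\<close>

lemma tips_len:
  assumes "w \<in> tips T"
  shows "2 \<le> len w"
proof (cases "w \<in> mon_rels T")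
  case True
  then have "Poly_Mapping.single w 1 \<in> rel_ideal T" using gens_rel_ideal by (auto simp: gens_def)
  from rel_ideal_len[OF this, of w] show ?thesis by simp
next
  case False
  then obtain i where i: "i \<in> {1..num_rels T}" "w = branch4 T (pivot T i)"
    using assms by (auto simp: tips_def)
  have "w \<in> Poly_Mapping.keys (rho T i)"
    using lookup_rho_pivot[OF i(1) i(1)] i(2) by (simp add: in_keys_iff)
  from rel_ideal_len[OF rho_in_ideal[OF i(1)] this] show ?thesis .
qed

abbreviation "hastip p \<equiv> \<exists>w\<in>tips T. subpath Q w p"

lemma subpath_pcomp:
  assumes "composable Q p q" "p \<in> Pths" "q \<in> Pths" "w \<in> Pths" "snd w \<noteq> []"
    "subpath Q w p \<or> subpath Q w q"
  shows "subpath Q w (pcomp p q)"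
proof -
  have "pcomp p q \<in> Pths" using assms by (auto simp: pcomp_in_paths_iff prod_eq_iff)
  then show ?thesis
    using assms by (auto simp: subpath_iff pcomp_def sublist_append)
qed

text \<open>The tip ideal is monomial: elements supported on paths that contain a tip already form
  an ideal around the generators. This turns the arrows of the Uf-graph into statements about
  sublists.\<close>

lemma in_tip_ideal_iff: "in_tip_ideal T p \<longleftrightarrow> p \<in> Pths \<and> hastip p"
proof
  let ?J = "Idl\<^bsub>R\<^esub> ((\<lambda>w. Poly_Mapping.single w 1) ` tips T)"
  have carr: "(\<lambda>w. Poly_Mapping.single w 1) ` tips T \<subseteq> carrier R"
    using tips_paths by (auto simp: path_algebra_carrier)
  show "in_tip_ideal T p" if "p \<in> Pths \<and> hastip p"
  proof -
    from that obtain w where w: "w \<in> tips T" "subpath Q w p" by blast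
    have "ideal ?J R" by (rule rel.genideal_ideal[OF carr])
    moreover have "Poly_Mapping.single w 1 \<in> ?J" using rel.genideal_self[OF carr] w by blast
    ultimately show ?thesis
      unfolding in_tip_ideal_def by (rule ideal_single_subpath) (rule w(2))
  qed
  \<comment> \<open>The empty index set makes the sum vanish, so \<open>?K\<close> consists of the
    elements supported on paths with a tip.\<close>
  let ?K = "{x \<in> carrier R. \<exists>c. \<forall>p. p \<notin> {p. hastip p} \<longrightarrow> Poly_Mapping.lookup x p = (\<Sum>i\<in>({}::nat set). c i * Poly_Mapping.lookup (0::('v, 'e) path \<Rightarrow>\<^sub>0 'k) p)}"
  assume p: "in_tip_ideal T p"
  have K: "ideal ?K R"
  proof (rule ideal_of_paths_and_branches)
    fix p q assume pq: "composable Q p q" "p \<in> Pths" "q \<in> Pths" "p \<in> {p. hastip p} \<or> q \<in> {p. hastip p}"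
    then obtain w where w: "w \<in> tips T" "subpath Q w p \<or> subpath Q w q" by blast
    with tips_len[OF w(1)] have "snd w \<noteq> []" by auto
    then have "subpath Q w (pcomp p q)" using subpath_pcomp pq w tips_paths by blast
    then show "pcomp p q \<in> {p. hastip p}" using w by blast
  qed simp
  have "(\<lambda>w. Poly_Mapping.single w 1) ` tips T \<subseteq> ?K"
  proof
    fix x :: "('v, 'e) path \<Rightarrow>\<^sub>0 'k"
    assume "x \<in> (\<lambda>w. Poly_Mapping.single w 1) ` tips T"
    then obtain w where w: "w \<in> tips T" "x = Poly_Mapping.single w 1" by blast
    have "subpath Q w w" using w tips_paths tips_len[OF w(1)] by (subst subpath_iff) auto
    then have "hastip w" using w(1) by blast
    then have "w \<noteq> p" if "\<not> hastip p" for p using that by blast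
    then have "Poly_Mapping.lookup x p = 0" if "\<not> hastip p" for p
      using that by (simp add: w(2) lookup_single when_def)
    moreover have "x \<in> carrier R" using w carr by blast
    ultimately show "x \<in> ?K" by simp
  qed
  from subsetD[OF rel.genideal_minimal[OF K this] p[unfolded in_tip_ideal_def]]
  have *: "Poly_Mapping.single p (1::'k) \<in> carrier R"
      "\<forall>q. \<not> hastip q \<longrightarrow> Poly_Mapping.lookup (Poly_Mapping.single p (1::'k)) q = 0"
    by simp_all
  show "p \<in> Pths \<and> hastip p"
    using *(1) spec[OF *(2), of p] by (simp add: path_algebra_carrier)
qed

text \<open>The elements with this coefficient pattern form an ideal by
  \<open>ideal_of_paths_and_branches\<close> and include all generators, so they include I.\<close>

lemma rel_ideal_coeffs:
  assumes "x \<in> rel_ideal T"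
  shows "\<exists>c. \<forall>p. \<not> (\<exists>u\<in>mon_rels T. subpath Q u p) \<longrightarrow>
    Poly_Mapping.lookup x p = (\<Sum>i\<in>{1..num_rels T}. c i * Poly_Mapping.lookup (rho T i) p)"
proof -
  let ?S = "{p. \<exists>u\<in>mon_rels T. subpath Q u p}"
  let ?K = "{x \<in> carrier R. \<exists>c. \<forall>p. p \<notin> ?S \<longrightarrow> Poly_Mapping.lookup x p = (\<Sum>i\<in>{1..num_rels T}. c i * Poly_Mapping.lookup (rho T i) p)}"
  have "ideal ?K R"
  proof (rule ideal_of_paths_and_branches)
    fix p q assume pq: "composable Q p q" "p \<in> Pths" "q \<in> Pths" "p \<in> ?S \<or> q \<in> ?S"
    then obtain w where w: "w \<in> mon_rels T" "subpath Q w p \<or> subpath Q w q" by blast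
    then have "w \<in> tips T" by (simp add: tips_def)
    with tips_len[OF this] have "snd w \<noteq> []" by auto
    then have "subpath Q w (pcomp p q)" using subpath_pcomp pq w mon_rels_paths by blast
    then show "pcomp p q \<in> ?S" using w by blast
  next
    fix i assume "i \<in> {1..num_rels T}"
    then show "Poly_Mapping.keys (rho T i) \<subseteq> Brs" using keys_rho branch4_in_branches by blast
  qed
  moreover have "gens T \<subseteq> ?K"
  proof
    fix x assume x: "x \<in> gens T"
    then have carr: "x \<in> carrier R" using gens_rel_ideal rel.a_Hcarr by blast
    consider u where "u \<in> mon_rels T" "x = Poly_Mapping.single u 1" | i where "i \<in> {1..num_rels T}" "x = rho T i"
      using x by (auto simp: gens_def)
    then show "x \<in> ?K"
    proof cases
      case 1
      then have "u \<in> tips T" by (simp add: tips_def)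
      then have "subpath Q u u" using tips_paths tips_len[of u] by (subst subpath_iff) auto
      then have "u \<in> ?S" using 1 by blast
      then have "Poly_Mapping.lookup x p = 0" if "p \<notin> ?S" for p
        using that 1(2) by (auto simp: lookup_single when_def)
      then have "\<forall>p. p \<notin> ?S \<longrightarrow> Poly_Mapping.lookup x p = (\<Sum>i\<in>{1..num_rels T}. (\<lambda>_. 0) i * Poly_Mapping.lookup (rho T i) p)"
        by simp
      with carr show ?thesis by (intro CollectI conjI exI[of _ "\<lambda>_. 0"])
    next
      case 2
      have "Poly_Mapping.lookup x p = (\<Sum>j\<in>{1..num_rels T}. (\<lambda>j. if j = i then 1 else 0) j * Poly_Mapping.lookup (rho T j) p)" for p
      proof -
        have "(\<Sum>j\<in>{1..num_rels T}. (\<lambda>j. if j = i then 1 else 0) j * Poly_Mapping.lookup (rho T j) p)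
            = (\<Sum>j\<in>{1..num_rels T}. if j = i then Poly_Mapping.lookup (rho T j) p else 0)"
          by (intro sum.cong refl) simp
        then show ?thesis using 2 by simp
      qed
      then have "\<forall>p. p \<notin> ?S \<longrightarrow> Poly_Mapping.lookup x p = (\<Sum>j\<in>{1..num_rels T}. (\<lambda>j. if j = i then 1 else 0) j * Poly_Mapping.lookup (rho T j) p)"
        by blast
      with carr show ?thesis by (intro CollectI conjI exI[of _ "\<lambda>j. if j = i then 1 else 0"])
    qed
  qed
  ultimately have "Idl\<^bsub>R\<^esub> gens T \<subseteq> ?K" by (rule rel.genideal_minimal)
  then have "rel_ideal T \<subseteq> ?K" by (simp only: Idl_gens)
  from subsetD[OF this assms] show ?thesis by simp
qed

lemma nontip_iff: "p \<in> nontip T \<longleftrightarrow> p \<in> Pths \<and> \<not> hastip p"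
  by (auto simp: nontip_def)

text \<open>Linear independence of the non-tips in A. Evaluation at a pivot, where \<open>x\<close>
  has coefficient 0, isolates a single \<open>c i\<close> through the identity matrix of
  \<open>lookup_rho_pivot\<close>; hence all \<open>c i\<close> vanish, and with them
  \<open>x\<close>.\<close>

lemma rel_ideal_nontip:
  assumes "x \<in> rel_ideal T" "Poly_Mapping.keys x \<subseteq> nontip T"
  shows "x = 0"
proof -
  obtain c where "\<forall>p. \<not> (\<exists>u\<in>mon_rels T. subpath Q u p) \<longrightarrow>
      Poly_Mapping.lookup x p = (\<Sum>i\<in>{1..num_rels T}. c i * Poly_Mapping.lookup (rho T i) p)"
    using rel_ideal_coeffs[OF assms(1)] by (rule exE)
  then have c: "Poly_Mapping.lookup x p = (\<Sum>i\<in>{1..num_rels T}. c i * Poly_Mapping.lookup (rho T i) p)"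
    if "\<not> (\<exists>u\<in>mon_rels T. subpath Q u p)" for p
    using that by simp
  have c0: "c i = 0" if i: "i \<in> {1..num_rels T}" for i
  proof -
    let ?b = "branch4 T (pivot T i)"
    have b: "?b \<in> tips T" using i by (auto simp: tips_def)
    then have "subpath Q ?b ?b" using tips_paths tips_len[OF b] by (subst subpath_iff) auto
    with b have "?b \<notin> Poly_Mapping.keys x" using assms(2) by (auto simp: nontip_iff)
    then have "0 = (\<Sum>j\<in>{1..num_rels T}. c j * Poly_Mapping.lookup (rho T j) ?b)"
      using c[of ?b] branch4_no_mon[OF pivot_in[OF i]] by (simp add: in_keys_iff)
    also have "\<dots> = (\<Sum>j\<in>{1..num_rels T}. if j = i then c j else 0)"
      using i by (intro sum.cong refl) (simp add: lookup_rho_pivot)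
    finally show ?thesis using i by simp
  qed
  have "Poly_Mapping.lookup x p = 0" for p
  proof (cases "p \<in> Poly_Mapping.keys x")
    case True
    then have "\<not> (\<exists>u\<in>mon_rels T. subpath Q u p)" using assms(2) by (auto simp: nontip_iff tips_def)
    from c[OF this] c0 show ?thesis by simp
  qed (simp add: in_keys_iff)
  then show ?thesis by (intro poly_mapping_eqI) simp
qed

text \<open>Admissibility puts all long paths into I, while independence keeps non-tips out of I, so
  their length is bounded. Finiteness of \<open>bar_terms\<close>, over which the three maps sum,
  depends on this.\<close>

lemma finite_nontip: "finite (nontip T)"
proof -
  obtain N where N: "arrow_ideal_pow Q N \<subseteq> rel_ideal T"
    using admissible by (auto simp: admissible_def)
  have len: "len p \<le> N" if p: "p \<in> nontip T" for p
  proof (rule ccontr)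
    assume "\<not> len p \<le> N"
    then have "Poly_Mapping.single p 1 \<in> rel_ideal T"
      using p N by (auto simp: arrow_ideal_pow_def path_algebra_carrier nontip_iff)
    then have "Poly_Mapping.single p (1::'k) = 0" using p by (intro rel_ideal_nontip) auto
    from arg_cong[OF this, of "\<lambda>x. Poly_Mapping.lookup x p"] show False by simp
  qed
  have "nontip T \<subseteq> verts Q \<times> {xs. set xs \<subseteq> arcs Q \<and> length xs \<le> N}"
  proof
    fix p assume "p \<in> nontip T"
    then show "p \<in> verts Q \<times> {xs. set xs \<subseteq> arcs Q \<and> length xs \<le> N}"
      using len[of p] arcs_path[of p] fst_path_verts[of p] by (simp add: mem_Times_iff nontip_iff)
  qed
  then show ?thesis
    by (rule finite_subset) (intro finite_cartesian_product finite_lists_length_le finite_verts finite_arcs)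
qed

section \<open>Normal forms in the quotient algebra\<close>

lemma single_carrier: "p \<in> Pths \<Longrightarrow> Poly_Mapping.single p c \<in> carrier R"
  by (auto simp: path_algebra_carrier)

lemma mem_path_class: "y \<in> path_class T p \<longleftrightarrow> y - Poly_Mapping.single p 1 \<in> rel_ideal T"
proof -
  have "y \<in> path_class T p \<longleftrightarrow> (\<exists>h\<in>rel_ideal T. y = h + Poly_Mapping.single p 1)"
    by (simp add: path_class_def a_r_coset_def' path_algebra_add)
  also have "\<dots> \<longleftrightarrow> y - Poly_Mapping.single p 1 \<in> rel_ideal T"
    by (auto intro: bexI[of _ "y - Poly_Mapping.single p 1"])
  finally show ?thesis .
qed

lemma zero_in_rel_ideal: "0 \<in> rel_ideal T"
  using additive_subgroup.zero_closed[OF rel.is_additive_subgroup] by (simp add: path_algebra_zero)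

lemma uminus_rel_ideal: "x \<in> rel_ideal T \<Longrightarrow> - x \<in> rel_ideal T"
  using additive_subgroup.a_inv_closed[OF rel.is_additive_subgroup, of x] path_algebra_uminus[OF rel.ring_axioms rel.a_Hcarr, of x] by simp

lemma diff_rel_ideal: "x \<in> rel_ideal T \<Longrightarrow> y \<in> rel_ideal T \<Longrightarrow> x - y \<in> rel_ideal T"
  using additive_subgroup.a_closed[OF rel.is_additive_subgroup, of x "- y"] uminus_rel_ideal[of y] by (simp add: path_algebra_add)

text \<open>The uniqueness behind the definite description is \<open>rel_ideal_nontip\<close>
  applied to the difference of two candidates.\<close>

lemma expand_eqI:
  assumes "y - Poly_Mapping.single p 1 \<in> rel_ideal T" "Poly_Mapping.keys y \<subseteq> nontip T"
  shows "expand T (path_class T p) = y"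
  unfolding expand_def
proof (rule the_equality)
  show "y \<in> path_class T p \<and> Poly_Mapping.keys y \<subseteq> nontip T"
    using assms by (simp add: mem_path_class)
  fix z assume z: "z \<in> path_class T p \<and> Poly_Mapping.keys z \<subseteq> nontip T"
  have "(z - Poly_Mapping.single p 1) - (y - Poly_Mapping.single p 1) \<in> rel_ideal T"
    using z assms by (simp only: diff_rel_ideal mem_path_class)
  then have "z - y \<in> rel_ideal T" by simp
  moreover have "Poly_Mapping.keys (z - y) \<subseteq> nontip T"
    using keys_diff[of z y] z assms by blast
  ultimately have "z - y = 0" by (rule rel_ideal_nontip)
  then show "z = y" by simp
qed

lemma expand_nontip: "p \<in> nontip T \<Longrightarrow> expand T (path_class T p) = Poly_Mapping.single p 1"
  by (rule expand_eqI) (auto simp: zero_in_rel_ideal)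

lemma mon_in_rel_ideal: "u \<in> mon_rels T \<Longrightarrow> subpath Q u p \<Longrightarrow> Poly_Mapping.single p a \<in> rel_ideal T"
  by (rule ideal_single_subpath[OF rel.ideal_axioms, of u]) (use gens_rel_ideal in \<open>auto simp: gens_def\<close>)

lemma expand_mon:
  assumes "u \<in> mon_rels T" "subpath Q u p"
  shows "expand T (path_class T p) = 0"
  using uminus_rel_ideal[OF mon_in_rel_ideal[OF assms, of 1]] by (intro expand_eqI) auto

text \<open>A non monomial tip is a branch, so it cannot sit properly inside \<open>p\<close> and
  must equal it.\<close>

lemma nontip_cases:
  assumes "p \<in> Pths" "p \<notin> nontip T"
  obtains u where "u \<in> mon_rels T" "subpath Q u p" | "p \<in> pivots"
proof -
  obtain w where w: "w \<in> tips T" "subpath Q w p" using assms by (auto simp: nontip_iff)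
  show thesis
  proof (cases "w \<in> mon_rels T")
    case True
    then show thesis using w(2) that(1) by blast
  next
    case False
    then have "w \<in> pivots" using w(1) by (simp add: tips_eq)
    then show thesis using subpath_of_branch[OF _ w(2)] pivots_branches that(2) by blast
  qed
qed

text \<open>The other terms of a relation are branches of the fourth group, hence free of monomial
  relations, and none of them is a pivot because the matrix is reduced. This gives the normal form
  of a pivot.\<close>

lemma rho_minus_tip_nontip:
  assumes i: "i \<in> {1..num_rels T}"
  shows "Poly_Mapping.keys (Poly_Mapping.single (branch4 T (pivot T i)) 1 - rho T i) \<subseteq> nontip T"
proof
  let ?b = "branch4 T (pivot T i)"
  fix p assume p: "p \<in> Poly_Mapping.keys (Poly_Mapping.single ?b 1 - rho T i)"
  then have "p \<in> branch4 T ` {1..num4 T}"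
    using keys_diff[of "Poly_Mapping.single ?b 1" "rho T i"] keys_rho[OF i] pivot_in[OF i]
    by (auto split: if_splits)
  then obtain j where j: "j \<in> {1..num4 T}" "p = branch4 T j" by blast
  have "p \<notin> pivots"
  proof
    assume "p \<in> pivots"
    then obtain i' where i': "i' \<in> {1..num_rels T}" "p = branch4 T (pivot T i')"
      by (auto simp: pivots_def)
    have "branch4 T (pivot T i) = branch4 T (pivot T i') \<longleftrightarrow> i = i'"
      using inj_on_eq_iff[OF branch4_inj pivot_in[OF i] pivot_in[OF i'(1)]]
        strict_mono_on_eqD[OF pivot_mono, of i i'] i i'(1) by auto
    then have "Poly_Mapping.lookup (Poly_Mapping.single ?b 1 - rho T i) p = 0"
      using lookup_rho_pivot[OF i i'(1)] by (simp add: lookup_minus lookup_single i'(2))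
    with p show False by (simp add: in_keys_iff)
  qed
  moreover have "p \<in> Pths" using j branch4_in_branches by (auto simp: branches_def)
  ultimately show "p \<in> nontip T"
    using branch4_no_mon[OF j(1)] j(2) by (auto elim: nontip_cases)
qed

lemma expand_pivot:
  assumes i: "i \<in> {1..num_rels T}"
  shows "expand T (path_class T (branch4 T (pivot T i))) = Poly_Mapping.single (branch4 T (pivot T i)) 1 - rho T i"
  using uminus_rel_ideal[OF rho_in_ideal[OF i]] rho_minus_tip_nontip[OF i]
  by (intro expand_eqI) auto

lemma path_class_mult:
  assumes "p \<in> Pths" "q \<in> Pths" "composable Q p q"
  shows "path_class T p \<otimes>\<^bsub>toupie_quot T\<^esub> path_class T q = path_class T (pcomp p q)"
  using rel.rcoset_mult_add[OF single_carrier[OF assms(1)] single_carrier[OF assms(2)], of 1 1] assms(3)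
  by (simp add: path_class_def FactRing_def path_algebra_single_mult)

lemma path_class_eq_zero_iff:
  assumes "p \<in> Pths"
  shows "path_class T p = \<zero>\<^bsub>toupie_quot T\<^esub> \<longleftrightarrow> Poly_Mapping.single p 1 \<in> rel_ideal T"
  using rel.a_rcos_zero[OF rel.ideal_axioms] rel.rcos_const_imp_mem[OF single_carrier[OF assms]]
  by (auto simp: path_class_def FactRing_def)

text \<open>Away from the pivots, a tip inside \<open>p\<close> comes with a monomial relation,
  which kills the class. A pivot is instead rewritten into other branches, so it has to be
  excluded.\<close>

lemma path_class_eq_zero_iff_nontip:
  assumes "p \<in> Pths" "p \<notin> pivots"
  shows "path_class T p = \<zero>\<^bsub>toupie_quot T\<^esub> \<longleftrightarrow> p \<notin> nontip T"
proof
  assume "path_class T p = \<zero>\<^bsub>toupie_quot T\<^esub>"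
  then have *: "Poly_Mapping.single p 1 \<in> rel_ideal T" by (simp only: path_class_eq_zero_iff[OF assms(1)])
  show "p \<notin> nontip T"
  proof
    assume "p \<in> nontip T"
    then have "Poly_Mapping.single p (1::'k) = 0" using * by (intro rel_ideal_nontip) auto
    from arg_cong[OF this, of "\<lambda>x. Poly_Mapping.lookup x p"] show False by simp
  qed
next
  assume "p \<notin> nontip T"
  from nontip_cases[OF assms(1) this] obtain u where "u \<in> mon_rels T" "subpath Q u p"
    using assms(2) by blast
  then show "path_class T p = \<zero>\<^bsub>toupie_quot T\<^esub>"
    unfolding path_class_eq_zero_iff[OF assms(1)] by (rule mon_in_rel_ideal)
qed

end

section \<open>Chains and splittings\<close>

lemma pcomp_assoc: "pcomp (pcomp p q) r = pcomp p (pcomp q r)"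
  by (simp add: pcomp_def)

lemma len_pcomp [simp]: "len (pcomp p q) = len p + len q"
  by (simp add: pcomp_def)

lemma composable_pcomp_right [simp]: "composable G p (pcomp q r) \<longleftrightarrow> composable G p q"
  by (simp add: composable_def pcomp_def)

lemma (in wf_digraph) composable_pcomp_left:
  "pcomp p q \<in> paths G \<Longrightarrow> composable G p q \<Longrightarrow> composable G (pcomp p q) r \<longleftrightarrow> composable G q r"
  by (simp add: composable_def tgt_pcomp)

lemma (in wf_digraph) path_factor:
  assumes "p \<in> paths G" "snd p = a @ b"
  shows "(fst p, a) \<in> paths G" "(awlast (fst p) a, b) \<in> paths G"
    "composable G (fst p, a) (awlast (fst p) a, b)" "p = pcomp (fst p, a) (awlast (fst p) a, b)"
  using assms by (cases p; simp add: paths_append_iff composable_iff pcomp_def)+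

context toupie_presentation
begin

lemma tips_nonempty: "w \<in> tips T \<Longrightarrow> snd w \<noteq> []"
  using tips_len[of w] by auto

lemma hastip_iff: "p \<in> Pths \<Longrightarrow> hastip p \<longleftrightarrow> (\<exists>w\<in>tips T. sublist (snd w) (snd p))"
  using tips_paths tips_nonempty by (simp add: subpath_iff subset_iff)

lemma hastip_mono: "p \<in> Pths \<Longrightarrow> q \<in> Pths \<Longrightarrow> sublist (snd p) (snd q) \<Longrightarrow> hastip p \<Longrightarrow> hastip q"
  unfolding hastip_iff using sublist_order.order_trans by blast

lemma nontip_sublist: "p \<in> Pths \<Longrightarrow> q \<in> nontip T \<Longrightarrow> sublist (snd p) (snd q) \<Longrightarrow> p \<in> nontip T"
  using hastip_mono unfolding nontip_iff by blast

lemma arrow_not_hastip: "p \<in> Pths \<Longrightarrow> len p \<le> 1 \<Longrightarrow> \<not> hastip p"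
  unfolding hastip_iff using tips_len sublist_length_le by fastforce

lemma uf_arrow_composable: "uf_arrow T u v \<Longrightarrow> composable Q u v"
  by (simp add: uf_arrow_def)

lemma uf_arrow_paths: "uf_arrow T u v \<Longrightarrow> u \<in> Pths \<and> v \<in> Pths"
  by (simp add: uf_arrow_def uf_verts_def)

lemma uf_arrow_hastip: "uf_arrow T u v \<Longrightarrow> 1 \<le> len u \<Longrightarrow> hastip (pcomp u v)"
  by (auto simp: uf_arrow_def in_tip_ideal_iff)

text \<open>Minimality of the arrow \<open>u\<close> to \<open>w'\<close> keeps the product of
  \<open>u\<close> and \<open>v'\<close> out of the tip ideal. The arrow to \<open>v'\<close> must
  then start at a vertex, which would put the non-tip \<open>w'\<close> itself into the tip
  ideal.\<close>

lemma uf_arrow_prefix: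
  assumes v': "uf_arrow T u v'" "1 \<le> len v'" and w': "uf_arrow T u w'" "w' \<in> nontip T"
    and px: "snd w' = snd v' @ xs" "xs \<noteq> []"
  shows False
proof -
  have paths: "u \<in> Pths" "v' \<in> Pths" "w' \<in> Pths" using v' w' uf_arrow_paths by blast+
  let ?v'' = "(awlast (fst w') (snd v'), xs)"
  note f = path_factor[OF paths(3) px(1)]
  have "(fst w', snd v') = v'" using f(1) paths(2) v'(2) by (intro path_eqI) auto
  with f have f: "?v'' \<in> Pths" "composable Q v' ?v''" "w' = pcomp v' ?v''" by simp_all
  have "len w' \<noteq> 1" using px v'(2) by (cases xs) auto
  then have w: "in_tip_ideal T (pcomp u w')"
     "\<And>w p. w \<in> Pths \<Longrightarrow> p \<in> Pths \<Longrightarrow> composable Q w p \<Longrightarrow> pcomp u w' = pcomp w p \<Longrightarrow> 1 \<le> len p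
        \<Longrightarrow> \<not> in_tip_ideal T w"
    using w'(1) by (auto simp: uf_arrow_def)
  have "\<not> in_tip_ideal T (pcomp u v')"
  proof (rule w(2))
    have uv: "composable Q u v'" using v'(1) by (rule uf_arrow_composable)
    then show "pcomp u v' \<in> Pths" using paths by (simp add: pcomp_in_paths_iff)
    then show "composable Q (pcomp u v') ?v''" using uv f by (simp add: composable_pcomp_left)
    show "pcomp u w' = pcomp (pcomp u v') ?v''" unfolding pcomp_assoc using f(3) by simp
  qed (use f px in \<open>auto simp: Suc_le_eq\<close>)
  then have "len u = 0" using v'(1) by (auto simp: uf_arrow_def)
  then have "pcomp u w' = w'" using uf_arrow_composable[OF w'(1)]
    by (auto simp: pcomp_def prod_eq_iff composable_iff)
  with w(1) w'(2) show False by (simp add: in_tip_ideal_iff nontip_iff)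
qed

text \<open>Of two prefixes of one list one extends the other, and \<open>uf_arrow_prefix\<close>
  rules out a proper extension. Uniqueness of splittings comes from here.\<close>

lemma uf_arrow_unique:
  assumes "uf_arrow T u v'" "1 \<le> len v'" "v' \<in> nontip T"
    and "uf_arrow T u w'" "1 \<le> len w'" "w' \<in> nontip T"
    and "snd v' @ xs = snd w' @ ys"
  shows "v' = w'"
proof -
  from assms(7) consider zs where "snd v' @ zs = snd w'" | zs where "snd v' = snd w' @ zs"
    by (auto simp: append_eq_append_conv2)
  then have "snd v' = snd w'"
  proof cases
    case (1 zs)
    then show ?thesis using uf_arrow_prefix[OF assms(1,2,4,6), of zs] by (cases "zs = []") auto
  next
    case (2 zs)
    then show ?thesis using uf_arrow_prefix[OF assms(4,5,1,3), of zs] by (cases "zs = []") auto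
  qed
  then show ?thesis using assms by (intro path_eqI) (auto simp: nontip_iff)
qed

text \<open>The witness is the shortest prefix of \<open>v\<close> whose product with
  \<open>u\<close> contains a tip. Minimality gives the condition on proper left factors, and the
  tip found shows that this prefix is a proper right factor of an element of W.\<close>

lemma uf_arrow_shortest:
  assumes u: "u \<in> uf_verts T" "u \<in> nontip T" "1 \<le> len u" and v: "v \<in> nontip T"
    and uv: "composable Q u v" "hastip (pcomp u v)"
  obtains n where "1 \<le> n" "n \<le> len v" "uf_arrow T u (fst v, take n (snd v))"
proof -
  have paths: "u \<in> Pths" "v \<in> Pths" using u v by (auto simp: nontip_iff)
  define pre where "pre n = (fst v, take n (snd v))" for n
  have pre: "pre n \<in> Pths" "composable Q u (pre n)" "pcomp u (pre n) \<in> Pths" for n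
  proof -
    show "pre n \<in> Pths" using path_factor(1)[OF paths(2), of "take n (snd v)" "drop n (snd v)"]
      by (simp add: pre_def)
    show "composable Q u (pre n)" using uv(1) by (simp add: pre_def composable_def)
    with \<open>pre n \<in> Pths\<close> show "pcomp u (pre n) \<in> Pths" using paths by (simp add: pcomp_in_paths_iff)
  qed
  have "pre (len v) = v" by (simp add: pre_def)
  then have ex: "hastip (pcomp u (pre (len v)))" using uv by simp
  define n where "n = (LEAST n. hastip (pcomp u (pre n)))"
  have n: "hastip (pcomp u (pre n))" unfolding n_def using ex by (rule LeastI)
  have least: "\<not> hastip (pcomp u (pre m))" if "m < n" for m using not_less_Least that unfolding n_def by blast
  have nv: "n \<le> len v" unfolding n_def using ex by (rule Least_le)
  have "n \<noteq> 0"
  proof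
    assume "n = 0"
    then have "pcomp u (pre n) = u" by (simp add: pcomp_def pre_def)
    with n u show False by (simp add: nontip_iff)
  qed
  then obtain m where m: "n = Suc m" by (cases n) auto
  \<comment> \<open>A proper left factor of the product fits into the product shortened by one
    arrow, which has no tip by leastness.\<close>
  have short: "\<not> hastip w" if w: "w \<in> Pths" "snd u @ take n (snd v) = snd w @ xs" "xs \<noteq> []" for w xs
  proof
    assume "hastip w"
    have "butlast (snd u @ take n (snd v)) = snd u @ take m (snd v)"
      using m nv by (simp add: butlast_append take_Suc_conv_app_nth)
    then have "snd u @ take m (snd v) = snd w @ butlast xs" using w(2,3) by (simp add: butlast_append)
    then have "sublist (snd w) (snd (pcomp u (pre m)))" by (simp add: pcomp_def pre_def)
    from hastip_mono[OF w(1) pre(3) this \<open>hastip w\<close>] least[of m] m show False by simp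
  qed
  have "pre n \<in> uf_verts T"
  proof -
    obtain t where t: "t \<in> tips T" "sublist (snd t) (snd u @ take n (snd v))"
      using n pre(3)[of n] by (auto simp: hastip_iff) (auto simp: pcomp_def pre_def)
    then obtain a b where ab: "snd u @ take n (snd v) = a @ snd t @ b" by (auto simp: sublist_def)
    have pn: "snd (pcomp u (pre n)) = (a @ snd t) @ b" using ab by (simp add: pcomp_def pre_def)
    \<comment> \<open>The tip reaches the end of the product; otherwise a proper left factor would
      already contain it.\<close>
    have "b = []"
    proof (rule ccontr)
      assume "b \<noteq> []"
      have p: "(fst (pcomp u (pre n)), a @ snd t) \<in> Pths" by (rule path_factor(1)[OF pre(3) pn])
      moreover have "hastip (fst (pcomp u (pre n)), a @ snd t)" using t(1) p by (auto simp: hastip_iff)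
      ultimately show False using short[of "(fst (pcomp u (pre n)), a @ snd t)" b] ab \<open>b \<noteq> []\<close> by simp
    qed
    then have eq: "snd u @ take n (snd v) = a @ snd t" using ab by simp
    \<comment> \<open>The tip cannot lie inside the non-tip \<open>v\<close>, so it starts within
      \<open>u\<close>, and the nonempty overlap \<open>us\<close> makes the prefix a proper right
      factor.\<close>
    have notsub: "\<not> sublist (snd t) (take n (snd v))"
    proof
      assume "sublist (snd t) (take n (snd v))"
      then have "sublist (snd t) (snd v)" by (meson sublist_order.order_trans sublist_take)
      then have "hastip v" using t(1) hastip_iff[OF paths(2)] by blast
      then show False using v by (simp add: nontip_iff)
    qed
    obtain us where us: "snd t = us @ take n (snd v)" "us \<noteq> []"
    proof -
      from eq consider us where "snd u = a @ us" "us @ take n (snd v) = snd t"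
        | us where "take n (snd v) = us @ snd t"
        by (auto simp: append_eq_append_conv2)
      then show thesis
      proof cases
        case (1 us)
        then show thesis using that[of us] notsub by (cases "us = []") auto
      next
        case 2
        then show thesis using notsub by auto
      qed
    qed
    have tP: "t \<in> Pths" using t tips_paths by blast
    note f = path_factor[OF tP us(1)]
    have ne: "take n (snd v) \<noteq> []" using m nv by auto
    have "(awlast (fst t) us, take n (snd v)) = pre n"
      using f(2) pre(1)[of n] ne by (intro path_eqI) (auto simp: pre_def)
    with f have "composable Q (fst t, us) (pre n)" "pcomp (fst t, us) (pre n) = t" by simp_all
    moreover have "1 \<le> len (fst t, us)" using us by (auto simp: Suc_le_eq)
    ultimately show ?thesis
      using f(1) pre(1)[of n] t(1) unfolding uf_verts_def
      by (intro CollectI conjI disjI2 bexI[of _ "(fst t, us)"]) simp_all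
  qed
  have "uf_arrow T u (pre n)"
    unfolding uf_arrow_def
  proof (intro conjI disjI2 ballI impI)
    show "in_tip_ideal T (pcomp u (pre n))" using n pre(3) by (simp add: in_tip_ideal_iff)
    fix w p assume "w \<in> Pths" "p \<in> Pths"
      and h: "composable Q w p \<and> pcomp u (pre n) = pcomp w p \<and> 1 \<le> len p"
    have "snd u @ take n (snd v) = snd w @ snd p" using h by (auto simp: pcomp_def pre_def)
    moreover have "snd p \<noteq> []" using h by auto
    ultimately show "\<not> in_tip_ideal T w" using short[OF \<open>w \<in> Pths\<close>] by (simp add: in_tip_ideal_iff)
  qed (use u pre \<open>pre n \<in> uf_verts T\<close> in auto)
  then show thesis using that[of n] m nv by (simp add: pre_def)
qed

abbreviation "NT \<equiv> {w \<in> nontip T. 1 \<le> len w}"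

lemma bar_terms_iff: "(e, ws) \<in> bar_terms T n \<longleftrightarrow> e \<in> verts Q \<and> length ws = n \<and> set ws \<subseteq> NT \<and>
    successively (composable Q) ((e, []) # ws)"
  by (simp add: bar_terms_def)

lemma bar_terms_length: "x \<in> bar_terms T n \<Longrightarrow> length (snd x) = n"
  by (cases x) (simp add: bar_terms_iff)

lemma chain_terms_length: "x \<in> chain_terms T n \<Longrightarrow> length (snd x) = n"
  by (cases x) (simp add: chain_terms_def)

lemma is_chain_iff: "is_chain T (e, ws) \<longleftrightarrow> e \<in> verts Q \<and> set ws \<subseteq> NT \<and>
    successively (uf_arrow T) ((e, []) # ws)"
  by (simp add: chain_terms_def)

lemma chain_terms_bar_terms: "chain_terms T n \<subseteq> bar_terms T n"
proof
  fix x assume "x \<in> chain_terms T n"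
  then show "x \<in> bar_terms T n"
    by (cases x) (auto simp: chain_terms_def bar_terms_iff uf_arrow_composable elim!: successively_mono)
qed

lemma finite_bar_terms: "finite (bar_terms T n)"
proof -
  have "bar_terms T n \<subseteq> verts Q \<times> {ws. set ws \<subseteq> NT \<and> length ws = n}"
    by (auto simp: bar_terms_def)
  then show ?thesis
    by (rule finite_subset) (simp add: finite_nontip finite_lists_length_eq)
qed

lemma finite_chain_terms: "finite (chain_terms T n)"
  using chain_terms_bar_terms finite_bar_terms by (rule finite_subset)

lemma is_chain_append: "is_chain T (e, ws @ vs) \<Longrightarrow> is_chain T (e, ws)"
  unfolding is_chain_iff append_Cons[symmetric] successively_append_iff by auto

lemma is_chain_snoc: "is_chain T (e, ws @ [w]) \<longleftrightarrow>
    is_chain T (e, ws) \<and> w \<in> NT \<and> uf_arrow T (last ((e, []) # ws)) w"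
  unfolding is_chain_iff append_Cons[symmetric] successively_append_iff by auto

lemma is_chain_take: "is_chain T (e, take k ws) \<Longrightarrow> i \<le> k \<Longrightarrow> is_chain T (e, take i ws)"
  by (rule is_chain_append[of e "take i ws" "take (k - i) (drop i ws)"]) (simp flip: take_add)

lemma chain_terms_Nil: "(e, []) \<in> chain_terms T 0 \<longleftrightarrow> e \<in> verts Q"
  using is_chain_iff[of e "[]"] by simp

text \<open>As \<open>splits\<close> makes the first \<open>k\<close> entries a chain, the second
  conjunct turns \<open>k\<close> into the length of the longest chain prefix, the index that
  \<open>Vset\<close> and the matching refer to.\<close>

definition first_split where
  "first_split e ws k w' w'' \<longleftrightarrow> splits T e ws k w' w'' \<and> \<not> is_chain T (e, take (Suc k) ws)"

lemma attached_iff: "attached T (e, ws) \<longleftrightarrow> ws \<noteq> [] \<and> (e, ws) \<in> bar_terms T (length ws) \<and>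
    successively (\<lambda>u v. hastip (pcomp u v)) ws"
  by (simp add: attached_def successively_conv_nth)

lemma splitsD:
  assumes "splits T e ws k w' w''"
  shows "k < length ws" "w' \<in> Pths" "w'' \<in> Pths" "composable Q w' w''" "1 \<le> len w'" "1 \<le> len w''"
    "ws ! k = pcomp w' w''" "is_chain T (e, take k ws)" "w' \<in> NT"
    "uf_arrow T (last ((e, []) # take k ws)) w'"
  using assms unfolding splits_def is_chain_snoc by auto

text \<open>At the end of the longest chain prefix, attachedness provides a tip across the joint, so
  some prefix of the next entry continues the chain. It is a proper prefix because the chain prefix
  was longest.\<close>

lemma first_splitI:
  assumes att: "attached T (e, ws)" and nch: "\<not> is_chain T (e, ws)"
  obtains k w' w'' where "first_split e ws k w' w''"
proof -
  have bar: "(e, ws) \<in> bar_terms T (length ws)" and tip: "successively (\<lambda>u v. hastip (pcomp u v)) ws"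
    using att by (simp_all add: attached_iff)
  define K where "K = {k. k \<le> length ws \<and> is_chain T (e, take k ws)}"
  have "0 \<in> K" using bar by (auto simp: K_def chain_terms_Nil bar_terms_iff)
  moreover have finK: "finite K" unfolding K_def by simp
  ultimately have "Max K \<in> K" by (intro Max_in) auto
  define k where "k = Max K"
  have k: "k \<le> length ws" "is_chain T (e, take k ws)" using \<open>Max K \<in> K\<close> by (auto simp: k_def K_def)
  have "k \<noteq> length ws" using k(2) nch by auto
  then have kl: "k < length ws" using k(1) by simp
  have nk: "\<not> is_chain T (e, take (Suc k) ws)"
  proof
    assume "is_chain T (e, take (Suc k) ws)"
    then have "Suc k \<in> K" using kl by (simp add: K_def)
    then have "Suc k \<le> k" using finK unfolding k_def by (rule Max_ge[rotated])
    then show False by simp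
  qed
  let ?v = "ws ! k" and ?u = "last ((e, []) # take k ws)"
  have "set ws \<subseteq> NT" using bar by (simp add: bar_terms_iff)
  then have v: "?v \<in> NT" using nth_mem[OF kl] by blast
  then have vP: "?v \<in> Pths" by (simp add: nontip_iff)
  have e: "e \<in> verts Q" using bar by (simp add: bar_terms_iff)
  have uv: "composable Q ?u ?v"
  proof -
    have "successively (composable Q) (((e, []) # take k ws) @ ?v # drop (Suc k) ws)"
      using bar kl by (simp add: bar_terms_iff id_take_nth_drop[symmetric])
    then show ?thesis unfolding successively_append_iff by simp
  qed
  have "\<exists>n. 1 \<le> n \<and> n \<le> len ?v \<and> uf_arrow T ?u (fst ?v, take n (snd ?v))"
  proof (cases k)
    \<comment> \<open>With an empty chain prefix the Uf-arrow leaves a vertex, so the piece split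
      off is the first arrow.\<close>
    case 0
    have P: "(fst ?v, take 1 (snd ?v)) \<in> Pths"
      using path_factor(1)[OF vP, of "take 1 (snd ?v)" "drop 1 (snd ?v)"] by simp
    have "(e, []) \<in> Pths" using e by (simp add: paths_iff awalk_Nil_iff)
    moreover have "len (fst ?v, take 1 (snd ?v)) = 1" using v by simp
    ultimately have "uf_arrow T ?u (fst ?v, take 1 (snd ?v))"
      using P uv 0 by (auto simp: uf_arrow_def uf_verts_def composable_def)
    then show ?thesis using v by (intro exI[of _ 1]) auto
  next
    case (Suc i)
    have u: "?u = ws ! i" using Suc kl by (simp add: take_Suc_conv_app_nth)
    have "is_chain T (e, take i ws @ [ws ! i])" using k(2) Suc kl by (simp add: take_Suc_conv_app_nth)
    then have "ws ! i \<in> NT" "uf_arrow T (last ((e, []) # take i ws)) (ws ! i)"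
      unfolding is_chain_snoc by auto
    moreover from this have "ws ! i \<in> uf_verts T" by (simp add: uf_arrow_def)
    moreover have "hastip (pcomp (ws ! i) ?v)"
      using tip kl Suc by (auto simp: successively_conv_nth)
    ultimately show ?thesis
      using uf_arrow_shortest[of "ws ! i" ?v] v uv unfolding u by blast
  qed
  then obtain n where n: "1 \<le> n" "n \<le> len ?v" "uf_arrow T ?u (fst ?v, take n (snd ?v))" by blast
  let ?w' = "(fst ?v, take n (snd ?v))" and ?w'' = "(awlast (fst ?v) (take n (snd ?v)), drop n (snd ?v))"
  note f = path_factor[OF vP, of "take n (snd ?v)" "drop n (snd ?v)", simplified]
  have nt: "?w' \<in> NT" using nontip_sublist[OF f(1), of ?v] v n by (auto simp: sublist_take)
  have ch: "is_chain T (e, take k ws @ [?w'])" using k(2) nt n(3) unfolding is_chain_snoc by blast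
  have "n \<noteq> len ?v"
  proof
    assume "n = len ?v"
    then have "?w' = ?v" by simp
    then have "is_chain T (e, take (Suc k) ws)" using ch kl by (simp add: take_Suc_conv_app_nth)
    with nk show False by simp
  qed
  then have "splits T e ws k ?w' ?w''"
    using f n kl ch unfolding splits_def by auto
  then show thesis using that nk unfolding first_split_def by blast
qed

text \<open>A split beyond \<open>k\<close> would require the first \<open>Suc k\<close> entries to
  form a chain.\<close>

lemma splits_le_first_split:
  "first_split e ws k w' w'' \<Longrightarrow> splits T e ws i u u' \<Longrightarrow> i \<le> k"
  using is_chain_take[of e i ws "Suc k"] splitsD(8)[of e ws i u u']
  unfolding first_split_def by (meson not_less_eq_eq)

lemma splits_unique:
  assumes "splits T e ws k w' w''" "splits T e ws k u' u''"
  shows "w' = u' \<and> w'' = u''"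
proof -
  note a = splitsD[OF assms(1)] and b = splitsD[OF assms(2)]
  have eq: "pcomp w' w'' = pcomp u' u''" using a(7) b(7) by simp
  then have "snd w' @ snd w'' = snd u' @ snd u''" by (simp add: pcomp_def)
  with uf_arrow_unique[OF a(10,5) _ b(10,5)] a(9) b(9) have "w' = u'" by simp
  moreover from this have "fst w'' = fst u''" "snd w'' = snd u''"
    using eq a(4) b(4) by (simp_all add: pcomp_def composable_def)
  ultimately show ?thesis by (simp add: prod_eq_iff)
qed

lemma first_split_unique:
  assumes "first_split e ws k w' w''" "first_split e ws i u' u''"
  shows "i = k \<and> u' = w' \<and> u'' = w''"
proof -
  have "i = k" using splits_le_first_split assms unfolding first_split_def by (meson le_antisym)
  then show ?thesis using splits_unique assms unfolding first_split_def by blast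
qed

text \<open>Translates the "largest position" rule of the attached procedure into
  \<open>first_split\<close>, the form in which it meets the matching.\<close>

lemma greatest_split_first:
  assumes "attached T (e, ws)" "\<not> is_chain T (e, ws)"
    and "splits T e ws i u' u''" "\<forall>i' u u'. splits T e ws i' u u' \<longrightarrow> i' \<le> i"
  shows "first_split e ws i u' u''"
proof -
  obtain k w' w'' where k: "first_split e ws k w' w''" using first_splitI[OF assms(1,2)] by blast
  then have "k \<le> i" using assms(4) unfolding first_split_def by blast
  moreover have "i \<le> k" using splits_le_first_split[OF k assms(3)] .
  ultimately show ?thesis using k assms(3) unfolding first_split_def by simp
qed

section \<open>The differential of a split bar term\<close>

text \<open>The bar term of \<gamma> with index 1, without its sign; it will be the matching partner
  of \<open>(e, ws)\<close>.\<close>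

definition up where
  "up e ws k w' w'' = (e, take k ws @ [w', w''] @ drop (Suc k) ws)"

text \<open>The bar term \<Gamma> with index 1, meaningful when a next entry exists and the product
  is nonzero.\<close>

definition down where
  "down e ws k w' w'' = (e, take k ws @ [w', pcomp w'' (ws ! Suc k)] @ drop (Suc (Suc k)) ws)"

lemma bar_terms_nth: "(e, ws) \<in> bar_terms T n \<Longrightarrow> i < length ws \<Longrightarrow> ws ! i \<in> NT"
  unfolding bar_terms_iff using nth_mem by blast

lemma bar_terms_pair:
  assumes "(e, ws) \<in> bar_terms T n" "Suc i < length ws"
  shows "composable Q (ws ! i) (ws ! Suc i)" "pcomp (ws ! i) (ws ! Suc i) \<in> Pths"
proof -
  have "successively (composable Q) ((e, []) # ws)" using assms by (simp add: bar_terms_iff)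
  from successively_nth[OF this, of "Suc i"] assms(2)
  show "composable Q (ws ! i) (ws ! Suc i)" by simp
  with bar_terms_nth[OF assms(1)] assms(2) show "pcomp (ws ! i) (ws ! Suc i) \<in> Pths"
    by (simp add: pcomp_in_paths_iff nontip_iff)
qed

lemma pcomp_not_pivot_after:
  assumes "w \<in> NT" "composable Q w p"
  shows "pcomp p q \<notin> pivots"
proof
  assume "pcomp p q \<in> pivots"
  then have "fst p = source T" using pivots_branches by (auto simp: branches_def pcomp_def)
  moreover have "snd w \<noteq> []" using assms by auto
  ultimately show False
    using assms tgt_neq_source[of w] by (simp add: composable_def nontip_iff)
qed

lemma pcomp_not_pivot_before:
  assumes "w \<in> NT" "composable Q q w" "composable Q p q" "pcomp p q \<in> Pths"
  shows "pcomp p q \<notin> pivots"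
proof
  assume "pcomp p q \<in> pivots"
  then have "tgt Q (pcomp p q) = sink T" using pivots_branches by (auto simp: branches_def)
  moreover have "snd w \<noteq> []" using assms by auto
  ultimately show False
    using assms fst_neq_sink[of w] tgt_pcomp[OF assms(4,3)] by (simp add: composable_def nontip_iff)
qed

text \<open>Among three or more entries an adjacent pair has a neighbour, on the right of the first
  pair and on the left of any other, and a branch admits no nontrivial neighbour.\<close>

lemma bar_terms_pair_not_pivot:
  assumes bar: "(e, ws) \<in> bar_terms T n" and i: "Suc i < length ws" and l: "3 \<le> length ws"
  shows "pcomp (ws ! i) (ws ! Suc i) \<notin> pivots"
proof (cases i)
  case 0
  with l have l: "Suc (Suc i) < length ws" by simp
  show ?thesis
    using pcomp_not_pivot_before[OF bar_terms_nth[OF bar l] bar_terms_pair(1)[OF bar l] bar_terms_pair[OF bar i]] .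
next
  case (Suc j)
  with i have j: "Suc j < length ws" "j < length ws" by simp_all
  show ?thesis
    unfolding Suc by (rule pcomp_not_pivot_after[OF bar_terms_nth[OF bar j(2)] bar_terms_pair(1)[OF bar j(1)]])
qed

lemma up_in_bar_terms:
  assumes bar: "(e, ws) \<in> bar_terms T n" and s: "splits T e ws k w' w''"
  shows "up e ws k w' w'' \<in> bar_terms T (Suc n)"
proof -
  note s = splitsD[OF s]
  define A B where "A = take k ws" and "B = drop (Suc k) ws"
  have ws: "ws = A @ pcomp w' w'' # B"
    using id_take_nth_drop[OF s(1)] s(7) by (simp add: A_def B_def)
  have P: "pcomp w' w'' \<in> Pths" using s by (simp add: pcomp_in_paths_iff)
  have "pcomp w' w'' \<in> NT" using bar_terms_nth[OF bar s(1)] s(7) by simp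
  then have "w'' \<in> NT" using nontip_sublist[OF s(3), of "pcomp w' w''"] s(6) by (simp add: pcomp_def)
  moreover have "set ws \<subseteq> NT" using bar by (simp add: bar_terms_iff)
  ultimately have "set (A @ [w', w''] @ B) \<subseteq> NT" using s(9) by (auto simp: ws)
  moreover have "successively (composable Q) (((e, []) # A) @ [w', w''] @ B)"
  proof -
    have "successively (composable Q) (((e, []) # A) @ pcomp w' w'' # B)"
      using bar by (simp add: bar_terms_iff ws)
    then show ?thesis
      using s(4) composable_pcomp_left[OF P s(4)]
      unfolding successively_append_iff by (auto simp: successively_Cons)
  qed
  moreover have "length (A @ [w', w''] @ B) = Suc n" using bar by (simp add: bar_terms_iff ws)
  moreover have "e \<in> verts Q" using bar by (simp add: bar_terms_iff)
  ultimately show ?thesis by (simp add: up_def bar_terms_iff flip: A_def B_def)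
qed

text \<open>Since \<open>w'\<close> stands directly in front, the product is not a whole branch; it
  is either a non-tip or zero in A, with no rewriting.\<close>

lemma splits_down_product:
  assumes bar: "(e, ws) \<in> bar_terms T n" and s: "splits T e ws k w' w''" and k: "Suc k < length ws"
  shows "composable Q w'' (ws ! Suc k)" "pcomp w'' (ws ! Suc k) \<in> Pths" "pcomp w'' (ws ! Suc k) \<notin> pivots"
proof -
  note s = splitsD[OF s]
  have P: "pcomp w' w'' \<in> Pths" using s by (simp add: pcomp_in_paths_iff)
  show c: "composable Q w'' (ws ! Suc k)"
    using bar_terms_pair(1)[OF bar k] composable_pcomp_left[OF P s(4)] by (simp add: s(7))
  show "pcomp w'' (ws ! Suc k) \<in> Pths"
    using c s(3) bar_terms_nth[OF bar k] by (simp add: pcomp_in_paths_iff nontip_iff)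
  show "pcomp w'' (ws ! Suc k) \<notin> pivots"
    using pcomp_not_pivot_after s(4,9) by blast
qed

text \<open>Three joints are new. Before \<open>w'\<close> the tip comes from the Uf-arrow; the
  product of \<open>w'\<close> with the merged entry is the old product regrouped; and the product
  of the merged entry with its successor contains an old product.\<close>

lemma down_attached:
  assumes att: "attached T (e, ws)" and s: "splits T e ws k w' w''" and k: "Suc k < length ws"
    and nt: "pcomp w'' (ws ! Suc k) \<in> nontip T"
  shows "attached T (down e ws k w' w'')"
proof -
  have bar: "(e, ws) \<in> bar_terms T (length ws)" and tip: "successively (\<lambda>u v. hastip (pcomp u v)) ws"
    using att by (simp_all add: attached_iff)
  note d = splits_down_product[OF bar s k]
  note s = splitsD[OF s]
  define A B c where "A = take k ws" and "B = drop (Suc (Suc k)) ws" and "c = ws ! Suc k"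
  have ws: "ws = A @ pcomp w' w'' # c # B"
    using id_take_nth_drop[OF s(1)] s(7) Cons_nth_drop_Suc[OF k] by (simp add: A_def B_def c_def)
  note nt = nt[folded c_def] and d = d[folded c_def]
  have P: "pcomp w' w'' \<in> Pths" using s by (simp add: pcomp_in_paths_iff)
  have setws: "set ws \<subseteq> NT" using bar by (simp add: bar_terms_iff)
  then have "set (A @ [w', pcomp w'' c] @ B) \<subseteq> NT" using s(6,9) nt by (auto simp: ws)
  moreover have comp: "successively (composable Q) (((e, []) # A) @ pcomp w' w'' # c # B)"
    using bar by (simp add: bar_terms_iff ws)
  then have "successively (composable Q) (((e, []) # A) @ [w', pcomp w'' c] @ B)"
    using s(4) composable_pcomp_left[OF d(2,1)]
    unfolding successively_append_iff by (auto simp: successively_Cons)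
  moreover have "successively (\<lambda>u v. hastip (pcomp u v)) (A @ [w', pcomp w'' c] @ B)"
  proof -
    have t: "successively (\<lambda>u v. hastip (pcomp u v)) (A @ pcomp w' w'' # c # B)"
      using tip by (simp add: ws)
    have "hastip (pcomp (last A) w')" if "A \<noteq> []"
    proof -
      have "last A \<in> NT" using that setws by (simp add: ws subset_iff)
      then show ?thesis using uf_arrow_hastip[OF s(10)] that by (simp add: A_def[symmetric])
    qed
    moreover have "hastip (pcomp w' (pcomp w'' c))"
      using t by (simp add: successively_append_iff successively_Cons pcomp_assoc)
    moreover have "hastip (pcomp (pcomp w'' c) (hd B))" if "B \<noteq> []"
    proof -
      have cb: "composable Q c (hd B)" using comp that by (simp add: successively_append_iff successively_Cons)
      have "c \<in> NT" "hd B \<in> NT" using setws that by (simp_all add: ws subset_iff)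
      then have P1: "pcomp c (hd B) \<in> Pths" using cb by (simp add: pcomp_in_paths_iff nontip_iff)
      then have P2: "pcomp (pcomp w'' c) (hd B) \<in> Pths"
        using d(1) s(3) by (simp add: pcomp_assoc pcomp_in_paths_iff)
      have "hastip (pcomp c (hd B))" using t that by (simp add: successively_append_iff successively_Cons)
      then show ?thesis by (rule hastip_mono[OF P1 P2, rotated]) (simp add: pcomp_def)
    qed
    ultimately show ?thesis
      using t unfolding successively_append_iff by (auto simp: successively_Cons)
  qed
  moreover have "e \<in> verts Q" using bar by (simp add: bar_terms_iff)
  ultimately show ?thesis by (simp add: down_def attached_iff bar_terms_iff flip: A_def B_def c_def)
qed

definition face where
  "face e ws j = (let y = expand T (path_class T (ws ! (j - 1)) \<otimes>\<^bsub>toupie_quot T\<^esub> path_class T (ws ! j))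
     in \<Sum>b\<in>Poly_Mapping.keys y. Poly_Mapping.single (e, take (j - 1) ws @ b # drop (j + 1) ws) ((-1) ^ j * Poly_Mapping.lookup y b))"

lemma bar_diff_face: "bar_diff T (e, ws) = (\<Sum>j\<in>{1..<length ws}. face e ws j)"
  by (simp add: bar_diff_def face_def)

lemma face_eq:
  assumes "(e, ws) \<in> bar_terms T n" "Suc i < length ws"
  shows "face e ws (Suc i) = (let y = expand T (path_class T (pcomp (ws ! i) (ws ! Suc i)))
     in \<Sum>b\<in>Poly_Mapping.keys y. Poly_Mapping.single (e, take i ws @ b # drop (Suc (Suc i)) ws) ((-1) ^ Suc i * Poly_Mapping.lookup y b))"
proof -
  have "path_class T (ws ! i) \<otimes>\<^bsub>toupie_quot T\<^esub> path_class T (ws ! Suc i)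
      = path_class T (pcomp (ws ! i) (ws ! Suc i))"
    using bar_terms_nth[OF assms(1)] bar_terms_pair(1)[OF assms] assms(2)
    by (intro path_class_mult) (auto simp: nontip_iff)
  then show ?thesis by (simp add: face_def)
qed

lemma face_nontip:
  assumes "(e, ws) \<in> bar_terms T n" "Suc i < length ws" "pcomp (ws ! i) (ws ! Suc i) \<in> nontip T"
  shows "face e ws (Suc i) =
    Poly_Mapping.single (e, take i ws @ pcomp (ws ! i) (ws ! Suc i) # drop (Suc (Suc i)) ws) ((-1) ^ Suc i)"
  unfolding face_eq[OF assms(1,2)] expand_nontip[OF assms(3)] by (simp add: Let_def)

lemma face_zero:
  assumes "(e, ws) \<in> bar_terms T n" "Suc i < length ws"
    and "hastip (pcomp (ws ! i) (ws ! Suc i))" "pcomp (ws ! i) (ws ! Suc i) \<notin> pivots"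
  shows "face e ws (Suc i) = 0"
proof -
  have "pcomp (ws ! i) (ws ! Suc i) \<notin> nontip T" using assms(3) by (simp add: nontip_iff)
  from nontip_cases[OF bar_terms_pair(2)[OF assms(1,2)] this] assms(4)
  obtain u where "u \<in> mon_rels T" "subpath Q u (pcomp (ws ! i) (ws ! Suc i))" by blast
  from expand_mon[OF this] show ?thesis unfolding face_eq[OF assms(1,2)] by simp
qed

text \<open>Faces \<open>Suc k\<close> and \<open>Suc (Suc k)\<close> merge \<open>w''\<close> with
  its left and right neighbour, hence the opposite signs. At every other joint the product contains
  a tip and is not a pivot, so that face vanishes.\<close>

lemma bar_diff_up:
  assumes att: "attached T (e, ws)" and s: "splits T e ws k w' w''"
  shows "bar_diff T (up e ws k w' w'') = Poly_Mapping.single (e, ws) ((-1) ^ Suc k) +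
    (if Suc k < length ws \<and> pcomp w'' (ws ! Suc k) \<in> nontip T
     then Poly_Mapping.single (down e ws k w' w'') ((-1) ^ k) else 0)"
proof -
  have bar: "(e, ws) \<in> bar_terms T (length ws)" and tip: "successively (\<lambda>u v. hastip (pcomp u v)) ws"
    using att by (simp_all add: attached_iff)
  define us where "us = take k ws @ [w', w''] @ drop (Suc k) ws"
  have upeq: "up e ws k w' w'' = (e, us)" by (simp add: up_def us_def)
  have barus: "(e, us) \<in> bar_terms T (Suc (length ws))"
    using up_in_bar_terms[OF bar s] by (simp add: upeq)
  note d = splits_down_product[OF bar s]
  note s = splitsD[OF s]
  have lus: "length us = Suc (length ws)" using s(1) by (simp add: us_def)
  have us_lt: "us ! i = ws ! i" if "i < k" for i using that s(1) by (simp add: us_def nth_append)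
  have us_k: "us ! k = w'" "us ! Suc k = w''" using s(1) by (simp_all add: us_def nth_append)
  have us_gt: "us ! Suc i = ws ! i" if "k < i" "i < length ws" for i
    using that s(1) by (simp add: us_def nth_append nth_Cons' Suc_diff_le)
  have zero: "face e us j = 0" if j: "j \<in> {1..<length us} - {Suc k, Suc (Suc k)}" for j
  proof -
    obtain i where i: "j = Suc i" using j by (cases j) auto
    have il: "Suc i < length us" "i \<noteq> k" "i \<noteq> Suc k" using j by (auto simp: i)
    \<comment> \<open>For a single entry \<open>ws\<close> only face \<open>Suc k\<close> exists, so
      any further face forces \<open>us\<close> to have at least three entries.\<close>
    have "length ws \<noteq> 1" using il s(1) lus by auto
    then have l3: "3 \<le> length us" using s(1) by (simp add: lus)
    have "hastip (pcomp (us ! i) (us ! Suc i))"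
    proof -
      consider "Suc i < k" | "Suc i = k" | m where "i = Suc m" "k < m" using il by (cases i) fastforce+
      then show ?thesis
      proof cases
        case 1
        then show ?thesis using us_lt tip s(1) by (auto simp: successively_conv_nth)
      next
        \<comment> \<open>The entry before the split is now followed by \<open>w'\<close> instead of
          the full entry; attachedness says nothing here, but the Uf-arrow into \<open>w'\<close>
          supplies a tip.\<close>
        case 2
        have "last ((e, []) # take k ws) = ws ! i" using 2 s(1) by (auto simp: take_Suc_conv_app_nth)
        then show ?thesis
          using uf_arrow_hastip[OF s(10)] bar_terms_nth[OF bar, of i] 2 s(1) us_lt[of i] us_k by auto
      next
        case (3 m)
        then show ?thesis using us_gt[of m] us_gt[of "Suc m"] il tip by (auto simp: lus successively_conv_nth)
      qed
    qed
    then show ?thesis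
      unfolding i using face_zero[OF barus il(1)] bar_terms_pair_not_pivot[OF barus il(1) l3] by blast
  qed
  have f1: "face e us (Suc k) = Poly_Mapping.single (e, ws) ((-1) ^ Suc k)"
  proof -
    have eq: "pcomp (us ! k) (us ! Suc k) = ws ! k" by (simp add: us_k s(7))
    have "pcomp (us ! k) (us ! Suc k) \<in> nontip T" unfolding eq using bar_terms_nth[OF bar s(1)] by simp
    from face_nontip[OF barus _ this] have "face e us (Suc k) =
        Poly_Mapping.single (e, take k us @ (ws ! k) # drop (Suc (Suc k)) us) ((-1) ^ Suc k)"
      using s(1) lus by (simp add: eq)
    moreover have "take k us @ (ws ! k) # drop (Suc (Suc k)) us = ws"
      using id_take_nth_drop[OF s(1)] s(1) by (simp add: us_def)
    ultimately show ?thesis by simp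
  qed
  have f2: "face e us (Suc (Suc k)) = (if pcomp w'' (ws ! Suc k) \<in> nontip T
     then Poly_Mapping.single (down e ws k w' w'') ((-1) ^ k) else 0)" if k: "Suc k < length ws"
  proof -
    have kl: "Suc (Suc k) < length us" using k lus by simp
    have eq: "pcomp (us ! Suc k) (us ! Suc (Suc k)) = pcomp w'' (ws ! Suc k)"
      using us_gt[of "Suc k"] k by (simp add: us_k)
    show ?thesis
    proof (cases "pcomp w'' (ws ! Suc k) \<in> nontip T")
      case True
      have "take (Suc k) us = take k ws @ [w']" "drop (Suc (Suc (Suc k))) us = drop (Suc (Suc k)) ws"
        using s(1) by (simp_all add: us_def)
      then show ?thesis using True face_nontip[OF barus kl] unfolding eq by (simp add: down_def)
    next
      case False
      then have "hastip (pcomp w'' (ws ! Suc k))" using d(2)[OF k] by (simp add: nontip_iff)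
      then show ?thesis using False d(3)[OF k] face_zero[OF barus kl] unfolding eq by simp
    qed
  qed
  have "bar_diff T (up e ws k w' w'') = (\<Sum>j\<in>{1..<length us}. face e us j)"
    by (simp add: upeq bar_diff_face)
  also have "\<dots> = (\<Sum>j\<in>{1..<length us} \<inter> {Suc k, Suc (Suc k)}. face e us j)"
    using zero by (intro sum.mono_neutral_right) auto
  also have "{1..<length us} \<inter> {Suc k, Suc (Suc k)} =
      (if Suc k < length ws then {Suc k, Suc (Suc k)} else {Suc k})"
    using s(1) by (auto simp: lus)
  finally show ?thesis using f1 f2 by simp
qed

section \<open>The Morse matching\<close>

text \<open>The chain prefix of the split term has exactly \<open>Suc k\<close> entries: a Uf-arrow
  from \<open>w'\<close> to \<open>w''\<close> would put a tip into the non-tip that was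
  split.\<close>

lemma up_prefixes:
  assumes bar: "(e, ws) \<in> bar_terms T n" and s: "splits T e ws k w' w''"
  shows "up e ws k w' w'' = (e, us) \<Longrightarrow> is_chain T (e, take (Suc k) us)"
    "up e ws k w' w'' = (e, us) \<Longrightarrow> \<not> is_chain T (e, take (Suc (Suc k)) us)"
proof -
  assume us: "up e ws k w' w'' = (e, us)"
  have k: "k < length ws" using splitsD(1)[OF s] .
  then have "take (Suc k) us = take k ws @ [w']" "take (Suc (Suc k)) us = (take k ws @ [w']) @ [w'']"
    using us by (auto simp: up_def)
  moreover have "is_chain T (e, take k ws @ [w'])" using s unfolding splits_def by blast
  moreover have "\<not> is_chain T (e, (take k ws @ [w']) @ [w''])"
  proof
    assume "is_chain T (e, (take k ws @ [w']) @ [w''])"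
    then have "uf_arrow T w' w''" unfolding is_chain_snoc by simp
    then have "hastip (ws ! k)" using uf_arrow_hastip splitsD(5,7)[OF s] by metis
    then show False using bar_terms_nth[OF bar k] by (simp add: nontip_iff)
  qed
  ultimately show "is_chain T (e, take (Suc k) us)" "\<not> is_chain T (e, take (Suc (Suc k)) us)"
    by simp_all
qed

text \<open>The position can be recovered from the split term as the length of its longest chain
  prefix minus one.\<close>

lemma up_index_unique:
  assumes "(e, ws) \<in> bar_terms T n" "splits T e ws k w' w''"
    and "(e, vs) \<in> bar_terms T m" "splits T e vs i v' v''"
    and eq: "up e ws k w' w'' = up e vs i v' v''"
  shows "i = k"
proof -
  obtain us where us: "up e ws k w' w'' = (e, us)" by (simp add: up_def)
  note a = up_prefixes[OF assms(1,2) us] and b = up_prefixes[OF assms(3,4) us[unfolded eq]]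
  have "\<not> Suc (Suc k) \<le> Suc i" using a(2) is_chain_take[OF b(1)] by blast
  moreover have "\<not> Suc (Suc i) \<le> Suc k" using b(2) is_chain_take[OF a(1)] by blast
  ultimately show ?thesis by simp
qed

lemma matchedD:
  assumes "matched T y (e, ws)"
  obtains k w' w'' where "first_split e ws k w' w''" "y = up e ws k w' w''"
proof -
  from assms obtain k w' w'' q where h: "k < length ws" "w' \<in> Pths" "w'' \<in> Pths" "composable Q w' w''"
      "ws ! k = pcomp w' w''" and y: "y = up e ws k w' w''"
      and V: "y \<in> Vset T q (k + 1) (length ws + 1)" "(e, ws) \<in> Vset T q k (length ws)"
    unfolding matched_def up_def by auto
  obtain us where us: "y = (e, us)" "us = take k ws @ [w', w''] @ drop (Suc k) ws" using y by (simp add: up_def)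
  have bar: "(e, us) \<in> bar_terms T (length ws + 1)" and ch: "is_chain T (e, take (Suc k) us)"
    using V(1) us by (auto simp: Vset_def)
  have "take (Suc k) us = take k ws @ [w']" using h(1) by (simp add: us)
  moreover have "us ! k = w'" "us ! Suc k = w''" using h(1) by (simp_all add: us nth_append)
  \<comment> \<open>\<open>matched\<close> allows trivial factors; they are excluded because both
    factors are entries of a bar term.\<close>
  then have "1 \<le> len w'" "1 \<le> len w''"
    using bar_terms_nth[OF bar, of k] bar_terms_nth[OF bar, of "Suc k"] h(1) us(2) by auto
  ultimately have "splits T e ws k w' w''" using h ch unfolding splits_def by simp
  moreover have "\<not> is_chain T (e, take (Suc k) ws)" using V(2) h(1) by (auto simp: Vset_def)
  ultimately show thesis using that y unfolding first_split_def by blast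
qed

text \<open>Together with \<open>matched_source_not_chain\<close> this says that chains are
  critical: no arrow of the matching touches them.\<close>

lemma matched_target_not_chain: "matched T y x \<Longrightarrow> \<not> is_chain T x"
proof
  assume m: "matched T y x" and c: "is_chain T x"
  obtain e ws where x: "x = (e, ws)" by (cases x)
  obtain k w' w'' where "first_split e ws k w' w''" using matchedD m unfolding x by blast
  then have "\<not> is_chain T (e, take (Suc k) ws)" "k < length ws"
    using splitsD(1) unfolding first_split_def by blast+
  then show False using is_chain_take[of e "length ws" ws "Suc k"] c unfolding x by simp
qed

lemma matched_source_not_chain:
  assumes m: "matched T y x"
  shows "\<not> is_chain T y"
proof
  assume c: "is_chain T y"
  obtain e ws where x: "x = (e, ws)" by (cases x)
  obtain k w' w'' where k: "first_split e ws k w' w''" and y: "y = up e ws k w' w''"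
    using matchedD m unfolding x by blast
  have "bar_arrow T y x" using m unfolding matched_def by blast
  then obtain n where "(e, ws) \<in> bar_terms T n" unfolding bar_arrow_def x by blast
  moreover have s: "splits T e ws k w' w''" using k unfolding first_split_def by blast
  moreover obtain us where us: "up e ws k w' w'' = (e, us)" by (simp add: up_def)
  ultimately have nc: "\<not> is_chain T (e, take (Suc (Suc k)) us)" by (intro up_prefixes(2))
  have "Suc (Suc k) \<le> length us" using us splitsD(1)[OF s] by (auto simp: up_def)
  then show False using nc c is_chain_take[of e "length us" us "Suc (Suc k)"] unfolding y us by simp
qed

lemma dotted_length: "dotted T x y \<Longrightarrow> length (snd y) = Suc (length (snd x))"
  by (auto simp: dotted_def matched_def)

lemma bar_diff_length:
  assumes "Poly_Mapping.lookup (bar_diff T x) y \<noteq> 0"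
  shows "length (snd x) = Suc (length (snd y))"
proof -
  obtain e ws where x: "x = (e, ws)" by (cases x)
  have "Poly_Mapping.lookup (bar_diff T x) y = (\<Sum>j\<in>{1..<length ws}. Poly_Mapping.lookup (face e ws j) y)"
    by (simp add: x bar_diff_face lookup_sum)
  with assms obtain j where j: "j \<in> {1..<length ws}" "Poly_Mapping.lookup (face e ws j) y \<noteq> 0"
    by (metis (no_types, lifting) sum.neutral)
  from j(2)[unfolded face_def Let_def lookup_sum] obtain b where
    "(e, take (j - 1) ws @ b # drop (j + 1) ws) = y"
    by (rule sum.not_neutral_contains_not_neutral) (simp add: lookup_single when_def split: if_splits)
  with j(1) show ?thesis by (auto simp: x)
qed

lemma undotted_length: "undotted T x y \<Longrightarrow> length (snd x) = Suc (length (snd y))"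
  unfolding undotted_def bar_arrow_def bar_weight_def using bar_diff_length by blast

lemma not_dotted_undotted: "dotted T x y \<Longrightarrow> \<not> undotted T x y"
  using dotted_length[of x y] undotted_length[of x y] by auto

text \<open>The case in which \<Gamma> is nonzero after the split. As the product is never a pivot
  here, being a non-tip is the same as being nonzero in A.\<close>

definition continues where
  "continues ws k w'' \<longleftrightarrow> Suc k < length ws \<and> pcomp w'' (ws ! Suc k) \<in> nontip T"

section \<open>The forced moves from an attached term that is not a chain\<close>

context
  fixes e ws k w' w''
  assumes att: "attached T (e, ws)" and fs: "first_split e ws k w' w''"
begin

lemma fs_splits: "splits T e ws k w' w''"
  using fs by (simp add: first_split_def)

lemma att_bar: "(e, ws) \<in> bar_terms T (length ws)"
  using att by (simp add: attached_iff)

lemma up_bar: "up e ws k w' w'' \<in> bar_terms T (Suc (length ws))"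
  by (rule up_in_bar_terms[OF att_bar fs_splits])

lemma down_att: "continues ws k w'' \<Longrightarrow> attached T (down e ws k w' w'')"
  using down_attached[OF att fs_splits] by (simp add: continues_def)

lemma down_length: "continues ws k w'' \<Longrightarrow> length (snd (down e ws k w' w'')) = length ws"
  by (auto simp: down_def continues_def)

text \<open>Entry \<open>k\<close> has become strictly shorter. Hence the two summands of the
  differential sit on different basis terms, and each weight can be read off separately.\<close>

lemma down_neq: "down e ws k w' w'' \<noteq> (e, ws)"
proof
  assume "down e ws k w' w'' = (e, ws)"
  then have "snd (down e ws k w' w'') ! k = ws ! k" by simp
  then have "w' = pcomp w' w''"
    using splitsD(1,7)[OF fs_splits] by (simp add: down_def nth_append)
  then have "len w' = len w' + len w''" by (metis len_pcomp)
  then show False using splitsD(6)[OF fs_splits] by simp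
qed

lemma weight_up: "bar_weight T (up e ws k w' w'') (e, ws) = (-1) ^ Suc k"
  using down_neq by (simp add: bar_weight_def bar_diff_up[OF att fs_splits] lookup_add lookup_single)

lemma weight_down: "continues ws k w'' \<Longrightarrow> bar_weight T (up e ws k w' w'') (down e ws k w' w'') = (-1) ^ k"
  using down_neq by (auto simp: bar_weight_def bar_diff_up[OF att fs_splits] lookup_add lookup_single
      continues_def when_def)

lemma matched_up: "matched T (up e ws k w' w'') (e, ws)"
proof -
  have arr: "bar_arrow T (up e ws k w' w'') (e, ws)"
    using up_bar att_bar weight_up unfolding bar_arrow_def by (auto simp del: power_Suc)
  define us where "us = take k ws @ [w', w''] @ drop (Suc k) ws"
  have us: "up e ws k w' w'' = (e, us)" by (simp add: us_def up_def)
  note s = splitsD[OF fs_splits]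
  \<comment> \<open>Splitting an entry leaves the concatenated path unchanged, so both terms belong
    to the same \<open>q\<close>.\<close>
  define q where "q = (e, concat (map snd ws))"
  have "concat (map snd us) = concat (map snd (take k ws @ (ws ! k) # drop (Suc k) ws))"
    by (simp add: us_def s(7) pcomp_def)
  then have q: "(e, concat (map snd us)) = q"
    using id_take_nth_drop[OF s(1)] by (simp add: q_def)
  have "(e, us) \<in> Vset T q (k + 1) (length ws + 1)"
    using up_prefixes[OF att_bar fs_splits us] up_bar s(1) q by (auto simp: Vset_def us)
  moreover have "(e, ws) \<in> Vset T q k (length ws)"
    using att_bar s(1,8) fs by (auto simp: Vset_def q_def first_split_def)
  ultimately show ?thesis
    using arr s(1-4,7) unfolding matched_def us us_def Suc_eq_plus1 by blast
qed

lemma dotted_iff: "dotted T (e, ws) y \<longleftrightarrow> y = up e ws k w' w''"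
proof
  assume "dotted T (e, ws) y"
  then show "y = up e ws k w' w''"
    unfolding dotted_def using matchedD first_split_unique[OF fs] by metis
qed (simp add: dotted_def matched_up)

text \<open>If both terms were matched with the same source, \<open>up_index_unique\<close> would
  force the same position, and \<open>w'\<close> would be a proper prefix of itself.\<close>

lemma not_matched_down:
  assumes c: "continues ws k w''"
  shows "\<not> matched T (up e ws k w' w'') (down e ws k w' w'')"
proof
  assume m: "matched T (up e ws k w' w'') (down e ws k w' w'')"
  obtain vs where vs: "down e ws k w' w'' = (e, vs)" by (simp add: down_def)
  obtain i v' v'' where i: "first_split e vs i v' v''" "up e ws k w' w'' = up e vs i v' v''"
    using matchedD m unfolding vs by metis
  have s': "splits T e vs i v' v''" using i(1) by (simp add: first_split_def)
  have "(e, vs) \<in> bar_terms T (length vs)" using down_att[OF c] by (simp add: vs attached_iff)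
  from up_index_unique[OF att_bar fs_splits this s' i(2)] have ik: "i = k" .
  have kl: "k < length ws" "k < length vs" using splitsD(1)[OF fs_splits] splitsD(1)[OF s'] ik by simp_all
  have "snd (up e ws k w' w'') ! k = snd (up e vs k v' v'') ! k" using i(2) ik by simp
  then have "w' = v'" using kl by (simp add: up_def nth_append)
  moreover have "vs ! k = w'" using vs kl by (auto simp: down_def nth_append)
  ultimately have "v' = pcomp v' v''" using splitsD(7)[OF s'] ik by simp
  then have "len v' = len v' + len v''" by (metis len_pcomp)
  then show False using splitsD(6)[OF s'] by simp
qed

lemma undotted_up_iff:
  "undotted T (up e ws k w' w'') z \<longleftrightarrow> continues ws k w'' \<and> z = down e ws k w' w''"
proof
  assume u: "undotted T (up e ws k w' w'') z"
  then have "z \<noteq> (e, ws)" using matched_up by (auto simp: undotted_def)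
  moreover have "Poly_Mapping.lookup (bar_diff T (up e ws k w' w'')) z \<noteq> 0"
    using u by (simp add: undotted_def bar_arrow_def bar_weight_def)
  ultimately show "continues ws k w'' \<and> z = down e ws k w' w''"
    unfolding bar_diff_up[OF att fs_splits] continues_def
    by (auto simp: lookup_add lookup_single when_def split: if_splits)
next
  assume c: "continues ws k w'' \<and> z = down e ws k w' w''"
  obtain vs where vs: "down e ws k w' w'' = (e, vs)" by (simp add: down_def)
  have "(e, vs) \<in> bar_terms T (length vs)" using down_att c by (simp add: vs attached_iff)
  then have "bar_arrow T (up e ws k w' w'') (down e ws k w' w'')"
    using up_bar weight_down c unfolding bar_arrow_def vs by auto
  then show "undotted T (up e ws k w' w'') z" using c not_matched_down by (simp add: undotted_def)
qed

text \<open>The negative inverse of \<open>(-1) ^ Suc k\<close>.\<close>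

lemma arrow_weight_up: "arrow_weight T (e, ws) (up e ws k w' w'') = (-1) ^ k"
  using dotted_iff weight_up by (simp add: arrow_weight_def power_inverse flip: power_inverse)

lemma arrow_weight_down:
  "continues ws k w'' \<Longrightarrow> arrow_weight T (up e ws k w' w'') (down e ws k w' w'') = (-1) ^ k"
  using undotted_up_iff[of "down e ws k w' w''"] weight_down
    not_dotted_undotted[of "up e ws k w' w''" "down e ws k w' w''"]
  by (auto simp: arrow_weight_def)

end

end

section \<open>Zigzag paths\<close>

lemma lin_ext_single: "lin_ext f (Poly_Mapping.single x (1::'k::field_char_0)) = f x"
  by (rule poly_mapping_eqI) (simp add: lin_ext_def Poly_Mapping.map.rep_eq when_def)

context toupie_presentation
begin

definition zigzags where
  "zigzags x y = {xs. zigzag T xs \<and> hd xs = x \<and> last xs = y}"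

lemma total_weight_zigzags: "total_weight T x y = (\<Sum>xs\<in>zigzags x y. zigzag_weight T xs)"
  by (simp add: total_weight_def zigzags_def)

lemma zigzag_Cons2: "zigzag T (a # b # r) \<longleftrightarrow> (\<exists>n. a \<in> bar_terms T n) \<and>
    (dotted T a b \<or> undotted T a b) \<and> zigzag T (b # r) \<and>
    (r \<noteq> [] \<longrightarrow> (dotted T a b \<longleftrightarrow> undotted T b (hd r)))"
proof -
  have "(\<forall>i. i + 2 < length (a # b # r) \<longrightarrow>
      (dotted T ((a # b # r) ! i) ((a # b # r) ! (i + 1)) \<longleftrightarrow> undotted T ((a # b # r) ! (i + 1)) ((a # b # r) ! (i + 2))))
    \<longleftrightarrow> (r \<noteq> [] \<longrightarrow> (dotted T a b \<longleftrightarrow> undotted T b (hd r))) \<and>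
      (\<forall>i. i + 2 < length (b # r) \<longrightarrow>
      (dotted T ((b # r) ! i) ((b # r) ! (i + 1)) \<longleftrightarrow> undotted T ((b # r) ! (i + 1)) ((b # r) ! (i + 2))))"
    (is "(\<forall>i. ?P i) \<longleftrightarrow> ?H \<and> (\<forall>i. ?R i)")
  proof -
    have "?P 0 = ?H" by (cases r) auto
    moreover have "?P (Suc i) = ?R i" for i by simp
    moreover have "(\<forall>i. ?P i) \<longleftrightarrow> ?P 0 \<and> (\<forall>i. ?P (Suc i))" using not0_implies_Suc by metis
    ultimately show ?thesis by simp
  qed
  then show ?thesis unfolding zigzag_def by auto
qed

lemma zigzag_singleton: "zigzag T [x] \<longleftrightarrow> (\<exists>n. x \<in> bar_terms T n)"
  by (simp add: zigzag_def)

lemma zigzag_weight_Cons2: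
  "zigzag_weight T (a # b # r) = arrow_weight T a b * zigzag_weight T (b # r)"
  by (simp add: zigzag_weight_def prod.lessThan_Suc_shift del: prod.lessThan_Suc)

lemma zigzag_weight_singleton: "zigzag_weight T [x] = 1"
  by (simp add: zigzag_weight_def)

lemma zigzag_arrow: "zigzag T xs \<Longrightarrow> Suc i < length xs \<Longrightarrow>
    dotted T (xs ! i) (xs ! Suc i) \<or> undotted T (xs ! i) (xs ! Suc i)"
  by (simp add: zigzag_def successively_conv_nth)

lemma zigzag_alternates:
  assumes z: "zigzag T xs"
  shows "Suc i < length xs \<Longrightarrow> dotted T (xs ! i) (xs ! Suc i) \<longleftrightarrow> (dotted T (xs ! 0) (xs ! 1) \<longleftrightarrow> even i)"
proof (induction i)
  case (Suc i)
  have "dotted T (xs ! i) (xs ! Suc i) \<longleftrightarrow> undotted T (xs ! Suc i) (xs ! Suc (Suc i))"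
    using z Suc.prems by (simp add: zigzag_def)
  moreover have "undotted T (xs ! Suc i) (xs ! Suc (Suc i)) \<longleftrightarrow> \<not> dotted T (xs ! Suc i) (xs ! Suc (Suc i))"
    using zigzag_arrow[OF z Suc.prems] not_dotted_undotted by blast
  ultimately show ?case using Suc by auto
qed simp

text \<open>Alternation confines a zigzag path to two consecutive degrees, with parity deciding
  which one. For a one-element path \<open>xs ! 1\<close> is unspecified, but at index 0 both
  branches say the same.\<close>

lemma zigzag_degree:
  assumes z: "zigzag T xs"
  shows "i < length xs \<Longrightarrow>
    (if dotted T (xs ! 0) (xs ! 1) then length (snd (xs ! i)) = length (snd (xs ! 0)) + i mod 2
     else length (snd (xs ! i)) + i mod 2 = length (snd (xs ! 0)))"
proof (induction i)
  case (Suc i)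
  from zigzag_arrow[OF z Suc.prems] show ?case
  proof
    assume d: "dotted T (xs ! i) (xs ! Suc i)"
    then have "dotted T (xs ! 0) (xs ! 1) \<longleftrightarrow> even i" using zigzag_alternates[OF z Suc.prems] by simp
    with Suc dotted_length[OF d] show ?thesis by (auto simp: mod_Suc even_iff_mod_2_eq_zero odd_iff_mod_2_eq_one split: if_splits)
  next
    assume d: "undotted T (xs ! i) (xs ! Suc i)"
    then have "dotted T (xs ! 0) (xs ! 1) \<longleftrightarrow> odd i"
      using zigzag_alternates[OF z Suc.prems] not_dotted_undotted by blast
    with Suc undotted_length[OF d] show ?thesis by (auto simp: mod_Suc even_iff_mod_2_eq_zero odd_iff_mod_2_eq_one split: if_splits)
  qed
qed simp

text \<open>The possible ends of the zigzag paths that contribute to the value of \<open>h\<close> or \<open>p\<close> at a bar term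
  of degree \<open>d\<close>.\<close>

definition hp_target where
  "hp_target d y \<longleftrightarrow> length (snd y) = Suc d \<or> is_chain T y \<and> length (snd y) = d"

lemma zigzag_to_target:
  assumes z: "zigzag T (x # z # zs)" and y: "hp_target (length (snd x)) (last (z # zs))"
  shows "dotted T x z"
proof (rule ccontr)
  assume nd: "\<not> dotted T x z"
  let ?xs = "x # z # zs"
  define m where "m = length zs"
  have l: "?xs ! Suc m = last (z # zs)" by (simp add: m_def last_conv_nth)
  have "length (snd (?xs ! Suc m)) + Suc m mod 2 = length (snd x)"
    using zigzag_degree[OF z, of "Suc m"] nd by (simp add: m_def)
  \<comment> \<open>A path starting downwards sees only degrees \<open>d\<close> and
    \<open>d - 1\<close>. Its end must be a chain of degree \<open>d\<close> at an even position,
    reached by a dotted arrow.\<close>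
  then have deg: "is_chain T (last (z # zs))" "even (Suc m)"
    using y unfolding l by (auto simp: hp_target_def even_iff_mod_2_eq_zero split: if_splits)
  then have "dotted T (?xs ! m) (?xs ! Suc m)"
    using zigzag_alternates[OF z, of m] nd by (simp add: m_def)
  then show False using deg(1) matched_source_not_chain unfolding l dotted_def by blast
qed

lemma chain_not_dotted: "is_chain T x \<Longrightarrow> \<not> dotted T x y"
  using matched_target_not_chain unfolding dotted_def by blast

lemma zigzags_chain:
  assumes c: "is_chain T x" and y: "hp_target (length (snd x)) y"
  shows "zigzags x y = (if y = x then {[x]} else {})"
proof -
  have "xs = [x]" if "xs \<in> zigzags x y" for xs
  proof -
    have xs: "zigzag T xs" "hd xs = x" "last xs = y" "xs \<noteq> []" using that by (auto simp: zigzags_def zigzag_def)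
    show ?thesis
    proof (cases "tl xs")
      case Nil
      then show ?thesis using xs by (cases xs) auto
    next
      case (Cons z zs)
      then have "xs = x # z # zs" using xs by (cases xs) auto
      then have "dotted T x z" using zigzag_to_target[of x z zs] xs y by simp
      then show ?thesis using chain_not_dotted c by blast
    qed
  qed
  then have "zigzags x y \<subseteq> {[x]}" by blast
  moreover have "[x] \<in> zigzags x x"
    using subsetD[OF chain_terms_bar_terms c] by (auto simp: zigzags_def zigzag_singleton)
  moreover have "[x] \<notin> zigzags x y" if "y \<noteq> x" using that by (simp add: zigzags_def)
  ultimately show ?thesis by (cases "y = x") auto
qed

context
  fixes e ws k w' w''
  assumes att: "attached T (e, ws)" and fs: "first_split e ws k w' w''"
begin

text \<open>All choices are forced: the only dotted arrow leads to \<open>up\<close>, and the only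
  undotted arrow from there leads to \<open>down\<close>. This is the recursion from which h and p
  are computed.\<close>

lemma zigzags_step:
  assumes y: "hp_target (length ws) y"
  shows "zigzags (e, ws) y = (if y = up e ws k w' w'' then {[(e, ws), up e ws k w' w'']} else {}) \<union>
    (if continues ws k w'' then (\<lambda>xs. (e, ws) # up e ws k w' w'' # xs) ` zigzags (down e ws k w' w'') y else {})"
    (is "_ = ?A \<union> ?B")
proof (intro equalityI subsetI)
  let ?x = "(e, ws)" and ?u = "up e ws k w' w''" and ?d = "down e ws k w' w''"
  have nch: "\<not> is_chain T ?x"
    using matched_target_not_chain[OF matched_up[OF att fs]] .
  fix xs assume "xs \<in> zigzags ?x y"
  then have xs: "zigzag T xs" "hd xs = ?x" "last xs = y" "xs \<noteq> []" by (auto simp: zigzags_def zigzag_def)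
  show "xs \<in> ?A \<union> ?B"
  proof (cases "tl xs")
    case Nil
    then have "xs = [?x]" using xs by (cases xs) auto
    then have "y = ?x" using xs by simp
    then show ?thesis using y nch by (simp add: hp_target_def)
  next
    case (Cons z zs)
    then have eq: "xs = ?x # z # zs" using xs by (cases xs) auto
    then have d: "dotted T ?x z" using zigzag_to_target[of ?x z zs] xs y by simp
    then have z: "z = ?u" using dotted_iff[OF att fs] by simp
    show ?thesis
    proof (cases zs)
      case Nil
      then show ?thesis using xs eq z by simp
    next
      case (Cons v vs)
      then have zz: "zigzag T (?x # ?u # v # vs)" using xs eq z by simp
      then have "undotted T ?u v" using d z unfolding zigzag_Cons2[of ?x] by simp
      then have "continues ws k w''" "v = ?d" using undotted_up_iff[OF att fs] by simp_all
      moreover have "zigzag T (v # vs)" using zz unfolding zigzag_Cons2 by simp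
      ultimately show ?thesis using xs eq z Cons by (auto simp: zigzags_def)
    qed
  qed
next
  let ?x = "(e, ws)" and ?u = "up e ws k w' w''" and ?d = "down e ws k w' w''"
  have d: "dotted T ?x ?u" using dotted_iff[OF att fs] by simp
  have bars: "\<exists>n. ?x \<in> bar_terms T n" "\<exists>n. ?u \<in> bar_terms T n"
    using att_bar[OF att fs] up_bar[OF att fs] by blast+
  fix xs assume "xs \<in> ?A \<union> ?B"
  then consider "xs = [?x, ?u]" "y = ?u" | ys where "continues ws k w''" "xs = ?x # ?u # ys" "ys \<in> zigzags ?d y"
    by (auto split: if_splits)
  then show "xs \<in> zigzags ?x y"
  proof cases
    case 1
    then show ?thesis using d bars by (simp add: zigzags_def zigzag_Cons2 zigzag_singleton)
  next
    case (2 ys)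
    have ys: "zigzag T ys" "hd ys = ?d" "last ys = y" "ys \<noteq> []" using 2(3) by (auto simp: zigzags_def zigzag_def)
    have u: "undotted T ?u ?d" using undotted_up_iff[OF att fs] 2(1) by simp
    then have nu: "\<not> dotted T ?u ?d" using not_dotted_undotted by blast
    obtain r where r: "ys = ?d # r" using ys by (cases ys) auto
    \<comment> \<open>Prefixing two arrows preserves alternation only if the rest starts with a
      dotted arrow; since \<open>?d\<close> has the same degree, \<open>zigzag_to_target\<close>
      ensures this.\<close>
    have "\<not> undotted T ?d (hd r)" if ne: "r \<noteq> []"
    proof -
      obtain a as where a: "r = a # as" using ne by (cases r) auto
      have "dotted T ?d a"
        using zigzag_to_target[of ?d a as] ys r a y down_length[OF att fs 2(1)] by simp
      then show ?thesis using not_dotted_undotted a by auto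
    qed
    then have "zigzag T (?u # ?d # r)" using u nu ys(1) bars unfolding zigzag_Cons2[of ?u] r by simp
    then have "zigzag T (?x # ?u # ?d # r)" using u d bars unfolding zigzag_Cons2[of ?x] by simp
    then show ?thesis using ys r 2(2) by (simp add: zigzags_def)
  qed
qed

text \<open>Propagates finiteness along the recursion, so that the sums defining
  \<open>total_weight\<close> do not collapse to the default 0.\<close>

lemma finite_zigzags_step:
  assumes "hp_target (length ws) y" "continues ws k w'' \<Longrightarrow> finite (zigzags (down e ws k w' w'') y)"
  shows "finite (zigzags (e, ws) y)"
  using assms(2) unfolding zigzags_step[OF assms(1)] by simp

lemma total_weight_step:
  assumes y: "hp_target (length ws) y"
    and fin: "continues ws k w'' \<Longrightarrow> finite (zigzags (down e ws k w' w'') y)"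
  shows "total_weight T (e, ws) y = (if y = up e ws k w' w'' then (-1) ^ k else 0) +
    (if continues ws k w'' then total_weight T (down e ws k w' w'') y else 0)"
proof -
  let ?x = "(e, ws)" and ?u = "up e ws k w' w''" and ?d = "down e ws k w' w''"
  let ?A = "if y = ?u then {[?x, ?u]} else {}"
  let ?B = "if continues ws k w'' then (\<lambda>xs. ?x # ?u # xs) ` zigzags ?d y else {}"
  have "[] \<notin> zigzags ?d y" by (simp add: zigzags_def zigzag_def)
  then have disj: "?A \<inter> ?B = {}" by auto
  have "total_weight T ?x y = sum (zigzag_weight T) ?A + sum (zigzag_weight T) ?B"
    unfolding total_weight_zigzags zigzags_step[OF y] using fin disj
    by (intro sum.union_disjoint) auto
  also have "sum (zigzag_weight T) ?A = (if y = ?u then (-1) ^ k else 0)"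
    using arrow_weight_up[OF att fs] by (simp add: zigzag_weight_Cons2 zigzag_weight_singleton)
  also have "sum (zigzag_weight T) ?B = (if continues ws k w'' then total_weight T ?d y else 0)"
  proof (cases "continues ws k w''")
    case True
    have "sum (zigzag_weight T) ?B = (\<Sum>xs\<in>zigzags ?d y. zigzag_weight T (?x # ?u # xs))"
      using True by (simp add: sum.reindex inj_on_def)
    also have "\<dots> = (\<Sum>xs\<in>zigzags ?d y. zigzag_weight T xs)"
    proof (rule sum.cong)
      fix xs assume "xs \<in> zigzags ?d y"
      then obtain r where r: "xs = ?d # r" by (cases xs) (auto simp: zigzags_def zigzag_def)
      \<comment> \<open>The dotted and the undotted arrow carry the same sign, so the detour through
        \<open>up\<close> has weight 1.\<close>
      have "(-1) ^ k * (-1) ^ k = (1::'k)" by (simp flip: power_mult_distrib)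
      then show "zigzag_weight T (?x # ?u # xs) = zigzag_weight T xs"
        using arrow_weight_up[OF att fs] arrow_weight_down[OF att fs True]
        by (simp add: r zigzag_weight_Cons2 mult.assoc[symmetric])
    qed simp
    finally show ?thesis using True by (simp add: total_weight_zigzags)
  qed simp
  finally show ?thesis .
qed

end

section \<open>Recursion for h and p\<close>

lemma h_map_single: "h_map T (Poly_Mapping.single x 1) =
    (\<Sum>y\<in>bar_terms T (length (snd x) + 1). Poly_Mapping.single y (total_weight T x y))"
  by (simp add: h_map_def lin_ext_single)

lemma p_map_single: "p_map T (Poly_Mapping.single x 1) =
    (\<Sum>y\<in>chain_terms T (length (snd x)). Poly_Mapping.single y (total_weight T x y))"
  by (simp add: p_map_def lin_ext_single)

lemma i_map_single: "i_map T (Poly_Mapping.single x 1) =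
    (\<Sum>y\<in>bar_terms T (length (snd x)). Poly_Mapping.single y (total_weight T x y))"
  by (simp add: i_map_def lin_ext_single)

lemma hp_target_bar: "y \<in> bar_terms T (d + 1) \<Longrightarrow> hp_target d y"
  using bar_terms_length by (auto simp: hp_target_def)

lemma hp_target_chain: "y \<in> chain_terms T d \<Longrightarrow> hp_target d y"
  using chain_terms_length by (auto simp: hp_target_def)

lemma hp_chain:
  assumes c: "is_chain T x"
  shows "h_map T (Poly_Mapping.single x 1) = 0" "p_map T (Poly_Mapping.single x 1) = Poly_Mapping.single x 1"
proof -
  have tw: "total_weight T x y = (if y = x then 1 else 0)" if "hp_target (length (snd x)) y" for y
    unfolding total_weight_zigzags zigzags_chain[OF c that] by (simp add: zigzag_weight_singleton)
  have "total_weight T x y = 0" if "y \<in> bar_terms T (length (snd x) + 1)" for y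
    using tw[OF hp_target_bar[OF that]] bar_terms_length[OF that] by auto
  then show "h_map T (Poly_Mapping.single x 1) = 0" unfolding h_map_single by simp
  have "p_map T (Poly_Mapping.single x 1) = (\<Sum>y\<in>chain_terms T (length (snd x)). if y = x then Poly_Mapping.single x 1 else 0)"
    unfolding p_map_single using tw[OF hp_target_chain] by (intro sum.cong) auto
  then show "p_map T (Poly_Mapping.single x 1) = Poly_Mapping.single x 1" using c finite_chain_terms by simp
qed

lemma hp_step:
  assumes att: "attached T (e, ws)" and fs: "first_split e ws k w' w''"
    and fin: "\<And>y. continues ws k w'' \<Longrightarrow> hp_target (length ws) y \<Longrightarrow> finite (zigzags (down e ws k w' w'') y)"
  shows "h_map T (Poly_Mapping.single (e, ws) 1) = Poly_Mapping.single (up e ws k w' w'') ((-1) ^ k) +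
      (if continues ws k w'' then h_map T (Poly_Mapping.single (down e ws k w' w'') 1) else 0)"
    "p_map T (Poly_Mapping.single (e, ws) 1) =
      (if continues ws k w'' then p_map T (Poly_Mapping.single (down e ws k w' w'') 1) else 0)"
proof -
  let ?u = "up e ws k w' w''" and ?d = "down e ws k w' w''"
  note tw = total_weight_step[OF att fs _ fin]
  have "h_map T (Poly_Mapping.single (e, ws) 1) = (\<Sum>y\<in>bar_terms T (length ws + 1).
      (if y = ?u then Poly_Mapping.single ?u ((-1) ^ k) else 0) +
      (if continues ws k w'' then Poly_Mapping.single y (total_weight T ?d y) else 0))"
    unfolding h_map_single using tw[OF hp_target_bar _ hp_target_bar]
    by (intro sum.cong) (auto simp: single_add)
  then show "h_map T (Poly_Mapping.single (e, ws) 1) = Poly_Mapping.single ?u ((-1) ^ k) +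
      (if continues ws k w'' then h_map T (Poly_Mapping.single ?d 1) else 0)"
    using up_bar[OF att fs] finite_bar_terms down_length[OF att fs]
    by (simp add: sum.distrib h_map_single)
  \<comment> \<open>\<open>up\<close> has one degree too many for p; only zigzag paths through
    \<open>down\<close> contribute there.\<close>
  have "y \<noteq> ?u" if "y \<in> chain_terms T (length ws)" for y
    using bar_terms_length[OF up_bar[OF att fs]] chain_terms_length[OF that] by auto
  then have "p_map T (Poly_Mapping.single (e, ws) 1) = (\<Sum>y\<in>chain_terms T (length ws).
      (if continues ws k w'' then Poly_Mapping.single y (total_weight T ?d y) else 0))"
    unfolding p_map_single using tw[OF hp_target_chain _ hp_target_chain]
    by (intro sum.cong) auto
  then show "p_map T (Poly_Mapping.single (e, ws) 1) = (if continues ws k w'' then p_map T (Poly_Mapping.single ?d 1) else 0)"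
    using down_length[OF att fs] by (simp add: p_map_single)
qed

section \<open>Attached terms\<close>

text \<open>In \<open>step x i g G\<close>, \<open>g\<close> and \<open>G\<close> stand for the \<open>\<gamma>\<^sup>j\<close> and \<open>\<Gamma>\<^sup>j\<close> produced from
  \<open>x = \<Gamma>\<^sup>j\<^sup>-\<^sup>1\<close> by splitting position \<open>i\<close>.\<close>

definition step where
  "step x i g G \<longleftrightarrow> (\<exists>e ws w' w''. x = (e, ws) \<and> \<not> is_chain T (e, ws) \<and> splits T e ws i w' w'' \<and>
     (\<forall>i' u u'. splits T e ws i' u u' \<longrightarrow> i' \<le> i) \<and>
     g = Poly_Mapping.single (e, take i ws @ [w', w''] @ drop (i + 1) ws) ((-1) ^ i :: 'k) \<and>
     G = (if i + 1 = length ws \<or> path_class T w'' \<otimes>\<^bsub>toupie_quot T\<^esub> path_class T (ws ! (i + 1)) = \<zero>\<^bsub>toupie_quot T\<^esub>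
          then 0
          else Poly_Mapping.single (e, take i ws @ [w', pcomp w'' (ws ! (i + 1))] @ drop (i + 2) ws) (1::'k)))"

lemma attached_terms_steps: "attached_terms T x n g G \<longleftrightarrow> G 0 = Poly_Mapping.single x 1 \<and>
    (\<exists>I. \<forall>j\<in>{1..n}. (\<exists>y. G (j - 1) = Poly_Mapping.single y 1 \<and> step y (I j) (g j) (G j)) \<and> (1 < j \<longrightarrow> I (j - 1) < I j)) \<and>
    (G n = 0 \<or> (\<exists>y. is_chain T y \<and> G n = Poly_Mapping.single y 1))"
proof -
  have "(\<exists>e ws w' w''. G (j - 1) = Poly_Mapping.single (e, ws) 1 \<and> \<not> is_chain T (e, ws) \<and> splits T e ws (I j) w' w'' \<and>
        (1 < j \<longrightarrow> I (j - 1) < I j) \<and> (\<forall>i' u u'. splits T e ws i' u u' \<longrightarrow> i' \<le> I j) \<and>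
        g j = Poly_Mapping.single (e, take (I j) ws @ [w', w''] @ drop (I j + 1) ws) ((-1) ^ I j) \<and>
        G j = (if I j + 1 = length ws \<or>
              path_class T w'' \<otimes>\<^bsub>toupie_quot T\<^esub> path_class T (ws ! (I j + 1)) = \<zero>\<^bsub>toupie_quot T\<^esub>
           then 0
           else Poly_Mapping.single (e, take (I j) ws @ [w', pcomp w'' (ws ! (I j + 1))] @ drop (I j + 2) ws) 1))
    \<longleftrightarrow> (\<exists>y. G (j - 1) = Poly_Mapping.single y 1 \<and> step y (I j) (g j) (G j)) \<and> (1 < j \<longrightarrow> I (j - 1) < I j)" for I j
    unfolding step_def by (intro iffI; elim exE conjE; blast)
  then show ?thesis unfolding attached_terms_def by simp
qed

lemma single_one_inject: "Poly_Mapping.single x (1::'k) = Poly_Mapping.single y 1 \<longleftrightarrow> x = y"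
  by (metis lookup_single_eq lookup_single_not_eq zero_neq_one)

lemma single_one_neq_zero: "Poly_Mapping.single x (1::'k) \<noteq> 0"
  by (metis lookup_single_eq lookup_zero zero_neq_one)

text \<open>On attached terms the stopping test by products in A becomes \<open>continues\<close>,
  because the product in question is never a pivot, and the maximality condition becomes
  \<open>first_split\<close>.\<close>

lemma step_iff:
  assumes att: "attached T (e, ws)"
  shows "step (e, ws) i g G \<longleftrightarrow> (\<exists>w' w''. first_split e ws i w' w'' \<and>
    g = Poly_Mapping.single (up e ws i w' w'') ((-1) ^ i) \<and>
    G = (if continues ws i w'' then Poly_Mapping.single (down e ws i w' w'') 1 else 0))"
proof -
  have bar: "(e, ws) \<in> bar_terms T (length ws)" using att by (simp add: attached_iff)
  have cond: "(i + 1 = length ws \<or> path_class T w'' \<otimes>\<^bsub>toupie_quot T\<^esub> path_class T (ws ! (i + 1)) = \<zero>\<^bsub>toupie_quot T\<^esub>)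
      \<longleftrightarrow> \<not> continues ws i w''" if s: "splits T e ws i w' w''" for w' w''
  proof (cases "Suc i < length ws")
    case True
    note d = splits_down_product[OF bar s True]
    have "path_class T w'' \<otimes>\<^bsub>toupie_quot T\<^esub> path_class T (ws ! Suc i) = path_class T (pcomp w'' (ws ! Suc i))"
      using d(1) splitsD(3)[OF s] bar_terms_nth[OF bar True] by (intro path_class_mult) (auto simp: nontip_iff)
    then show ?thesis using path_class_eq_zero_iff_nontip[OF d(2,3)] True by (simp add: continues_def)
  next
    case False
    then show ?thesis using splitsD(1)[OF s] by (simp add: continues_def)
  qed
  show ?thesis
  proof
    assume "step (e, ws) i g G"
    then obtain w' w'' where h: "\<not> is_chain T (e, ws)" "splits T e ws i w' w''"
        "\<forall>i' u u'. splits T e ws i' u u' \<longrightarrow> i' \<le> i"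
      and g: "g = Poly_Mapping.single (e, take i ws @ [w', w''] @ drop (i + 1) ws) ((-1) ^ i)"
      and G: "G = (if i + 1 = length ws \<or> path_class T w'' \<otimes>\<^bsub>toupie_quot T\<^esub> path_class T (ws ! (i + 1)) = \<zero>\<^bsub>toupie_quot T\<^esub>
          then 0 else Poly_Mapping.single (e, take i ws @ [w', pcomp w'' (ws ! (i + 1))] @ drop (i + 2) ws) 1)"
      unfolding step_def by blast
    have "first_split e ws i w' w''" using greatest_split_first[OF att h] .
    moreover have "g = Poly_Mapping.single (up e ws i w' w'') ((-1) ^ i)" using g by (simp add: up_def)
    moreover have "G = (if continues ws i w'' then Poly_Mapping.single (down e ws i w' w'') 1 else 0)"
      unfolding G cond[OF h(2)] by (simp add: down_def)
    ultimately show "\<exists>w' w''. first_split e ws i w' w'' \<and> g = Poly_Mapping.single (up e ws i w' w'') ((-1) ^ i) \<and>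
        G = (if continues ws i w'' then Poly_Mapping.single (down e ws i w' w'') 1 else 0)" by blast
  next
    assume "\<exists>w' w''. first_split e ws i w' w'' \<and> g = Poly_Mapping.single (up e ws i w' w'') ((-1) ^ i) \<and>
        G = (if continues ws i w'' then Poly_Mapping.single (down e ws i w' w'') 1 else 0)"
    then obtain w' w'' where fs: "first_split e ws i w' w''" and g: "g = Poly_Mapping.single (up e ws i w' w'') ((-1) ^ i)"
      and G: "G = (if continues ws i w'' then Poly_Mapping.single (down e ws i w' w'') 1 else 0)" by blast
    have s: "splits T e ws i w' w''" using fs by (simp add: first_split_def)
    have "\<not> is_chain T (e, ws)" using matched_target_not_chain[OF matched_up[OF att fs]] .
    moreover have "\<forall>i' u u'. splits T e ws i' u u' \<longrightarrow> i' \<le> i" using splits_le_first_split[OF fs] by blast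
    moreover have "g = Poly_Mapping.single (e, take i ws @ [w', w''] @ drop (i + 1) ws) ((-1) ^ i)" using g by (simp add: up_def)
    moreover have "G = (if i + 1 = length ws \<or> path_class T w'' \<otimes>\<^bsub>toupie_quot T\<^esub> path_class T (ws ! (i + 1)) = \<zero>\<^bsub>toupie_quot T\<^esub>
          then 0 else Poly_Mapping.single (e, take i ws @ [w', pcomp w'' (ws ! (i + 1))] @ drop (i + 2) ws) 1)"
      unfolding G cond[OF s] by (simp add: down_def)
    ultimately show "step (e, ws) i g G" unfolding step_def using s by blast
  qed
qed

text \<open>The first \<open>Suc k\<close> entries of \<open>down\<close> form a chain ending in
  \<open>w'\<close>, so its longest chain prefix ends later. This yields both termination and the
  increasing positions demanded by \<open>attached_terms\<close>.\<close>

lemma first_split_down_less: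
  assumes att: "attached T (e, ws)" and fs: "first_split e ws k w' w''"
    and vs: "down e ws k w' w'' = (e, vs)" and i: "first_split e vs i v' v''"
  shows "k < i"
proof -
  have s: "splits T e ws k w' w''" using fs by (simp add: first_split_def)
  have "take (Suc k) vs = take k ws @ [w']" using vs splitsD(1)[OF s] by (auto simp: down_def)
  moreover have "is_chain T (e, take k ws @ [w'])" using s unfolding splits_def by blast
  ultimately have "is_chain T (e, take (Suc k) vs)" by (simp only:)
  moreover have "\<not> is_chain T (e, take (Suc i) vs)" using i by (simp add: first_split_def)
  ultimately have "\<not> Suc i \<le> Suc k" using is_chain_take by blast
  then show ?thesis by simp
qed

lemma attached_terms_chain:
  assumes "is_chain T x"
  shows "attached_terms T x 0 (\<lambda>_. 0) (\<lambda>_. Poly_Mapping.single x 1)"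
proof -
  have "\<exists>y. is_chain T y \<and> Poly_Mapping.single x (1::'k) = Poly_Mapping.single y 1"
    using assms by blast
  then show ?thesis unfolding attached_terms_steps by simp
qed

lemma attached_terms_exist:
  assumes "attached T (e, ws)"
  shows "\<exists>n g G. attached_terms T (e, ws) n g G"
proof (cases "is_chain T (e, ws)")
  case True
  then show ?thesis using attached_terms_chain by blast
next
  case False
  obtain k w' w'' where "first_split e ws k w' w''" using first_splitI[OF assms False] .
  with assms show ?thesis
  \<comment> \<open>\<open>down\<close> keeps the number of entries while the split position
    increases, so this difference drops.\<close>
  proof (induction "length ws - k" arbitrary: ws k w' w'' rule: less_induct)
    case less
    note att = less.prems(1) and fs = less.prems(2)
    let ?u = "Poly_Mapping.single (up e ws k w' w'') ((-1) ^ k :: 'k)"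
    show ?case
    proof (cases "continues ws k w''")
      case False
      define G where "G j = (if j = 0 then Poly_Mapping.single (e, ws) 1 else 0 :: _ \<Rightarrow>\<^sub>0 'k)" for j :: nat
      have "step (e, ws) k ?u (G 1)"
        unfolding step_iff[OF att] using fs False by (auto simp: G_def)
      then have "attached_terms T (e, ws) 1 (\<lambda>_. ?u) G"
        unfolding attached_terms_steps
        by (intro conjI exI[of _ "\<lambda>_. k"] ballI exI[of _ "(e, ws)"]) (auto simp: G_def)
      then show ?thesis by blast
    next
      case True
      obtain vs where vs: "down e ws k w' w'' = (e, vs)" by (simp add: down_def)
      have attv: "attached T (e, vs)" using down_att[OF att fs True] vs by simp
      have lv: "length vs = length ws" using down_length[OF att fs True] vs by simp
      have kl: "k < length ws" using fs splitsD(1) unfolding first_split_def by blast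
      have "\<exists>n g G. attached_terms T (e, vs) n g G"
      proof (cases "is_chain T (e, vs)")
        case True
        then show ?thesis using attached_terms_chain by blast
      next
        case False
        obtain i v' v'' where i: "first_split e vs i v' v''" using first_splitI[OF attv False] .
        have "length vs - i < length ws - k" using first_split_down_less[OF att fs vs i] lv kl by simp
        from less.hyps[OF this attv i] show ?thesis .
      qed
      then obtain n g G where A: "attached_terms T (e, vs) n g G" by blast
      note A = A[unfolded attached_terms_steps]
      obtain I where I: "\<forall>j\<in>{1..n}. (\<exists>y. G (j - 1) = Poly_Mapping.single y 1 \<and> step y (I j) (g j) (G j)) \<and>
          (1 < j \<longrightarrow> I (j - 1) < I j)"
        using A by (elim conjE exE)
      have G: "G 0 = Poly_Mapping.single (e, vs) (1::'k)" using A by (elim conjE)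
      have st: "\<exists>y. G (j - 1) = Poly_Mapping.single y 1 \<and> step y (I j) (g j) (G j)" if "j \<in> {1..n}" for j
        using I that by blast
      have less: "I (j - 1) < I j" if "j \<in> {1..n}" "1 < j" for j using I that by blast
      have last: "G n = 0 \<or> (\<exists>y. is_chain T y \<and> G n = Poly_Mapping.single y 1)" using A by (elim conjE)
      \<comment> \<open>The run for \<open>down\<close>, shifted by one and preceded by the present
        step.\<close>
      define g' G' I' where "g' j = (if j = 1 then ?u else g (j - 1))"
        and "G' j = (if j = 0 then Poly_Mapping.single (e, ws) 1 else G (j - 1))"
        and "I' j = (if j = 1 then k else I (j - 1))" for j :: nat
      have "(\<exists>y. G' (j - 1) = Poly_Mapping.single y 1 \<and> step y (I' j) (g' j) (G' j)) \<and> (1 < j \<longrightarrow> I' (j - 1) < I' j)"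
        if j: "j \<in> {1..Suc n}" for j
      proof (cases "j = 1")
        case True
        have "step (e, ws) k ?u (G 0)"
          unfolding step_iff[OF att] using fs \<open>continues ws k w''\<close> G vs
          by (intro exI[of _ w'] exI[of _ w'']) simp
        then show ?thesis using True by (auto simp: G'_def g'_def I'_def)
      next
        case False
        then obtain m where m: "j = Suc m" "m \<in> {1..n}" using j by (cases j) auto
        have "I' (j - 1) < I' j"
        proof (cases "m = 1")
          \<comment> \<open>Only the comparison of the present position with the first one of the
            old run is new.\<close>
          case True
          obtain y where y: "G 0 = Poly_Mapping.single y 1" "step y (I 1) (g 1) (G 1)" using st[OF m(2)] True by auto
          then have "y = (e, vs)" using G single_one_inject by metis
          then obtain v' v'' where "first_split e vs (I 1) v' v''" using y(2) step_iff[OF attv] by auto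
          then show ?thesis using first_split_down_less[OF att fs vs] True m(1) by (simp add: I'_def)
        next
          case False
          then show ?thesis using less[OF m(2)] m by (auto simp: I'_def)
        qed
        then show ?thesis using st[OF m(2)] m by (auto simp: G'_def g'_def I'_def)
      qed
      then have "attached_terms T (e, ws) (Suc n) g' G'"
        unfolding attached_terms_steps using last
        by (intro conjI exI[of _ I'] ballI) (auto simp: G'_def)
      then show ?thesis by blast
    qed
  qed
qed

text \<open>Finiteness is part of the induction claim because the recursion for the total weights is
  available only with it.\<close>

lemma attached_terms_values:
  assumes "attached T x" "attached_terms T x n g G"
  shows "(\<forall>y. hp_target (length (snd x)) y \<longrightarrow> finite (zigzags x y)) \<and>
    h_map T (Poly_Mapping.single x 1) = (\<Sum>j=1..n. g j) \<and> p_map T (Poly_Mapping.single x 1) = G n"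
  using assms
proof (induction n arbitrary: x g G)
  case 0
  then have "is_chain T x" "G 0 = Poly_Mapping.single x 1"
    unfolding attached_terms_steps using single_one_inject single_one_neq_zero by metis+
  then show ?case using zigzags_chain hp_chain by simp
next
  case (Suc n)
  obtain e ws where x: "x = (e, ws)" by (cases x)
  note att = Suc.prems(1)[unfolded x]
  note A = Suc.prems(2)[unfolded attached_terms_steps]
  obtain I where *: "\<forall>j\<in>{1..Suc n}. (\<exists>y. G (j - 1) = Poly_Mapping.single y 1 \<and> step y (I j) (g j) (G j)) \<and>
      (1 < j \<longrightarrow> I (j - 1) < I j)"
    using A by (elim conjE exE)
  have G0: "G 0 = Poly_Mapping.single x 1" using A by (elim conjE)
  have st: "\<exists>y. G (j - 1) = Poly_Mapping.single y 1 \<and> step y (I j) (g j) (G j)" if "j \<in> {1..Suc n}" for j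
    using * that by blast
  have I: "I (j - 1) < I j" if "j \<in> {1..Suc n}" "1 < j" for j using * that by blast
  have fin: "G (Suc n) = 0 \<or> (\<exists>y. is_chain T y \<and> G (Suc n) = Poly_Mapping.single y 1)" using A by (elim conjE)
  define k where "k = I 1"
  obtain y where "G 0 = Poly_Mapping.single y 1" "step y k (g 1) (G 1)" using st[of 1] by (auto simp: k_def)
  then have "step (e, ws) k (g 1) (G 1)" using G0 single_one_inject x by metis
  then obtain w' w'' where fs: "first_split e ws k w' w''" and g1: "g 1 = Poly_Mapping.single (up e ws k w' w'') ((-1) ^ k)"
    and G1: "G 1 = (if continues ws k w'' then Poly_Mapping.single (down e ws k w' w'') 1 else 0)"
    unfolding step_iff[OF att] by blast
  show ?case
  proof (cases "continues ws k w''")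
    case True
    let ?d = "down e ws k w' w''"
    \<comment> \<open>Dropping the first step of a run for \<open>x\<close> leaves a run for
      \<open>down\<close>.\<close>
    have "attached_terms T ?d n (\<lambda>j. g (Suc j)) (\<lambda>j. G (Suc j))"
      unfolding attached_terms_steps
    proof (intro conjI exI[of _ "\<lambda>j. I (Suc j)"] ballI)
      show "G (Suc 0) = Poly_Mapping.single ?d 1" using G1 True by simp
      fix j assume j: "j \<in> {1..n}"
      show "\<exists>y. G (Suc (j - 1)) = Poly_Mapping.single y 1 \<and> step y (I (Suc j)) (g (Suc j)) (G (Suc j))"
        using st[of "Suc j"] j by simp
      show "1 < j \<longrightarrow> I (Suc (j - 1)) < I (Suc j)" using I[of "Suc j"] j by simp
    qed (rule fin)
    from Suc.IH[OF down_att[OF att fs True] this]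
    have IH: "\<And>y. hp_target (length ws) y \<Longrightarrow> finite (zigzags ?d y)"
        "h_map T (Poly_Mapping.single ?d 1) = (\<Sum>j=1..n. g (Suc j))" "p_map T (Poly_Mapping.single ?d 1) = G (Suc n)"
      using down_length[OF att fs True] by simp_all
    have "(\<Sum>j=1..Suc n. g j) = g 1 + (\<Sum>j=1..n. g (Suc j))"
      by (simp add: sum.atLeast_Suc_atMost sum.shift_bounds_cl_Suc_ivl del: sum.cl_ivl_Suc)
    then show ?thesis
      using finite_zigzags_step[OF att fs _ IH(1)] hp_step[OF att fs IH(1)] True IH(2,3) g1
      unfolding x by simp
  next
    case False
    \<comment> \<open>A further step would have to start from a single bar term, but
      \<open>G 1\<close> is zero.\<close>
    have "n = 0"
    proof (rule ccontr)
      assume "n \<noteq> 0"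
      then obtain y where "G 1 = Poly_Mapping.single y 1" using st[of 2] by auto
      then show False using G1 False single_one_neq_zero by metis
    qed
    then show ?thesis
      using finite_zigzags_step[OF att fs] hp_step[OF att fs] False g1 G1
      unfolding x by simp
  qed
qed

section \<open>The map \<open>i\<close> on chains\<close>

text \<open>The other kind of Uf-arrow out of a vertex would place the non-tip \<open>w\<close> in
  the tip ideal.\<close>

lemma chain_Cons_len:
  assumes "is_chain T (e, w # ws)"
  shows "len w = 1" "fst w = e"
proof -
  have w: "w \<in> NT" "uf_arrow T (e, []) w" using assms unfolding is_chain_iff by simp_all
  show "fst w = e" using uf_arrow_composable[OF w(2)] by (simp add: composable_iff)
  then have "pcomp (e, []) w = w" by (simp add: pcomp_def prod_eq_iff)
  then have "\<not> in_tip_ideal T (pcomp (e, []) w)" using w(1) by (simp add: in_tip_ideal_iff nontip_iff)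
  then show "len w = 1" using w(2) by (auto simp: uf_arrow_def)
qed

lemma chain_hastip:
  assumes "is_chain T (e, ws)" "Suc i < length ws"
  shows "hastip (pcomp (ws ! i) (ws ! Suc i))"
proof -
  have "successively (uf_arrow T) ((e, []) # ws)" "set ws \<subseteq> NT"
    using assms(1) unfolding is_chain_iff by simp_all
  moreover from this(2) have "ws ! i \<in> NT" using nth_mem[OF Suc_lessD[OF assms(2)]] by blast
  ultimately have *: "successively (uf_arrow T) ((e, []) # ws)" "ws ! i \<in> NT" by simp_all
  from successively_nth[OF *(1), of "Suc i"] *(2) show ?thesis
    using uf_arrow_hastip assms(2) by simp
qed

text \<open>A tip inside the product ends where the product ends, by minimality of the Uf-arrow. It
  also starts where the product starts: \<open>u\<close> is one arrow, so a later start would place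
  the tip inside the non-tip \<open>v\<close>.\<close>

lemma chain_two_tip:
  assumes c: "is_chain T (e, [u, v])"
  shows "pcomp u v \<in> tips T"
proof -
  have uv: "u \<in> NT" "v \<in> NT" "uf_arrow T u v" using c unfolding is_chain_iff by simp_all
  have P: "pcomp u v \<in> Pths"
    using uv uf_arrow_composable[OF uv(3)] by (simp add: pcomp_in_paths_iff nontip_iff)
  have lu: "len u = 1" using chain_Cons_len(1)[OF c] .
  obtain t where t: "t \<in> tips T" "sublist (snd t) (snd (pcomp u v))"
    using uf_arrow_hastip[OF uv(3)] uv(1) hastip_iff[OF P] by auto
  then obtain a b where ab: "snd (pcomp u v) = a @ snd t @ b" by (auto simp: sublist_def)
  have "b = []"
  proof (rule ccontr)
    assume b: "b \<noteq> []"
    note f = path_factor[OF P, of "a @ snd t" b, unfolded ab, simplified]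
    have "hastip (fst (pcomp u v), a @ snd t)" using t(1) hastip_iff[OF f(1)] by auto
    then have tip: "in_tip_ideal T (fst (pcomp u v), a @ snd t)" using f(1) by (simp add: in_tip_ideal_iff)
    have "len u \<noteq> 0" using lu by simp
    then have min: "\<forall>w\<in>Pths. \<forall>p\<in>Pths.
         composable Q w p \<and> pcomp u v = pcomp w p \<and> 1 \<le> len p \<longrightarrow> \<not> in_tip_ideal T w"
      using uv(3) unfolding uf_arrow_def by blast
    have "1 \<le> len (awlast (fst (pcomp u v)) (a @ snd t), b)" using b by (simp add: Suc_le_eq)
    with f tip min show False by blast
  qed
  moreover have "a = []"
  proof (rule ccontr)
    assume "a \<noteq> []"
    obtain x where x: "snd u = [x]" using lu by (cases "snd u") auto
    obtain a' where "a = x # a'" using ab \<open>a \<noteq> []\<close> x by (cases a) (auto simp: pcomp_def)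
    then have "snd v = a' @ snd t @ b" using ab x by (simp add: pcomp_def)
    then have "sublist (snd t) (snd v)" by (auto simp: sublist_def)
    moreover have "v \<in> Pths" "\<not> hastip v" using uv(2) by (simp_all add: nontip_iff)
    ultimately show False using t(1) hastip_iff by blast
  qed
  ultimately have "t = pcomp u v"
    using ab P t(1) tips_paths tips_nonempty by (intro path_eqI) auto
  then show ?thesis using t(1) by simp
qed

lemma tip_inv_pivot:
  assumes i: "i \<in> {1..num_rels T}"
  shows "tip_inv T (branch4 T (pivot T i)) = rho T i"
proof -
  let ?b = "branch4 T (pivot T i)"
  have b: "?b \<in> tips T" using i by (auto simp: tips_def)
  then have "subpath Q ?b ?b" using tips_paths tips_nonempty by (subst subpath_iff) auto
  then have "?b \<notin> mon_rels T" using branch4_no_mon[OF pivot_in[OF i]] by blast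
  moreover have "(THE j. j \<in> {1..num_rels T} \<and> branch4 T (pivot T j) = ?b) = i"
  proof (rule the_equality)
    fix j assume j: "j \<in> {1..num_rels T} \<and> branch4 T (pivot T j) = ?b"
    then have "pivot T j = pivot T i"
      using inj_onD[OF branch4_inj] pivot_in i by blast
    then show "j = i" using strict_mono_on_eqD[OF pivot_mono] i j by metis
  qed (use i in simp)
  ultimately show ?thesis by (simp add: tip_inv_def)
qed

text \<open>Treats both kinds of tips at once: for a monomial tip the right-hand side is 0.\<close>

lemma expand_tip:
  assumes t: "t \<in> tips T"
  shows "expand T (path_class T t) = Poly_Mapping.single t 1 - tip_inv T t"
proof (cases "t \<in> mon_rels T")
  case True
  then have "subpath Q t t" using t tips_paths tips_nonempty by (subst subpath_iff) auto
  from expand_mon[OF True this] True show ?thesis by (simp add: tip_inv_def)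
next
  case False
  then obtain i where "i \<in> {1..num_rels T}" "t = branch4 T (pivot T i)" using t by (auto simp: tips_def)
  then show ?thesis by (simp add: expand_pivot tip_inv_pivot)
qed

lemma tip_inv_tip: "t \<in> tips T \<Longrightarrow> Poly_Mapping.lookup (tip_inv T t) t = 1"
proof (cases "t \<in> mon_rels T")
  case True
  then show ?thesis by (simp add: tip_inv_def)
next
  case False
  moreover assume "t \<in> tips T"
  ultimately obtain i where "i \<in> {1..num_rels T}" "t = branch4 T (pivot T i)" by (auto simp: tips_def)
  then show ?thesis by (simp add: tip_inv_pivot lookup_rho_pivot)
qed

lemma keys_tip_inv:
  assumes t: "t \<in> tips T" and b: "b \<in> Poly_Mapping.keys (tip_inv T t)" "b \<noteq> t"
  shows "b \<in> nontip T" "2 \<le> len b" "fst b = fst t"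
proof -
  have "t \<notin> mon_rels T" using b by (auto simp: tip_inv_def split: if_splits)
  then obtain i where i: "i \<in> {1..num_rels T}" "t = branch4 T (pivot T i)" using t by (auto simp: tips_def)
  then have bi: "b \<in> Poly_Mapping.keys (rho T i)" using b(1) by (simp add: tip_inv_pivot)
  then have "b \<in> Poly_Mapping.keys (Poly_Mapping.single t 1 - rho T i)" using b(2) by (simp add: in_keys_iff lookup_minus lookup_single)
  then show "b \<in> nontip T" using rho_minus_tip_nontip[OF i(1)] i(2) by auto
  show "2 \<le> len b" using rel_ideal_len[OF rho_in_ideal[OF i(1)] bi] .
  show "fst b = fst t"
    using bi keys_rho[OF i(1)] branch4_in_branches i pivot_in[OF i(1)] by (fastforce simp: branches_def)
qed

lemma bar_diff_chain:
  assumes c: "is_chain T (e, ws)" and l: "length ws \<noteq> 2"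
  shows "bar_diff T (e, ws) = 0"
proof -
  have bar: "(e, ws) \<in> bar_terms T (length ws)" using c chain_terms_bar_terms by auto
  have "face e ws j = 0" if j: "j \<in> {1..<length ws}" for j
  proof -
    obtain i where i: "j = Suc i" "Suc i < length ws" using j by (cases j) auto
    then have "3 \<le> length ws" using l by simp
    then show ?thesis
      unfolding i using face_zero[OF bar i(2) chain_hastip[OF c i(2)]] bar_terms_pair_not_pivot[OF bar i(2)] by blast
  qed
  then show ?thesis unfolding bar_diff_face by (intro sum.neutral) blast
qed

lemma zigzags_from_chain:
  assumes c: "is_chain T x" and xs: "zigzag T (x # z # zs)"
  shows "undotted T x z" "zs \<noteq> [] \<Longrightarrow> dotted T z (hd zs)"
proof -
  show u: "undotted T x z" using xs chain_not_dotted[OF c] unfolding zigzag_Cons2 by blast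
  assume "zs \<noteq> []"
  then obtain y ys where zs: "zs = y # ys" by (cases zs) auto
  then have "\<not> undotted T z y" "dotted T z y \<or> undotted T z y"
    using xs chain_not_dotted[OF c] by (auto simp: zigzag_Cons2)
  then show "dotted T z (hd zs)" using zs by simp
qed

lemma i_map_isolated_chain:
  assumes c: "is_chain T (e, ws)" and l: "length ws \<noteq> 2"
  shows "i_map T (Poly_Mapping.single (e, ws) 1) = Poly_Mapping.single (e, ws) 1"
proof -
  have bar: "(e, ws) \<in> bar_terms T (length ws)" using c chain_terms_bar_terms by auto
  have nu: "\<not> undotted T (e, ws) z" for z
    using bar_diff_chain[OF c l] by (simp add: undotted_def bar_arrow_def bar_weight_def)
  have zz: "zigzags (e, ws) y = (if y = (e, ws) then {[(e, ws)]} else {})" for y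
  proof -
    have "xs = [(e, ws)]" if "xs \<in> zigzags (e, ws) y" for xs
    proof -
      have xs: "zigzag T xs" "hd xs = (e, ws)" "xs \<noteq> []" using that by (auto simp: zigzags_def zigzag_def)
      show ?thesis
      proof (cases "tl xs")
        case Nil
        then show ?thesis using xs by (cases xs) auto
      next
        case (Cons z zs)
        then have "xs = (e, ws) # z # zs" using xs by (cases xs) auto
        then show ?thesis using zigzags_from_chain(1)[OF c] xs nu by blast
      qed
    qed
    then have "zigzags (e, ws) y \<subseteq> {[(e, ws)]}" by blast
    moreover have "[(e, ws)] \<in> zigzags (e, ws) y \<longleftrightarrow> y = (e, ws)"
      using bar by (auto simp: zigzags_def zigzag_singleton)
    ultimately show ?thesis by (cases "y = (e, ws)") auto
  qed
  have "i_map T (Poly_Mapping.single (e, ws) 1) = (\<Sum>y\<in>bar_terms T (length ws). if y = (e, ws) then Poly_Mapping.single (e, ws) 1 else 0)"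
    unfolding i_map_single total_weight_zigzags zz
    by (intro sum.cong) (auto simp: zigzag_weight_singleton)
  then show ?thesis using bar finite_bar_terms by simp
qed

section \<open>Zigzag paths from a chain of degree 2\<close>

context
  fixes e u v
  assumes c: "is_chain T (e, [u, v])"
begin

lemma two_bar: "(e, [u, v]) \<in> bar_terms T 2"
  using subsetD[OF chain_terms_bar_terms c] by (simp add: numeral_2_eq_2)

text \<open>The only face has sign -1, and the normal form of the tip is the tip minus its relation;
  the two signs cancel and leave the coefficient of the branch in the relation.\<close>

lemma bar_weight_two:
  "bar_weight T (e, [u, v]) z = (\<Sum>b\<in>Poly_Mapping.keys (tip_inv T (pcomp u v)) - {pcomp u v}.
     if z = (e, [b]) then Poly_Mapping.lookup (tip_inv T (pcomp u v)) b else 0)"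
proof -
  let ?t = "pcomp u v" and ?c = "Poly_Mapping.lookup (tip_inv T (pcomp u v))"
  let ?y = "Poly_Mapping.single ?t 1 - tip_inv T ?t"
  have t: "?t \<in> tips T" using chain_two_tip[OF c] .
  have y: "Poly_Mapping.lookup ?y b = (if b = ?t then 0 else - ?c b)" for b
    using tip_inv_tip[OF t] by (simp add: lookup_minus lookup_single when_def)
  have "b \<in> Poly_Mapping.keys ?y \<longleftrightarrow> b \<in> Poly_Mapping.keys (tip_inv T ?t) - {?t}" for b
    by (simp add: in_keys_iff y)
  then have keys_y: "Poly_Mapping.keys ?y = Poly_Mapping.keys (tip_inv T ?t) - {?t}" by blast
  have "bar_diff T (e, [u, v]) = face e [u, v] (Suc 0)"
    by (simp add: bar_diff_face numeral_2_eq_2)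
  also have "\<dots> = (\<Sum>b\<in>Poly_Mapping.keys ?y. Poly_Mapping.single (e, [b]) (- Poly_Mapping.lookup ?y b))"
    using face_eq[OF two_bar, of 0] by (simp add: expand_tip[OF t] Let_def)
  also have "\<dots> = (\<Sum>b\<in>Poly_Mapping.keys ?y. Poly_Mapping.single (e, [b]) (?c b))"
    using keys_y by (intro sum.cong refl) (auto simp: y)
  finally show ?thesis
    by (simp add: bar_weight_def keys_y lookup_sum lookup_single when_def eq_commute[of z])
qed

lemma undotted_two_iff: "undotted T (e, [u, v]) z \<longleftrightarrow>
    (\<exists>b\<in>Poly_Mapping.keys (tip_inv T (pcomp u v)) - {pcomp u v}. z = (e, [b]))"
proof
  assume un: "undotted T (e, [u, v]) z"
  then have "bar_weight T (e, [u, v]) z \<noteq> 0" by (simp add: undotted_def bar_arrow_def)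
  then obtain b where "b \<in> Poly_Mapping.keys (tip_inv T (pcomp u v)) - {pcomp u v}"
      "(if z = (e, [b]) then Poly_Mapping.lookup (tip_inv T (pcomp u v)) b else 0) \<noteq> 0"
    unfolding bar_weight_two by (rule sum.not_neutral_contains_not_neutral)
  then show "\<exists>b\<in>Poly_Mapping.keys (tip_inv T (pcomp u v)) - {pcomp u v}. z = (e, [b])"
    by (auto split: if_splits)
next
  assume "\<exists>b\<in>Poly_Mapping.keys (tip_inv T (pcomp u v)) - {pcomp u v}. z = (e, [b])"
  then obtain b where b: "b \<in> Poly_Mapping.keys (tip_inv T (pcomp u v))" "b \<noteq> pcomp u v" and z: "z = (e, [b])" by blast
  note kb = keys_tip_inv[OF chain_two_tip[OF c] b]
  have "bar_weight T (e, [u, v]) z = Poly_Mapping.lookup (tip_inv T (pcomp u v)) b"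
    unfolding bar_weight_two z using b by (simp add: sum.delta)
  then have w: "bar_weight T (e, [u, v]) z \<noteq> 0" using b(1) by (simp add: in_keys_iff)
  have "fst b = e" using kb(3) chain_Cons_len(2)[OF c] by (simp add: pcomp_def)
  then have "z \<in> bar_terms T 1"
    using kb two_bar unfolding z bar_terms_iff by (auto simp: composable_iff)
  then have arr: "bar_arrow T (e, [u, v]) z" using w two_bar unfolding bar_arrow_def by blast
  have "\<not> matched T (e, [u, v]) z"
    using matched_source_not_chain c by blast
  with arr show "undotted T (e, [u, v]) z" by (simp add: undotted_def)
qed

lemma weight_two: "b \<in> Poly_Mapping.keys (tip_inv T (pcomp u v)) \<Longrightarrow> b \<noteq> pcomp u v \<Longrightarrow>
    arrow_weight T (e, [u, v]) (e, [b]) = Poly_Mapping.lookup (tip_inv T (pcomp u v)) b"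
  using chain_not_dotted[OF c] unfolding arrow_weight_def bar_weight_two by (simp add: sum.delta)

lemma attached_single:
  assumes "b \<in> Poly_Mapping.keys (tip_inv T (pcomp u v))" "b \<noteq> pcomp u v"
  shows "attached T (e, [b])"
proof -
  have "undotted T (e, [u, v]) (e, [b])" using assms undotted_two_iff by blast
  then obtain n where "(e, [b]) \<in> bar_terms T n" unfolding undotted_def bar_arrow_def by blast
  then show ?thesis unfolding attached_iff by (simp add: bar_terms_iff)
qed

lemma first_split_single:
  assumes b: "pcomp p q \<in> Poly_Mapping.keys (tip_inv T (pcomp u v))" "pcomp p q \<noteq> pcomp u v"
    and pq: "p \<in> Pths" "q \<in> Pths" "composable Q p q" "len p = 1"
  shows "first_split e [pcomp p q] 0 p q" "(e, [p, q]) \<in> bar_terms T 2"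
proof -
  note kb = keys_tip_inv[OF chain_two_tip[OF c] b]
  have e: "fst p = e" using kb(3) chain_Cons_len(2)[OF c] by (simp add: pcomp_def)
  have ev: "e \<in> verts Q" using two_bar by (simp add: bar_terms_iff)
  have "p \<in> nontip T" using pq arrow_not_hastip by (simp add: nontip_iff)
  moreover have "uf_arrow T (e, []) p"
    using pq e ev by (auto simp: uf_arrow_def uf_verts_def composable_iff paths_iff awalk_Nil_iff)
  ultimately have "is_chain T (e, [p])" unfolding is_chain_iff using ev pq(4) by simp
  moreover have "\<not> is_chain T (e, [pcomp p q])" using chain_Cons_len(1)[of e "pcomp p q" "[]"] kb(2) by auto
  ultimately show fs: "first_split e [pcomp p q] 0 p q"
    using pq kb(2) by (simp add: first_split_def splits_def)
  show "(e, [p, q]) \<in> bar_terms T 2"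
    using up_bar[OF attached_single[OF b] fs] by (simp add: up_def numeral_2_eq_2)
qed

text \<open>A nontrivial path goes down to another branch of the relation and up again by splitting
  off its first arrow. Longer paths do not exist, since a one-entry term has no next entry to merge
  with.\<close>

lemma zigzags_two:
  assumes y: "length (snd y) = 2"
  shows "zigzags (e, [u, v]) y = (if y = (e, [u, v]) then {[(e, [u, v])]} else {}) \<union>
    {[(e, [u, v]), (e, [pcomp p q]), y] | p q. p \<in> Pths \<and> q \<in> Pths \<and> composable Q p q \<and> len p = 1 \<and>
       pcomp p q \<in> Poly_Mapping.keys (tip_inv T (pcomp u v)) \<and> pcomp p q \<noteq> pcomp u v \<and> y = (e, [p, q])}"
    (is "_ = ?A \<union> ?B")
proof (intro equalityI subsetI)
  let ?x = "(e, [u, v])"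
  fix xs assume "xs \<in> zigzags ?x y"
  then have xs: "zigzag T xs" "hd xs = ?x" "last xs = y" "xs \<noteq> []" by (auto simp: zigzags_def zigzag_def)
  show "xs \<in> ?A \<union> ?B"
  proof (cases "tl xs")
    case Nil
    then have "xs = [?x]" using xs by (cases xs) auto
    then show ?thesis using xs by auto
  next
    case (Cons z zs)
    then have eq: "xs = ?x # z # zs" using xs by (cases xs) auto
    then have "undotted T ?x z" using zigzags_from_chain(1)[OF c] xs by blast
    then obtain b where b: "b \<in> Poly_Mapping.keys (tip_inv T (pcomp u v))" "b \<noteq> pcomp u v" "z = (e, [b])"
      using undotted_two_iff by blast
    have att: "attached T (e, [b])" using attached_single b by blast
    have "\<not> is_chain T (e, [b])"
      using chain_Cons_len(1)[of e b "[]"] keys_tip_inv(2)[OF chain_two_tip[OF c] b(1,2)] by auto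
    then obtain k p q where fs: "first_split e [b] k p q" using first_splitI[OF att] by blast
    then have s: "splits T e [b] k p q" by (simp add: first_split_def)
    note s = splitsD[OF s]
    have k: "k = 0" using s(1) by simp
    have bpq: "b = pcomp p q" using s(7) k by simp
    have lp: "len p = 1"
    proof -
      have "is_chain T (e, [p])" using fs k unfolding first_split_def splits_def by simp
      then show ?thesis by (rule chain_Cons_len(1))
    qed
    have ne: "zs \<noteq> []" using xs(3) y eq b(3) by auto
    then obtain r rs where zs: "zs = r # rs" by (cases zs) auto
    have "dotted T z r" using zigzags_from_chain(2)[OF c, of z zs] xs(1) eq ne zs by simp
    then have r: "r = (e, [p, q])" using dotted_iff[OF att fs] b(3) k by (simp add: up_def)
    \<comment> \<open>\<open>continues\<close> fails for the one-entry list \<open>[b]\<close>, so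
      no undotted arrow leaves \<open>up\<close>.\<close>
    have "rs = []"
    proof (rule ccontr)
      assume "rs \<noteq> []"
      then obtain a as where rs: "rs = a # as" by (cases rs) auto
      then have "undotted T r a"
        using xs(1) \<open>dotted T z r\<close> unfolding eq zs zigzag_Cons2[of ?x] zigzag_Cons2[of z] by simp
      then have "undotted T (up e [b] k p q) a" using r k by (simp add: up_def)
      then show False using undotted_up_iff[OF att fs] by (simp add: continues_def)
    qed
    then have "y = r" using xs(3) eq zs by simp
    then have "xs \<in> ?B" using eq zs \<open>rs = []\<close> r b bpq lp s by auto
    then show ?thesis by blast
  qed
next
  let ?x = "(e, [u, v])"
  fix xs assume "xs \<in> ?A \<union> ?B"
  then consider "xs = [?x]" "y = ?x" | p q where "xs = [?x, (e, [pcomp p q]), y]" "p \<in> Pths" "q \<in> Pths"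
      "composable Q p q" "len p = 1" "pcomp p q \<in> Poly_Mapping.keys (tip_inv T (pcomp u v))" "pcomp p q \<noteq> pcomp u v"
      "y = (e, [p, q])"
    by (auto split: if_splits)
  then show "xs \<in> zigzags ?x y"
  proof cases
    case 1
    then show ?thesis using two_bar by (auto simp: zigzags_def zigzag_singleton)
  next
    case (2 p q)
    note fs = first_split_single[OF 2(6,7,2-5)]
    have "undotted T ?x (e, [pcomp p q])" using undotted_two_iff 2 by blast
    moreover have att: "attached T (e, [pcomp p q])" using attached_single 2 by blast
    then have "dotted T (e, [pcomp p q]) y" using dotted_iff[OF att fs(1)] 2 by (simp add: up_def)
    moreover have "(e, [pcomp p q]) \<in> bar_terms T 1" using att by (simp add: attached_iff)
    ultimately show ?thesis
      using 2 two_bar fs(2) chain_not_dotted[OF c] not_dotted_undotted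
      by (auto simp: zigzags_def zigzag_Cons2 zigzag_singleton)
  qed
qed

text \<open>The trivial path fits the same formula, because the tip has coefficient 1 in its
  relation.\<close>

lemma total_weight_two:
  assumes y: "(e', [p, q]) \<in> bar_terms T 2"
  shows "total_weight T (e, [u, v]) (e', [p, q]) =
    (if e' = e \<and> len p = 1 then Poly_Mapping.lookup (tip_inv T (pcomp u v)) (pcomp p q) else 0)"
proof -
  let ?x = "(e, [u, v])" and ?y = "(e', [p, q])" and ?c = "Poly_Mapping.lookup (tip_inv T (pcomp u v))"
  have pq: "p \<in> Pths" "q \<in> Pths" "composable Q p q" "fst p = e'"
    using y by (auto simp: bar_terms_iff nontip_iff composable_iff)
  \<comment> \<open>\<open>u\<close> is a single arrow too, so the factorization of the tip with an
    arrow in front is unique.\<close>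
  have same: "?y = ?x \<longleftrightarrow> e' = e \<and> len p = 1 \<and> pcomp p q = pcomp u v"
  proof
    assume "e' = e \<and> len p = 1 \<and> pcomp p q = pcomp u v"
    moreover have "len u = 1" using chain_Cons_len(1)[OF c] .
    moreover have "composable Q u v" using bar_terms_pair(1)[OF two_bar, of 0] by simp
    ultimately show "?y = ?x"
      using pq chain_Cons_len(2)[OF c]
      by (auto simp: pcomp_def prod_eq_iff composable_iff)
  qed (use chain_Cons_len(1)[OF c] in simp)
  let ?ok = "e' = e \<and> len p = 1 \<and> pcomp p q \<in> Poly_Mapping.keys (tip_inv T (pcomp u v)) \<and> pcomp p q \<noteq> pcomp u v"
  have zz: "zigzags ?x ?y = (if ?y = ?x then {[?x]} else {}) \<union>
      (if ?ok then {[?x, (e, [pcomp p q]), ?y]} else {})"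
    unfolding zigzags_two[of ?y, simplified] using pq by auto
  consider "?y = ?x" | "?ok" | "?y \<noteq> ?x" "\<not> ?ok" by blast
  then show ?thesis
  proof cases
    case 1
    then show ?thesis
      unfolding total_weight_zigzags zz
      using tip_inv_tip[OF chain_two_tip[OF c]] chain_Cons_len(1)[OF c] by (simp add: zigzag_weight_singleton)
  next
    case 2
    then have "?y \<noteq> ?x" using same by blast
    have ok: "pcomp p q \<in> Poly_Mapping.keys (tip_inv T (pcomp u v))" "pcomp p q \<noteq> pcomp u v" "len p = 1" using 2 by simp_all
    have fs: "first_split e [pcomp p q] 0 p q" using first_split_single(1)[OF ok(1,2) pq(1-3) ok(3)] .
    \<comment> \<open>The split is at position 0, so the dotted arrow has weight
      \<open>(-1) ^ 0\<close>.\<close>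
    have "arrow_weight T (e, [pcomp p q]) ?y = 1"
      using arrow_weight_up[OF attached_single[OF ok(1,2)] fs] 2 by (simp add: up_def)
    then show ?thesis
      unfolding total_weight_zigzags zz using 2 \<open>?y \<noteq> ?x\<close> weight_two[OF ok(1,2)]
      by (simp add: zigzag_weight_Cons2 zigzag_weight_singleton)
  next
    case 3
    then have "?c (pcomp p q) = 0" if "e' = e \<and> len p = 1"
      using that same by (auto simp: in_keys_iff)
    moreover have "zigzags ?x ?y = {}" unfolding zz using 3 by (simp only: if_False Un_empty_left simp_thms)
    ultimately show ?thesis unfolding total_weight_zigzags by auto
  qed
qed

lemma i_map_two:
  "i_map T (Poly_Mapping.single (e, [u, v]) 1) =
     (\<Sum>(p, q)\<in>{(p, q). p \<in> Pths \<and> q \<in> Pths \<and> composable Q p q \<and> len p = 1 \<and>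
                      pcomp p q \<in> Poly_Mapping.keys (tip_inv T (pcomp u v))}.
        Poly_Mapping.single (e, [p, q]) (Poly_Mapping.lookup (tip_inv T (pcomp u v)) (pcomp p q)))"
    (is "_ = (\<Sum>(p, q)\<in>?S. ?f p q)")
proof -
  let ?g = "\<lambda>(p, q). (e, [p, q])"
  have inj: "inj_on ?g ?S" by (auto simp: inj_on_def)
  have sub: "?g ` ?S \<subseteq> bar_terms T 2"
  proof clarify
    fix p q assume h: "p \<in> Pths" "q \<in> Pths" "composable Q p q" "len p = 1"
      "pcomp p q \<in> Poly_Mapping.keys (tip_inv T (pcomp u v))"
    show "(e, [p, q]) \<in> bar_terms T 2"
    proof (cases "pcomp p q = pcomp u v")
      case True
      moreover have "len u = 1" "fst u = e" using chain_Cons_len[OF c] by simp_all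
      moreover have "composable Q u v" using bar_terms_pair(1)[OF two_bar, of 0] by simp
      ultimately have "p = u" "q = v"
        using h by (auto simp: pcomp_def prod_eq_iff composable_iff)
      then show ?thesis using two_bar by simp
    next
      case False
      then show ?thesis using first_split_single(2)[OF h(5) False h(1-4)] by simp
    qed
  qed
  have zero: "total_weight T (e, [u, v]) y = 0" if y: "y \<in> bar_terms T 2 - ?g ` ?S" for y
  proof -
    obtain e' p q where eq: "y = (e', [p, q])"
      using y bar_terms_length[of y 2] by (cases y) (auto simp: length_Suc_conv numeral_2_eq_2)
    have bar: "(e', [p, q]) \<in> bar_terms T 2" using y eq by blast
    then have pq: "p \<in> Pths" "q \<in> Pths" "composable Q p q"
      by (auto simp: bar_terms_iff nontip_iff)
    have "pcomp p q \<notin> Poly_Mapping.keys (tip_inv T (pcomp u v))" if "e' = e" "len p = 1"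
      using y eq pq that by force
    then show ?thesis unfolding eq total_weight_two[OF bar] by (auto simp: in_keys_iff)
  qed
  have "i_map T (Poly_Mapping.single (e, [u, v]) 1) = (\<Sum>y\<in>bar_terms T 2. Poly_Mapping.single y (total_weight T (e, [u, v]) y))"
    by (simp add: i_map_single numeral_2_eq_2)
  also have "\<dots> = (\<Sum>y\<in>?g ` ?S. Poly_Mapping.single y (total_weight T (e, [u, v]) y))"
    using sub zero finite_bar_terms by (intro sum.mono_neutral_right) auto
  also have "\<dots> = (\<Sum>s\<in>?S. Poly_Mapping.single (?g s) (total_weight T (e, [u, v]) (?g s)))"
    by (rule sum.reindex_cong[OF inj]) simp_all
  also have "\<dots> = (\<Sum>(p, q)\<in>?S. ?f p q)"
  proof (rule sum.cong[OF refl], clarify)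
    fix p q assume h: "p \<in> Pths" "q \<in> Pths" "composable Q p q" "len p = 1"
      "pcomp p q \<in> Poly_Mapping.keys (tip_inv T (pcomp u v))"
    then have "(e, [p, q]) \<in> bar_terms T 2" using sub by force
    from total_weight_two[OF this] h(4)
    show "Poly_Mapping.single (e, [p, q]) (total_weight T (e, [u, v]) (e, [p, q])) = ?f p q" by simp
  qed
  finally show ?thesis .
qed

end

end

text \<open>As \<open>attached_terms\<close> is a relation, the claim has two halves: some
  terminating run exists, and every run yields the values of h and p. Factorizations into two paths
  are indexed by pairs.\<close>

theorem lemma4p6:
  fixes T :: "('v, 'e, 'k::field_char_0) toupie_data"
  assumes "toupie_algebra T"
  shows
    "(\<forall>\<gamma>. attached T \<gamma> \<longrightarrow>
        (\<exists>n g \<Gamma>. attached_terms T \<gamma> n g \<Gamma>) \<and>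
        (\<forall>n g \<Gamma>. attached_terms T \<gamma> n g \<Gamma> \<longrightarrow>
           h_map T (Poly_Mapping.single \<gamma> 1) = (\<Sum>j=1..n. g j) \<and>
           p_map T (Poly_Mapping.single \<gamma> 1) = \<Gamma> n)) \<and>
     (\<forall>e ws r. (e, ws) \<in> chain_terms T (r + 1) \<longrightarrow>
        i_map T (Poly_Mapping.single (e, ws) 1) =
          (if r \<noteq> 1 then Poly_Mapping.single (e, ws) 1
           else (\<Sum>(p\<^sub>1, p\<^sub>2)\<in>{(p\<^sub>1, p\<^sub>2). p\<^sub>1 \<in> paths (quiver T) \<and> p\<^sub>2 \<in> paths (quiver T) \<and>
                      composable (quiver T) p\<^sub>1 p\<^sub>2 \<and> len p\<^sub>1 = 1 \<and>
                      pcomp p\<^sub>1 p\<^sub>2 \<in> Poly_Mapping.keys (tip_inv T (pcomp (ws ! 0) (ws ! 1)))}.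
                   Poly_Mapping.single (e, [p\<^sub>1, p\<^sub>2])
                     (Poly_Mapping.lookup (tip_inv T (pcomp (ws ! 0) (ws ! 1))) (pcomp p\<^sub>1 p\<^sub>2)))))"
proof (intro conjI allI impI)
  interpret toupie_presentation T by unfold_locales (rule assms)
  show "\<exists>n g \<Gamma>. attached_terms T \<gamma> n g \<Gamma>" if "attached T \<gamma>" for \<gamma>
    using attached_terms_exist that by (cases \<gamma>) simp
  show "h_map T (Poly_Mapping.single \<gamma> 1) = (\<Sum>j=1..n. g j)" "p_map T (Poly_Mapping.single \<gamma> 1) = \<Gamma> n"
    if "attached T \<gamma>" "attached_terms T \<gamma> n g \<Gamma>" for \<gamma> n g \<Gamma>
    using attached_terms_values[OF that] by simp_all
  fix e ws r
  assume ch: "(e, ws) \<in> chain_terms T (r + 1)"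
  then have l: "length ws = r + 1" using chain_terms_length by fastforce
  then have c: "is_chain T (e, ws)" using ch by simp
  show "i_map T (Poly_Mapping.single (e, ws) 1) =
          (if r \<noteq> 1 then Poly_Mapping.single (e, ws) 1
           else (\<Sum>(p\<^sub>1, p\<^sub>2)\<in>{(p\<^sub>1, p\<^sub>2). p\<^sub>1 \<in> paths (quiver T) \<and> p\<^sub>2 \<in> paths (quiver T) \<and>
                      composable (quiver T) p\<^sub>1 p\<^sub>2 \<and> len p\<^sub>1 = 1 \<and>
                      pcomp p\<^sub>1 p\<^sub>2 \<in> Poly_Mapping.keys (tip_inv T (pcomp (ws ! 0) (ws ! 1)))}.
                   Poly_Mapping.single (e, [p\<^sub>1, p\<^sub>2])
                     (Poly_Mapping.lookup (tip_inv T (pcomp (ws ! 0) (ws ! 1))) (pcomp p\<^sub>1 p\<^sub>2))))"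
  proof (cases "r = 1")
    case True
    then obtain u v where "ws = [u, v]" using l by (auto simp: length_Suc_conv numeral_2_eq_2)
    then show ?thesis using i_map_two[of e u v] c True by simp
  next
    case False
    then show ?thesis using i_map_isolated_chain[OF c] l by simp
  qed
qed

end
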